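(* Let $p$ be a prime. A (possibly infinite) $p$-group $G$ is a cut-group if, and only if, one of the following holds: (i) $p=2$ and, for all $a\in\Phi^+(G)$, $a^3\sim_G a$ or $a^3\sim_G a^{-1}$; (ii) $p=3$ and $a^2\sim_G a^{-1}$ for all $a\in\Phi^+(G)$; (iii) $\Phi^+(G)=\{1\}$.
   Context: For a group $G$, $\mathcal{U}(\mathbb{Z}[G])$ is the group of units of the integral group ring $\mathbb{Z}[G]$ and $\mathcal{Z}(\cdot)$ denotes the center of a group. $G$ is called a cut-group if $\mathcal{Z}(\mathcal{U}(\mathbb{Z}[G]))=\pm\mathcal{Z}(G)$. $\Phi(G)$ denotes the FC-subgroup of $G$, i.e. the subgroup of elements having only finitely many conjugates in $G$, and $\Phi^+(G)$ denotes the torsion subgroup of $\Phi(G)$. $y\sim_G z$ means that $y$ and $z$ are conjugate in $G$. A $p$-group is a group in which every element has order a power of $p$. *)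

theory Defs
  imports
    "HOL-Algebra.Multiplicative_Group"
    "HOL-Algebra.Free_Abelian_Groups"
    "HOL-Computational_Algebra.Primes"
begin

(* The additive group is the free abelian group on the carrier of G, as in
   free_Abelian_group; the product is the bilinear extension of that of G,
   i.e. (SUM x. f x * x) (SUM y. g y * y) = (SUM x y. f x * g y * xy). *)
definition integral_group_ring :: "('a, 'b) monoid_scheme \<Rightarrow> ('a \<Rightarrow>\<^sub>0 int) ring"
  where "integral_group_ring G =
    \<lparr>carrier = {f. Poly_Mapping.keys f \<subseteq> carrier G},
     monoid.mult = (\<lambda>f g. frag_extend (\<lambda>x. frag_extend (\<lambda>y. frag_of (x \<otimes>\<^bsub>G\<^esub> y)) g) f),
     monoid.one = frag_of \<one>\<^bsub>G\<^esub>,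
     ring.zero = 0,
     ring.add = (+)\<rparr>"

lemma keys_frag_extend_subset: "(\<And>x. x \<in> Poly_Mapping.keys f \<Longrightarrow> Poly_Mapping.keys (b x) \<subseteq> A) \<Longrightarrow> Poly_Mapping.keys (frag_extend b f) \<subseteq> A"
  using keys_frag_extend by fastforce

lemma frag_extend_compose: "frag_extend b (frag_extend c f) = frag_extend (\<lambda>x. frag_extend b (c x)) f"
  unfolding frag_extend_def[of c f] frag_extend_def[of "\<lambda>x. frag_extend b (c x)" f]
  by (simp add: frag_extend_sum frag_extend_cmul o_def)

lemma frag_extend_add_fun: "frag_extend (\<lambda>x. b x + c x) f = frag_extend b f + frag_extend c f"
  by (simp add: frag_extend_def frag_cmul_distrib2 sum.distrib)

lemma frag_extend_id: "(\<And>x. x \<in> Poly_Mapping.keys f \<Longrightarrow> b x = frag_of x) \<Longrightarrow> frag_extend b f = f"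
  by (metis frag_expansion frag_extend_eq)

lemma ring_integral_group_ring:
  assumes "group G"
  shows "ring (integral_group_ring G)"
proof -
  interpret group G by fact
  show ?thesis
  proof (rule ringI)
    show "abelian_group (integral_group_ring G)"
      apply (rule abelian_groupI)
           apply (auto simp: integral_group_ring_def algebra_simps dest!: subsetD[OF Poly_Mapping.keys_add])
      subgoal for x by (rule exI[of _ "-x"]) simp
      done
    show "monoid (integral_group_ring G)"
      apply (rule monoidI)
      apply (simp_all add: integral_group_ring_def)
      subgoal by (intro keys_frag_extend_subset) auto
      subgoal for x y z
        apply (simp add: frag_extend_compose)
        apply (rule frag_extend_eq)+
        by (auto simp: m_assoc subset_iff intro!: frag_extend_eq)
      subgoal by (rule frag_extend_id) auto
      subgoal by (rule frag_extend_id) auto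
      done
  qed (auto simp: integral_group_ring_def frag_extend_add frag_extend_add_fun)
qed

definition group_center :: "('a, 'b) monoid_scheme \<Rightarrow> 'a set"
  where "group_center G = {z \<in> carrier G. \<forall>x \<in> carrier G. z \<otimes>\<^bsub>G\<^esub> x = x \<otimes>\<^bsub>G\<^esub> z}"

definition cut_group :: "('a, 'b) monoid_scheme \<Rightarrow> bool"
  where "cut_group G \<longleftrightarrow>
    group_center (units_of (integral_group_ring G)) =
      frag_of ` group_center G \<union> (\<lambda>z. - frag_of z) ` group_center G"

definition conjugate :: "('a, 'b) monoid_scheme \<Rightarrow> 'a \<Rightarrow> 'a \<Rightarrow> bool"
  where "conjugate G y z \<longleftrightarrow> (\<exists>x \<in> carrier G. z = inv\<^bsub>G\<^esub> x \<otimes>\<^bsub>G\<^esub> y \<otimes>\<^bsub>G\<^esub> x)"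

definition FC_subgroup :: "('a, 'b) monoid_scheme \<Rightarrow> 'a set"
  where "FC_subgroup G = {a \<in> carrier G. finite {b. conjugate G a b}}"

definition torsion_FC_subgroup :: "('a, 'b) monoid_scheme \<Rightarrow> 'a set"
  where "torsion_FC_subgroup G = {a \<in> FC_subgroup G. \<exists>n>0. a [^]\<^bsub>G\<^esub> (n::nat) = \<one>\<^bsub>G\<^esub>}"

definition p_group :: "nat \<Rightarrow> ('a, 'b) monoid_scheme \<Rightarrow> bool"
  where "p_group p G \<longleftrightarrow> group G \<and> (\<forall>x \<in> carrier G. \<exists>n. group.ord G x = p ^ n)"

end

theory Submission
  imports
    "HOL-Number_Theory.Residues"
    "HOL-Algebra.Sylow"
    "HOL-Algebra.Group_Action"
    "Jordan_Normal_Form.Schur_Decomposition"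
    Defs
begin

text \<open>
  A central unit \<open>u\<close> of \<open>\<int>[G]\<close> is constant on conjugacy classes, hence supported in a finite normal
  subgroup of the FC-subgroup.  If every power of \<open>a\<close> prime to \<open>p\<close> is conjugate to \<open>a\<close> or \<open>a\<^sup>-\<^sup>1\<close>, then the
  coefficients of \<open>s = u u\<^sup>*\<close> are invariant under these powers, so the eigenvalues of \<open>s\<close> in the regular
  representation are rational; being units they are \<open>\<plusminus>1\<close>, thus \<open>s\<^sup>2 = 1\<close>, which forces \<open>\<Sum>u\<^sub>g\<^sup>2 = 1\<close>.

  Conversely, an element \<open>a\<close> violating the condition is conjugate only to those of its powers \<open>a\<^sup>j\<close> with
  \<open>j \<equiv> \<plusminus>1\<close> modulo some \<open>m \<in> {8, 9, p}\<close>.  Its centralizer is subnormal in \<open>G\<close>, so a unit \<open>v\<close> of \<open>\<int>[\<langle>a\<rangle>]\<close>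
  can be multiplied up, step by step, with its conjugates to a central unit of \<open>\<int>[G]\<close>.  For
  \<open>v = 1 + q\<^sup>e z\<close> this multiplies the class sums of \<open>z\<close> by a power of \<open>p\<close> modulo \<open>q\<^sup>e\<close>.  If all central
  units are trivial, these class sums are divisible by \<open>q\<^sup>e\<close> for every such \<open>v\<close>, and letting \<open>v\<close> run
  through the powers of a Bass unit contradicts the fact that cyclotomic units have infinite order.
\<close>

subsection \<open>Complex matrices\<close>

text \<open>The eigenvalues are shown rational without Galois theory. A spectral idempotent
  \<open>E\<close> of the regular matrix of s is a polynomial in that matrix, so its traces against
  group elements do not change under powers prime to p, and their sum over all such residues is an
  integer. Hence one nonzero integer C makes C theta^k integral for all k, and likewise for 1/theta,
  which leaves only theta = 1 and theta = -1. The step from u to s supplies a hermitian matrix;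
  without it the last nonzero partial product of the characteristic polynomial could be nilpotent
  and would yield no idempotent.

  In the converse the number of conjugates multiplied together is not controlled, only known to be a
  power of p; taking q to be an odd prime other than p makes it cancel. The gain is a squared
  modulus: the coefficient of 1 + q^e z at a generator is q^e times one that is itself divisible by
  q^e, whereas a q-th power normally gains a single factor q. The moduli 8 and 9 are the least
  powers of 2 and 3 with units other than 1 and -1.\<close>

fun shift_prod :: "complex mat \<Rightarrow> (nat \<Rightarrow> complex) \<Rightarrow> complex mat \<Rightarrow> nat \<Rightarrow> complex mat" where
  "shift_prod S \<mu> X 0 = X"
| "shift_prod S \<mu> X (Suc k) = shift_prod S \<mu> X k * (S - \<mu> k \<cdot>\<^sub>m 1\<^sub>m (dim_row S))"

lemma shift_prod_carrier:
  assumes "S \<in> carrier_mat n n" "X \<in> carrier_mat n n"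
  shows "shift_prod S \<mu> X k \<in> carrier_mat n n"
  using assms by (induction k) (auto simp: carrier_matD)

lemma shift_prod_left:
  assumes S: "S \<in> carrier_mat n n" and X: "X \<in> carrier_mat n n"
  shows "shift_prod S \<mu> X k = X * shift_prod S \<mu> (1\<^sub>m n) k"
proof (induction k)
  case 0
  then show ?case using X by simp
next
  case (Suc k)
  have c: "shift_prod S \<mu> (1\<^sub>m n) k \<in> carrier_mat n n"
    using S by (intro shift_prod_carrier) auto
  have "X * shift_prod S \<mu> (1\<^sub>m n) k * (S - \<mu> k \<cdot>\<^sub>m 1\<^sub>m n) =
      X * (shift_prod S \<mu> (1\<^sub>m n) k * (S - \<mu> k \<cdot>\<^sub>m 1\<^sub>m n))"
    using S by (intro assoc_mult_mat[OF X c]) auto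
  then show ?case using Suc S by simp
qed

lemma shift_prod_similar:
  assumes "B \<in> carrier_mat n n" "P \<in> carrier_mat n n" "Q \<in> carrier_mat n n"
    and PQ: "P * Q = 1\<^sub>m n" and QP: "Q * P = 1\<^sub>m n" and A: "A = P * B * Q"
  shows "shift_prod A \<mu> (1\<^sub>m n) k = P * shift_prod B \<mu> (1\<^sub>m n) k * Q"
proof (induction k)
  case 0
  then show ?case using assms by simp
next
  case (Suc k)
  note c = assms(1-3)
  define X where "X = shift_prod B \<mu> (1\<^sub>m n) k"
  have X: "X \<in> carrier_mat n n" unfolding X_def using c by (intro shift_prod_carrier) auto
  have Ac: "A \<in> carrier_mat n n" using A c by auto
  have dims: "dim_row A = n" "dim_row B = n" using c Ac by auto
  have "P * (\<mu> k \<cdot>\<^sub>m 1\<^sub>m n) * Q = \<mu> k \<cdot>\<^sub>m 1\<^sub>m n"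
    using mult_smult_distrib[OF c(2) one_carrier_mat] mult_smult_assoc_mat[OF c(2) c(3)] c PQ by simp
  moreover have "P * (B - \<mu> k \<cdot>\<^sub>m 1\<^sub>m n) * Q = P * B * Q - P * (\<mu> k \<cdot>\<^sub>m 1\<^sub>m n) * Q"
    using c by (simp add: mult_minus_distrib_mat[OF c(2) c(1)] minus_mult_distrib_mat[of _ n n _ _ n])
  ultimately have "A - \<mu> k \<cdot>\<^sub>m 1\<^sub>m n = P * (B - \<mu> k \<cdot>\<^sub>m 1\<^sub>m n) * Q"
    using A by simp
  then have "shift_prod A \<mu> (1\<^sub>m n) (Suc k) = P * X * Q * (P * (B - \<mu> k \<cdot>\<^sub>m 1\<^sub>m n) * Q)"
    using Suc dims by (simp add: X_def)
  also have "\<dots> = P * X * (Q * P) * ((B - \<mu> k \<cdot>\<^sub>m 1\<^sub>m n) * Q)"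
  proof -
    define D where "D = B - \<mu> k \<cdot>\<^sub>m 1\<^sub>m n"
    have D: "D \<in> carrier_mat n n" using c by (auto simp: D_def)
    have *: "P * D * Q = P * (D * Q)" using c D by (simp add: assoc_mult_mat[of _ n n _ n _ n])
    show ?thesis unfolding D_def[symmetric] *
      using c D X by (simp add: assoc_mult_mat[of _ n n _ n _ n])
  qed
  also have "\<dots> = P * (X * (B - \<mu> k \<cdot>\<^sub>m 1\<^sub>m n)) * Q"
  proof -
    define D where "D = B - \<mu> k \<cdot>\<^sub>m 1\<^sub>m n"
    have D: "D \<in> carrier_mat n n" using c by (auto simp: D_def)
    show ?thesis unfolding D_def[symmetric] using c X QP D by (simp add: assoc_mult_mat[of _ n n _ n _ n])
  qed
  finally show ?case using dims by (simp add: X_def)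
qed

text \<open>Each factor kills one more column: the first \<open>k\<close> columns of the left factor
  vanish by induction, and the remaining rows of the new factor vanish in the columns up to
  \<open>k\<close>. At \<open>k = n\<close> this is Cayley-Hamilton for triangular matrices.\<close>

lemma shift_prod_upper_triangular:
  assumes B: "B \<in> carrier_mat n n" and ut: "upper_triangular B"
  shows "k \<le> n \<Longrightarrow> i < n \<Longrightarrow> j < k \<Longrightarrow> shift_prod B (\<lambda>i. B $$ (i, i)) (1\<^sub>m n) k $$ (i, j) = 0"
proof (induction k arbitrary: i j)
  case (Suc k)
  define X where "X = shift_prod B (\<lambda>i. B $$ (i, i)) (1\<^sub>m n) k"
  define D where "D = B - B $$ (k, k) \<cdot>\<^sub>m 1\<^sub>m n"
  have X: "X \<in> carrier_mat n n" unfolding X_def using B by (intro shift_prod_carrier) auto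
  have D: "D \<in> carrier_mat n n" using B by (auto simp: D_def)
  have "(X * D) $$ (i, j) = (\<Sum>l<n. X $$ (i, l) * D $$ (l, j))"
    using X D Suc.prems by (simp add: scalar_prod_def atLeast0LessThan)
  also have "\<dots> = 0"
  proof (rule sum.neutral, intro ballI)
    fix l assume l: "l \<in> {..<n}"
    show "X $$ (i, l) * D $$ (l, j) = 0"
    proof (cases "l < k")
      case True
      then show ?thesis using Suc by (simp add: X_def)
    next
      case False
      have "D $$ (l, j) = 0"
        using False l Suc.prems B ut by (cases "l = k"; cases "j = k")
          (auto simp: D_def upper_triangular_def)
      then show ?thesis by simp
    qed
  qed
  finally show ?case using B by (simp add: X_def D_def)
qed simp

lemma complex_schur:
  fixes A :: "complex mat"
  assumes A: "A \<in> carrier_mat n n"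
  obtains B P Q where "upper_triangular B" 
     "B \<in> carrier_mat n n" "P \<in> carrier_mat n n" "Q \<in> carrier_mat n n"
     "P * Q = 1\<^sub>m n" "Q * P = 1\<^sub>m n" "A = P * B * Q"
     "shift_prod A (\<lambda>i. B $$ (i, i)) (1\<^sub>m n) n = 0\<^sub>m n n"
proof -
  obtain es where "char_poly A = (\<Prod> a \<leftarrow> es. [:- a, 1:])"
    using char_poly_factorized[OF A] by blast
  then obtain B where B: "B \<in> carrier_mat n n" "upper_triangular B" "similar_mat A B"
    using schur_decomposition_exists[OF A] by blast
  then obtain P Q where w: "similar_mat_wit A B P Q" unfolding similar_mat_def by blast
  note w' = similar_mat_witD2[OF A w]
  have "shift_prod B (\<lambda>i. B $$ (i, i)) (1\<^sub>m n) n = 0\<^sub>m n n"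
    using shift_prod_upper_triangular[OF B(1,2), of n]
      carrier_matD[OF shift_prod_carrier[OF B(1) one_carrier_mat, of "\<lambda>i. B $$ (i, i)" n]]
    by (intro eq_matI) auto
  then have "shift_prod A (\<lambda>i. B $$ (i, i)) (1\<^sub>m n) n = 0\<^sub>m n n"
    using shift_prod_similar[of B n P Q A] w' by simp
  then show ?thesis using that[OF B(2,1) w'(6,7) w'(1,2,3)] by simp
qed

section \<open>Traces and idempotent matrices\<close>

definition trace :: "'a::comm_ring_1 mat \<Rightarrow> 'a" where
  "trace A = (\<Sum>i<dim_row A. A $$ (i, i))"

lemma trace_add: "A \<in> carrier_mat n n \<Longrightarrow> B \<in> carrier_mat n n \<Longrightarrow> trace (A + B) = trace A + trace B"
  by (auto simp: trace_def sum.distrib)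

lemma trace_minus: "A \<in> carrier_mat n n \<Longrightarrow> B \<in> carrier_mat n n \<Longrightarrow> trace (A - B) = trace A - trace B"
  by (auto simp: trace_def sum_subtractf)

lemma trace_smult: "A \<in> carrier_mat n n \<Longrightarrow> trace (c \<cdot>\<^sub>m A) = c * trace A"
  by (auto simp: trace_def sum_distrib_left)

lemma trace_mult_commute:
  assumes "A \<in> carrier_mat n n" "B \<in> carrier_mat n n"
  shows "trace (A * B) = trace (B * A)"
proof -
  have "trace (A * B) = (\<Sum>i<n. \<Sum>j<n. A $$ (i, j) * B $$ (j, i))"
    using assms by (auto simp: trace_def scalar_prod_def atLeast0LessThan)
  also have "\<dots> = (\<Sum>j<n. \<Sum>i<n. A $$ (i, j) * B $$ (j, i))" by (rule sum.swap)
  also have "\<dots> = trace (B * A)"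
    using assms by (auto simp: trace_def scalar_prod_def atLeast0LessThan mult.commute)
  finally show ?thesis .
qed

text \<open>In triangular form the diagonal entries are 0 or 1, so the trace counts the ones. If it
  is 0, all eigenvalues vanish, \<open>E\<close> is nilpotent, and being idempotent it is
  zero.\<close>

lemma idempotent_trace:
  fixes E :: "complex mat"
  assumes E: "E \<in> carrier_mat n n" and idem: "E * E = E"
  shows "trace E \<in> \<int>" "trace E = 0 \<Longrightarrow> E = 0\<^sub>m n n"
proof -
  obtain B P Q where B: "upper_triangular B" 
     "B \<in> carrier_mat n n" "P \<in> carrier_mat n n" "Q \<in> carrier_mat n n"
     "P * Q = 1\<^sub>m n" "Q * P = 1\<^sub>m n" "E = P * B * Q"
     "shift_prod E (\<lambda>i. B $$ (i, i)) (1\<^sub>m n) n = 0\<^sub>m n n"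
    by (rule complex_schur[OF E])
  note c = B(2-4)
  have QEP: "Q * X * P = Y" if "X = P * Y * Q" "Y \<in> carrier_mat n n" for X Y
  proof -
    have "Q * X * P = (Q * P) * Y * (Q * P)"
      unfolding that(1) using c that(2) by (simp add: assoc_mult_mat[of _ n n _ n _ n])
    then show ?thesis using that(2) B(6) by simp
  qed
  have EE: "E * E = P * (B * B) * Q"
  proof -
    have "E * E = P * B * (Q * P) * B * Q"
      using c unfolding B(7) by (simp add: assoc_mult_mat[of _ n n _ n _ n])
    then show ?thesis using c B(6) by (simp add: assoc_mult_mat[of _ n n _ n _ n])
  qed
  have BB: "B * B = B"
    using QEP[OF EE] QEP[OF B(7) c(1)] mult_carrier_mat[OF c(1) c(1)] idem by metis
  have diag: "B $$ (i, i) = 0 \<or> B $$ (i, i) = 1" if i: "i < n" for i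
  proof -
    have "(B * B) $$ (i, i) = (\<Sum>l<n. B $$ (i, l) * B $$ (l, i))"
      using c i by (simp add: scalar_prod_def atLeast0LessThan)
    also have "\<dots> = (\<Sum>l\<in>{i}. B $$ (i, l) * B $$ (l, i))"
    proof (rule sum.mono_neutral_right, simp, simp add: i, intro ballI)
      fix l assume "l \<in> {..<n} - {i}"
      then show "B $$ (i, l) * B $$ (l, i) = 0"
        using B(1) i c by (cases "l < i") (auto simp: upper_triangular_def)
    qed
    finally have "B $$ (i, i) * B $$ (i, i) = B $$ (i, i)" using BB by simp
    then show ?thesis by auto
  qed
  have tr: "trace E = trace B"
  proof -
    have "trace E = trace (P * (B * Q))"
      unfolding B(7) using c by (simp add: assoc_mult_mat[of _ n n _ n _ n])
    also have "\<dots> = trace (B * Q * P)" using c by (intro trace_mult_commute) auto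
    also have "\<dots> = trace B" using c B(6) by (simp add: assoc_mult_mat[of _ n n _ n _ n])
    finally show ?thesis .
  qed
  have trB: "trace B = of_nat (card {i. i < n \<and> B $$ (i, i) = 1})"
  proof -
    have "trace B = (\<Sum>i<n. if B $$ (i, i) = 1 then 1 else 0)"
      using c diag by (auto simp: trace_def intro!: sum.cong dest: diag)
    also have "\<dots> = of_nat (card ({..<n} \<inter> {i. B $$ (i, i) = 1}))"
      by (simp add: sum.If_cases)
    finally show ?thesis by (simp add: Int_def)
  qed
  show "trace E \<in> \<int>" unfolding tr trB by simp
  assume "trace E = 0"
  then have "card {i. i < n \<and> B $$ (i, i) = 1} = 0" unfolding tr trB by simp
  then have z: "B $$ (i, i) = 0" if "i < n" for i
    using diag that by auto
  \<comment> \<open>With all shifts zero the Cayley-Hamilton product is the n-th power of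
    \<open>E\<close>, that is \<open>E\<close> itself once \<open>n > 0\<close>.\<close>
  have pow: "shift_prod E (\<lambda>i. B $$ (i, i)) (1\<^sub>m n) k = (if k = 0 then 1\<^sub>m n else E)" if "k \<le> n" for k
    using that
  proof (induction k)
    case (Suc k)
    have "E - 0 \<cdot>\<^sub>m 1\<^sub>m n = E" using E by (intro eq_matI) auto
    then show ?case using Suc z[of k] E idem by auto
  qed simp
  show "E = 0\<^sub>m n n"
  proof (cases "n = 0")
    case True
    then show ?thesis using E by (intro eq_matI) auto
  next
    case False
    then show ?thesis using pow[of n] B(8) by simp
  qed
qed

section \<open>Hermitian matrices and their polynomials\<close>

definition conj_transpose :: "complex mat \<Rightarrow> complex mat" where
  "conj_transpose A = transpose_mat (map_mat cnj A)"

lemma conj_transpose_carrier [simp]: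
  "A \<in> carrier_mat n m \<Longrightarrow> conj_transpose A \<in> carrier_mat m n"
  by (simp add: conj_transpose_def)

lemma conj_transpose_mult:
  assumes "A \<in> carrier_mat n m" "B \<in> carrier_mat m k"
  shows "conj_transpose (A * B) = conj_transpose B * conj_transpose A"
  using assms by (intro eq_matI) (auto simp: conj_transpose_def scalar_prod_def mult.commute)

lemma conj_transpose_conj_transpose [simp]: "conj_transpose (conj_transpose A) = A"
  by (intro eq_matI) (auto simp: conj_transpose_def)

lemma smult_smult_times: "a \<cdot>\<^sub>m (b \<cdot>\<^sub>m A) = (a * b) \<cdot>\<^sub>m (A :: 'a :: semigroup_mult mat)"
  by (intro eq_matI) (auto simp: mult.assoc)

lemma conj_transpose_mult_self_eq_0:
  assumes A: "A \<in> carrier_mat n n" and 0: "conj_transpose A * A = 0\<^sub>m n n"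
  shows "A = 0\<^sub>m n n"
proof (intro eq_matI)
  fix i j assume ij: "i < dim_row (0\<^sub>m n n :: complex mat)" "j < dim_col (0\<^sub>m n n :: complex mat)"
  have "(\<Sum>l<n. cnj (A $$ (l, j)) * A $$ (l, j)) = (conj_transpose A * A) $$ (j, j)"
    using A ij by (simp add: conj_transpose_def scalar_prod_def atLeast0LessThan)
  also have "\<dots> = 0" using 0 ij by simp
  finally have "complex_of_real (\<Sum>l<n. (cmod (A $$ (l, j)))\<^sup>2) = 0"
    by (simp add: complex_norm_square mult.commute del: of_real_power)
  then have "(\<Sum>l<n. (cmod (A $$ (l, j)))\<^sup>2) = 0" using of_real_eq_0_iff by blast
  then show "A $$ (i, j) = 0\<^sub>m n n $$ (i, j)"
    using ij by (simp add: sum_nonneg_eq_0_iff)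
qed (use A in auto)

text \<open>Linear spaces containing 1 and stable under right multiplication by \<open>S\<close>.
  Membership in every such space encodes "is a polynomial in \<open>S\<close>"; properties of the
  polynomial are read off by choosing the space.\<close>

definition power_closed :: "nat \<Rightarrow> complex mat \<Rightarrow> complex mat set \<Rightarrow> bool" where
  "power_closed n S C \<longleftrightarrow> C \<subseteq> carrier_mat n n \<and> 1\<^sub>m n \<in> C \<and> (\<forall>X\<in>C. X * S \<in> C) \<and>
     (\<forall>X\<in>C. \<forall>Y\<in>C. X + Y \<in> C) \<and> (\<forall>c. \<forall>X\<in>C. c \<cdot>\<^sub>m X \<in> C)"

lemma power_closed_shift_prod:
  assumes S: "S \<in> carrier_mat n n" and C: "power_closed n S C" and X: "X \<in> C"
  shows "shift_prod S \<mu> X k \<in> C"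
proof (induction k)
  case (Suc k)
  define Z where "Z = shift_prod S \<mu> X k"
  have Z: "Z \<in> C" "Z \<in> carrier_mat n n" using Suc C by (auto simp: Z_def power_closed_def)
  have "Z * (S - \<mu> k \<cdot>\<^sub>m 1\<^sub>m n) = Z * S + (- \<mu> k) \<cdot>\<^sub>m Z"
    using S Z(2) mult_smult_distrib[OF Z(2) one_carrier_mat]
    by (simp add: mult_minus_distrib_mat[OF Z(2) S]) (intro eq_matI, auto)
  then show ?case using S C Z(1) by (simp add: Z_def[symmetric] power_closed_def)
qed (use X in simp)

text \<open>Whatever commutes with \<open>S\<close> commutes with every polynomial in
  \<open>S\<close>: the commutant is one of the spaces to which membership is applied.\<close>

lemma power_closed_commute:
  assumes S: "S \<in> carrier_mat n n" and Z: "Z \<in> carrier_mat n n" and SZ: "S * Z = Z * S"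
  shows "power_closed n S {X \<in> carrier_mat n n. X * Z = Z * X}"
  unfolding power_closed_def
proof (intro conjI ballI allI)
  fix X assume X: "X \<in> {X \<in> carrier_mat n n. X * Z = Z * X}"
  then have "X * S * Z = X * (Z * S)"
    using S Z SZ by (simp add: assoc_mult_mat[of _ n n _ n _ n])
  also have "\<dots> = X * Z * S" using S Z X assoc_mult_mat[of X n n Z n S n] by simp
  also have "\<dots> = Z * (X * S)" using S Z X assoc_mult_mat[of Z n n X n S n] by simp
  finally show "X * S \<in> {X \<in> carrier_mat n n. X * Z = Z * X}" using X S mult_carrier_mat[of X n n S n] by simp
qed (use Z in \<open>auto simp: add_mult_distrib_mat[of _ n n] mult_add_distrib_mat[of _ n n] 
       mult_smult_distrib[of _ n n _ n] mult_smult_assoc_mat[of _ n n _ n]\<close>)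

text \<open>Multiply \<open>S * S - 1\<^sub>m n\<close> by the factors \<open>S - \<mu> k\<close> in
  turn. The last nonzero product \<open>Z\<close> satisfies
  \<open>Z * S = \<theta> \<cdot>\<^sub>m Z\<close>, so polynomials in \<open>S\<close> act on it by
  scalars and \<open>Z * Z\<close> is a multiple of \<open>Z\<close>. The scalar is nonzero because
  \<open>Z\<close> is normal, and rescaling gives \<open>E\<close>.\<close>

lemma hermitian_spectral_idempotent:
  assumes S: "S \<in> carrier_mat n n" and H: "conj_transpose S = S" and S2: "S * S \<noteq> 1\<^sub>m n"
  obtains E \<theta> where "E \<in> carrier_mat n n" "E * E = E" "E \<noteq> 0\<^sub>m n n" "E * S = \<theta> \<cdot>\<^sub>m E" "\<theta>\<^sup>2 \<noteq> 1"
    "\<And>C. power_closed n S C \<Longrightarrow> E \<in> C"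
proof -
  obtain \<mu> where \<mu>: "shift_prod S \<mu> (1\<^sub>m n) n = 0\<^sub>m n n"
    by (rule complex_schur[OF S])
  \<comment> \<open>Starting from this matrix puts the factor \<open>\<theta>\<^sup>2 - 1\<close>
    into the scalar of \<open>Z * Z\<close>, so that a nonzero scalar also yields
    \<open>\<theta>\<^sup>2 \<noteq> 1\<close>.\<close>
  define X0 where "X0 = S * S - 1\<^sub>m n"
  have X0c: "X0 \<in> carrier_mat n n" using S by (simp add: X0_def minus_carrier_mat)
  have X0: "X0 \<in> C" if "power_closed n S C" for C
  proof -
    have "1\<^sub>m n * S * S + (-1) \<cdot>\<^sub>m 1\<^sub>m n \<in> C" using that unfolding power_closed_def by blast
    also have "1\<^sub>m n * S * S + (-1) \<cdot>\<^sub>m 1\<^sub>m n = X0" using S by (auto simp: X0_def)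
    finally show ?thesis .
  qed
  have X0nz: "X0 \<noteq> 0\<^sub>m n n"
  proof
    assume "X0 = 0\<^sub>m n n"
    then have "S * S - 1\<^sub>m n + 1\<^sub>m n = 0\<^sub>m n n + 1\<^sub>m n" by (simp add: X0_def)
    moreover have "S * S - 1\<^sub>m n + 1\<^sub>m n = S * S" using S by (intro eq_matI) auto
    ultimately show False using S2 by simp
  qed
  define W where "W = (\<lambda>k. shift_prod S \<mu> (1\<^sub>m n) k)"
  define Y where "Y = (\<lambda>k. shift_prod S \<mu> X0 k)"
  have YW: "Y k = X0 * W k" for k
    using shift_prod_left[OF S X0c] by (simp add: Y_def W_def)
  have "Y n = 0\<^sub>m n n" using YW[of n] \<mu> X0c by (simp add: W_def)
  moreover have "Y 0 \<noteq> 0\<^sub>m n n" using X0nz by (simp add: Y_def)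
  ultimately obtain k where k: "Y k \<noteq> 0\<^sub>m n n" "Y (Suc k) = 0\<^sub>m n n"
    using dec_induct[of 0 n "\<lambda>k. Y k \<noteq> 0\<^sub>m n n"] by blast
  define Z where "Z = Y k"
  define \<theta> where "\<theta> = \<mu> k"
  have Zin: "Z \<in> C" if "power_closed n S C" for C
    unfolding Z_def Y_def using power_closed_shift_prod[OF S that X0[OF that]] .
  have pc: "power_closed n S (carrier_mat n n)" using S by (auto simp: power_closed_def)
  have Z: "Z \<in> carrier_mat n n" using Zin[OF pc] .
  have Wc: "W k \<in> carrier_mat n n" unfolding W_def using S by (intro shift_prod_carrier) auto
  have ZS: "Z * S = \<theta> \<cdot>\<^sub>m Z"
  proof -
    have "Z * (S - \<theta> \<cdot>\<^sub>m 1\<^sub>m n) = 0\<^sub>m n n" using k(2) S by (simp add: Y_def Z_def \<theta>_def)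
    then have "Z * S - \<theta> \<cdot>\<^sub>m Z = 0\<^sub>m n n"
      using S Z mult_smult_distrib[OF Z one_carrier_mat] by (simp add: mult_minus_distrib_mat[OF Z S])
    then have "Z * S - \<theta> \<cdot>\<^sub>m Z + \<theta> \<cdot>\<^sub>m Z = \<theta> \<cdot>\<^sub>m Z" using Z by simp
    moreover have "Z * S - \<theta> \<cdot>\<^sub>m Z + \<theta> \<cdot>\<^sub>m Z = Z * S" using Z S by (intro eq_matI) auto
    ultimately show ?thesis by simp
  qed
  have SZ: "S * Z = Z * S" using Zin[OF power_closed_commute[OF S S refl]] by simp
  \<comment> \<open>As \<open>S\<close> is hermitian, the adjoint of \<open>Z\<close> commutes with
    \<open>S\<close> too, hence with the polynomial \<open>Z\<close> in \<open>S\<close>.\<close>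
  have normal: "Z * conj_transpose Z = conj_transpose Z * Z"
  proof -
    have "conj_transpose (S * Z) = conj_transpose (Z * S)" using SZ by simp
    then have "conj_transpose Z * S = S * conj_transpose Z"
      using S Z H by (simp add: conj_transpose_mult[of _ n n])
    then show ?thesis using Zin[OF power_closed_commute[OF S conj_transpose_carrier[OF Z]]] by simp
  qed
  have WZ: "\<exists>c. W k * Z = c \<cdot>\<^sub>m Z"
  proof -
    define C where "C = {X \<in> carrier_mat n n. \<exists>c. X * Z = c \<cdot>\<^sub>m Z}"
    have "power_closed n S C"
      unfolding power_closed_def
    proof (intro conjI ballI allI)
      show "1\<^sub>m n \<in> C" using Z by (auto simp: C_def intro!: exI[of _ 1])
    next
      fix X assume "X \<in> C"
      then obtain c where X: "X \<in> carrier_mat n n" "X * Z = c \<cdot>\<^sub>m Z" by (auto simp: C_def)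
      have "X * S * Z = X * (Z * S)" using X S Z SZ by (simp add: assoc_mult_mat[of _ n n _ n _ n])
      also have "\<dots> = \<theta> \<cdot>\<^sub>m (X * Z)" using ZS X Z by (simp add: mult_smult_distrib[of _ n n _ n])
      finally have "X * S * Z = (\<theta> * c) \<cdot>\<^sub>m Z" using X Z by (simp add: smult_smult_times)
      then show "X * S \<in> C" using X S mult_carrier_mat[of X n n S n] by (auto simp: C_def)
    next
      fix X Y assume "X \<in> C" "Y \<in> C"
      then obtain c d where X: "X \<in> carrier_mat n n" "X * Z = c \<cdot>\<^sub>m Z"
        and Y: "Y \<in> carrier_mat n n" "Y * Z = d \<cdot>\<^sub>m Z" by (auto simp: C_def)
      have "(X + Y) * Z = (c + d) \<cdot>\<^sub>m Z"
        using X Y Z by (simp add: add_mult_distrib_mat[of _ n n] add_smult_distrib_right_mat[of _ n n])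
      then show "X + Y \<in> C" using X Y by (auto simp: C_def)
    next
      fix X a assume "X \<in> C"
      then obtain c where X: "X \<in> carrier_mat n n" "X * Z = c \<cdot>\<^sub>m Z" by (auto simp: C_def)
      have "a \<cdot>\<^sub>m X * Z = (a * c) \<cdot>\<^sub>m Z"
        using X Z by (simp add: mult_smult_assoc_mat[of _ n n _ n] smult_smult_times)
      then show "a \<cdot>\<^sub>m X \<in> C" using X by (auto simp: C_def)
    qed (auto simp: C_def)
    then show ?thesis using power_closed_shift_prod[OF S, of C "1\<^sub>m n" \<mu> k]
      unfolding W_def C_def power_closed_def by blast
  qed
  then obtain c where c: "W k * Z = c \<cdot>\<^sub>m Z" by blast
  have SSZ: "S * S * Z = \<theta>\<^sup>2 \<cdot>\<^sub>m Z"
  proof -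
    have "S * S * Z = S * (\<theta> \<cdot>\<^sub>m Z)" using S Z SZ ZS by (simp add: assoc_mult_mat[of _ n n _ n _ n])
    also have "\<dots> = \<theta> \<cdot>\<^sub>m (\<theta> \<cdot>\<^sub>m Z)" using S Z SZ ZS by (simp add: mult_smult_distrib[of _ n n _ n])
    finally show ?thesis using Z by (simp add: smult_smult_times power2_eq_square)
  qed
  have ZZ: "Z * Z = (c * (\<theta>\<^sup>2 - 1)) \<cdot>\<^sub>m Z"
  proof -
    have "Z * Z = X0 * (W k * Z)"
      using YW[of k] assoc_mult_mat[OF X0c Wc Z] by (simp add: Z_def[symmetric])
    also have "\<dots> = c \<cdot>\<^sub>m (X0 * Z)" using c X0c Z by (simp add: mult_smult_distrib[of _ n n _ n])
    also have "X0 * Z = \<theta>\<^sup>2 \<cdot>\<^sub>m Z - Z"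
      using SSZ S Z by (simp add: X0_def minus_mult_distrib_mat[of _ n n _ _ n])
    also have "c \<cdot>\<^sub>m (\<theta>\<^sup>2 \<cdot>\<^sub>m Z - Z) = (c * (\<theta>\<^sup>2 - 1)) \<cdot>\<^sub>m Z"
      using Z by (intro eq_matI) (auto simp: algebra_simps)
    finally show ?thesis .
  qed
  define d where "d = c * (\<theta>\<^sup>2 - 1)"
  \<comment> \<open>A normal matrix with square zero is zero: \<open>V\<close> is hermitian with
    square zero, and positivity is applied first to \<open>V\<close>, then to
    \<open>Z\<close>.\<close>
  have d: "d \<noteq> 0"
  proof
    assume "d = 0"
    then have 0: "Z * Z = 0\<^sub>m n n" using ZZ Z by (simp add: d_def[symmetric]) (intro eq_matI, auto)
    define V where "V = conj_transpose Z * Z"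
    note cZ = conj_transpose_carrier[OF Z]
    have V: "V \<in> carrier_mat n n" using Z cZ by (simp add: V_def mult_carrier_mat[OF cZ Z])
    have VH: "conj_transpose V = V" using Z cZ by (simp add: V_def conj_transpose_mult[OF cZ Z])
    have "V * V = 0\<^sub>m n n"
    proof -
      define U where "U = conj_transpose Z"
      have U: "U \<in> carrier_mat n n" using cZ by (simp add: U_def)
      have ZU: "Z * U = U * Z" using normal by (simp add: U_def)
      have "V * V = U * (Z * U) * Z"
        using Z U by (simp add: V_def U_def[symmetric] assoc_mult_mat[of _ n n _ n _ n])
      also have "\<dots> = U * U * (Z * Z)"
        unfolding ZU using Z U by (simp add: assoc_mult_mat[of _ n n _ n _ n])
      finally show ?thesis using 0 right_mult_zero_mat[OF mult_carrier_mat[OF U U]] by simp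
    qed
    then have "V = 0\<^sub>m n n" using conj_transpose_mult_self_eq_0[OF V] VH by simp
    then have "Z = 0\<^sub>m n n" using conj_transpose_mult_self_eq_0[OF Z] by (simp add: V_def)
    then show False using k(1) by (simp add: Z_def)
  qed
  show ?thesis
  proof (rule that[of "(1 / d) \<cdot>\<^sub>m Z" \<theta>])
    show "(1 / d) \<cdot>\<^sub>m Z \<in> carrier_mat n n" using Z by simp
    show "(1 / d) \<cdot>\<^sub>m Z * ((1 / d) \<cdot>\<^sub>m Z) = (1 / d) \<cdot>\<^sub>m Z"
      using ZZ Z d by (simp add: d_def[symmetric] mult_smult_distrib[of _ n n _ n]
          mult_smult_assoc_mat[of _ n n _ n] smult_smult_times)
    show "(1 / d) \<cdot>\<^sub>m Z \<noteq> 0\<^sub>m n n"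
    proof
      assume "(1 / d) \<cdot>\<^sub>m Z = 0\<^sub>m n n"
      then have "d \<cdot>\<^sub>m ((1 / d) \<cdot>\<^sub>m Z) = d \<cdot>\<^sub>m 0\<^sub>m n n" by simp
      then have "Z = 0\<^sub>m n n" using d Z by (simp add: smult_smult_times) (metis carrier_matD eq_matI index_smult_mat mult_1)
      then show False using k(1) by (simp add: Z_def)
    qed
    show "(1 / d) \<cdot>\<^sub>m Z * S = \<theta> \<cdot>\<^sub>m ((1 / d) \<cdot>\<^sub>m Z)"
      using ZS Z S by (simp add: mult_smult_assoc_mat[of _ n n _ n] smult_smult_times mult.commute)
    show "\<theta>\<^sup>2 \<noteq> 1" using d by (auto simp: d_def)
    show "(1 / d) \<cdot>\<^sub>m Z \<in> C" if "power_closed n S C" for C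
      using Zin[OF that] that by (auto simp: power_closed_def)
  qed
qed

subsection \<open>Traces of spectral idempotents\<close>

lemma sum_powers_root_of_unity_in_Ints:
  fixes w :: complex
  assumes "w ^ m = 1"
  shows "(\<Sum>j<m. w ^ j) \<in> \<int>"
  using assms by (cases "w = 1") (simp_all add: sum_gp_strict)

section \<open>Fourier sums of a periodic sequence of matrices\<close>

definition lin_comb :: "nat \<Rightarrow> nat \<Rightarrow> (nat \<Rightarrow> complex) \<Rightarrow> (nat \<Rightarrow> complex mat) \<Rightarrow> complex mat" where
  "lin_comb n q c M = mat n n (\<lambda>(a, b). \<Sum>i<q. c i * M i $$ (a, b))"

lemma lin_comb_carrier [simp]: "lin_comb n q c M \<in> carrier_mat n n"
  by (simp add: lin_comb_def)

lemma lin_comb_mult_right: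
  assumes "\<And>i. i < q \<Longrightarrow> M i \<in> carrier_mat n n" "X \<in> carrier_mat n n"
  shows "lin_comb n q c M * X = lin_comb n q c (\<lambda>i. M i * X)"
proof (intro eq_matI)
  fix a b assume "a < dim_row (lin_comb n q c (\<lambda>i. M i * X))" "b < dim_col (lin_comb n q c (\<lambda>i. M i * X))"
  then have ab: "a < n" "b < n" by (auto simp: lin_comb_def)
  have "(lin_comb n q c M * X) $$ (a, b) = (\<Sum>l<n. (\<Sum>i<q. c i * M i $$ (a, l)) * X $$ (l, b))"
    using assms(2) ab by (simp add: lin_comb_def scalar_prod_def atLeast0LessThan)
  also have "\<dots> = (\<Sum>i<q. \<Sum>l<n. c i * M i $$ (a, l) * X $$ (l, b))"
    unfolding sum_distrib_right by (rule sum.swap)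
  also have "\<dots> = (\<Sum>i<q. c i * (M i * X) $$ (a, b))"
    using assms ab by (intro sum.cong refl)
      (simp add: scalar_prod_def atLeast0LessThan sum_distrib_left mult.assoc carrier_matD[OF assms(1)])
  finally show "(lin_comb n q c M * X) $$ (a, b) = lin_comb n q c (\<lambda>i. M i * X) $$ (a, b)"
    using ab by (simp add: lin_comb_def)
qed (use assms in \<open>auto simp: lin_comb_def\<close>)

lemma lin_comb_mult_left:
  assumes "\<And>i. i < q \<Longrightarrow> M i \<in> carrier_mat n n" "X \<in> carrier_mat n n"
  shows "X * lin_comb n q c M = lin_comb n q c (\<lambda>i. X * M i)"
proof (intro eq_matI)
  fix a b assume "a < dim_row (lin_comb n q c (\<lambda>i. X * M i))" "b < dim_col (lin_comb n q c (\<lambda>i. X * M i))"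
  then have ab: "a < n" "b < n" by (auto simp: lin_comb_def)
  have "(X * lin_comb n q c M) $$ (a, b) = (\<Sum>l<n. X $$ (a, l) * (\<Sum>i<q. c i * M i $$ (l, b)))"
    using assms(2) ab by (simp add: lin_comb_def scalar_prod_def atLeast0LessThan)
  also have "\<dots> = (\<Sum>i<q. \<Sum>l<n. X $$ (a, l) * (c i * M i $$ (l, b)))"
    unfolding sum_distrib_left by (rule sum.swap)
  also have "\<dots> = (\<Sum>i<q. c i * (X * M i) $$ (a, b))"
    using assms ab by (intro sum.cong refl)
      (simp add: scalar_prod_def atLeast0LessThan sum_distrib_left mult_ac carrier_matD[OF assms(1)])
  finally show "(X * lin_comb n q c M) $$ (a, b) = lin_comb n q c (\<lambda>i. X * M i) $$ (a, b)"
    using ab by (simp add: lin_comb_def)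
qed (use assms in \<open>auto simp: lin_comb_def\<close>)

lemma trace_lin_comb:
  assumes "\<And>i. i < q \<Longrightarrow> M i \<in> carrier_mat n n"
  shows "trace (lin_comb n q c M) = (\<Sum>i<q. c i * trace (M i))"
proof -
  have "trace (lin_comb n q c M) = (\<Sum>a<n. \<Sum>i<q. c i * M i $$ (a, a))"
    by (simp add: trace_def lin_comb_def)
  also have "\<dots> = (\<Sum>i<q. \<Sum>a<n. c i * M i $$ (a, a))" by (rule sum.swap)
  also have "\<dots> = (\<Sum>i<q. c i * trace (M i))"
    using assms by (intro sum.cong refl) (simp add: trace_def sum_distrib_left carrier_matD[OF assms])
  finally show ?thesis .
qed

text \<open>The Fourier sum of a sequence of period \<open>q\<close> is an eigenvector of the shift:
  the term lost at one end returns at the other.\<close>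

lemma lin_comb_cyclic_shift:
  assumes "z * y = 1" "y ^ q = 1" "M q = M 0"
  shows "lin_comb n q (\<lambda>i. y ^ i) (\<lambda>i. M (Suc i)) = z \<cdot>\<^sub>m lin_comb n q (\<lambda>i. y ^ i) M"
proof (intro eq_matI)
  fix a b assume "a < dim_row (z \<cdot>\<^sub>m lin_comb n q (\<lambda>i. y ^ i) M)" "b < dim_col (z \<cdot>\<^sub>m lin_comb n q (\<lambda>i. y ^ i) M)"
  then have ab: "a < n" "b < n" by (auto simp: lin_comb_def)
  define m where "m i = M i $$ (a, b)" for i
  have "(\<Sum>i<q. y ^ Suc i * m (Suc i)) = (\<Sum>i<q. y ^ i * m i)"
    using sum.lessThan_Suc_shift[of "\<lambda>i. y ^ i * m i" q] assms(2,3) by (simp add: m_def)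
  then have "y * (\<Sum>i<q. y ^ i * m (Suc i)) = (\<Sum>i<q. y ^ i * m i)"
    by (simp add: sum_distrib_left mult.assoc)
  then have "z * (y * (\<Sum>i<q. y ^ i * m (Suc i))) = z * (\<Sum>i<q. y ^ i * m i)" by simp
  then have "(\<Sum>i<q. y ^ i * m (Suc i)) = z * (\<Sum>i<q. y ^ i * m i)"
    using assms(1) by (simp add: mult.assoc[symmetric])
  then show "lin_comb n q (\<lambda>i. y ^ i) (\<lambda>i. M (Suc i)) $$ (a, b) = (z \<cdot>\<^sub>m lin_comb n q (\<lambda>i. y ^ i) M) $$ (a, b)"
    using ab by (simp add: lin_comb_def m_def)
qed (auto simp: lin_comb_def)

text \<open>\<open>F\<close> projects onto the eigenspace of \<open>M 1\<close> for the eigenvalue 1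
  / y: on the Fourier sum \<open>Z\<close> each \<open>M i\<close> acts as y^(-i), which cancels the
  weight y^i, so \<open>Z * Z\<close> is \<open>q\<close> times \<open>Z\<close>.\<close>

lemma spectral_component_idempotent:
  fixes M :: "nat \<Rightarrow> complex mat"
  assumes M: "\<And>i. M i \<in> carrier_mat n n" and M0: "M 0 = 1\<^sub>m n" and add: "\<And>i. M (Suc i) = M 1 * M i"
    and per: "M q = M 0" and q: "q > 0" and y: "y ^ q = 1"
  defines "F \<equiv> (1 / of_nat q) \<cdot>\<^sub>m lin_comb n q (\<lambda>i. y ^ i) M"
  shows "F * F = F"
proof -
  define Z where "Z = lin_comb n q (\<lambda>i. y ^ i) M"
  have Z: "Z \<in> carrier_mat n n" by (simp add: Z_def)
  have y0: "y \<noteq> 0" using y q by (auto simp: power_0_left)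
  have "M 1 * Z = lin_comb n q (\<lambda>i. y ^ i) (\<lambda>i. M (Suc i))"
    unfolding Z_def add using M by (simp add: lin_comb_mult_left)
  also have "\<dots> = inverse y \<cdot>\<^sub>m Z"
    unfolding Z_def using y0 y per by (intro lin_comb_cyclic_shift) auto
  finally have M1: "M 1 * Z = inverse y \<cdot>\<^sub>m Z" .
  have MZ: "M i * Z = inverse y ^ i \<cdot>\<^sub>m Z" for i
  proof (induction i)
    case 0
    then show ?case using M0 Z by (intro eq_matI) auto
  next
    case (Suc i)
    have "M (Suc i) * Z = M 1 * (M i * Z)" using add[of i] M Z by (simp add: assoc_mult_mat[of _ n n _ n _ n])
    also have "\<dots> = (inverse y ^ Suc i) \<cdot>\<^sub>m Z"
      using Suc M Z M1 by (simp add: mult_smult_distrib[of _ n n _ n] smult_smult_times mult.commute)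
    finally show ?case .
  qed
  have "Z * Z = lin_comb n q (\<lambda>i. y ^ i) (\<lambda>i. inverse y ^ i \<cdot>\<^sub>m Z)"
    using lin_comb_mult_right[of q M n Z "\<lambda>i. y ^ i"] M Z MZ by (simp add: Z_def[symmetric])
  also have "\<dots> = of_nat q \<cdot>\<^sub>m Z"
    using Z y0 by (intro eq_matI) (auto simp: lin_comb_def mult.assoc[symmetric] power_mult_distrib[symmetric])
  finally have "Z * Z = of_nat q \<cdot>\<^sub>m Z" .
  then show ?thesis
    unfolding F_def Z_def[symmetric] using Z q
    by (simp add: mult_smult_distrib[of _ n n _ n] mult_smult_assoc_mat[of _ n n _ n] smult_smult_times)
qed

text \<open>The multiplicity of each eigenvalue of \<open>M 1\<close> on the image of \<open>E\<close> is an integer, so the sum of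
  the traces over the residues prime to \<open>p\<close> is an integral combination of Ramanujan sums.\<close>
lemma sum_coprime_traces_in_Ints:
  fixes M :: "nat \<Rightarrow> complex mat" and p r :: nat
  assumes M: "\<And>i. M i \<in> carrier_mat n n" and M0: "M 0 = 1\<^sub>m n" and add: "\<And>i. M (Suc i) = M 1 * M i"
    and per: "M q = M 0" and q: "q = p ^ Suc r" and p: "prime p"
    and E: "E \<in> carrier_mat n n" "E * E = E" and EM: "\<And>i. E * M i = M i * E"
  shows "(\<Sum>j | j < q \<and> coprime j p. trace (E * M j)) \<in> \<int>"
proof -
  have q0: "q > 0" using q p prime_gt_0_nat by simp
  define \<zeta> where "\<zeta> k = cis (2 * pi * real k / real q)" for k
  have zpow: "\<zeta> k ^ i = \<zeta> (k * i)" for k i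
    by (simp add: \<zeta>_def DeMoivre mult_ac)
  have zq: "\<zeta> k ^ q = 1" for k
    using q0 by (simp add: \<zeta>_def DeMoivre cis_multiple_2pi)
  have z0: "\<zeta> k \<noteq> 0" for k by (simp add: \<zeta>_def)
  define y where "y k = inverse (\<zeta> k)" for k
  have yq: "y k ^ q = 1" for k using zq by (simp add: y_def power_inverse)
  define F where "F k = (1 / of_nat q) \<cdot>\<^sub>m lin_comb n q (\<lambda>i. y k ^ i) M" for k
  have Fc: "F k \<in> carrier_mat n n" for k by (simp add: F_def)
  have FF: "F k * F k = F k" for k
    unfolding F_def using M M0 add per q0 yq by (rule spectral_component_idempotent)
  have EF: "E * F k = F k * E" for k
    unfolding F_def using M E EM
    by (simp add: mult_smult_distrib[of _ n n _ n] mult_smult_assoc_mat[of _ n n _ n] lin_comb_mult_left lin_comb_mult_right)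
  \<comment> \<open>The multiplicity of the eigenvalue \<open>\<zeta> k\<close> of
    \<open>M 1\<close> on the image of \<open>E\<close>; it is integral because \<open>E\<close> and
    \<open>F k\<close> are commuting idempotents.\<close>
  define m where "m k = trace (E * F k)" for k
  have m_int: "m k \<in> \<int>" for k
    unfolding m_def
  proof (rule idempotent_trace)
    show "E * F k \<in> carrier_mat n n" using E Fc by (intro mult_carrier_mat)
    have "E * F k * (E * F k) = E * (F k * E) * F k"
      using E(1) Fc[of k] by (simp add: assoc_mult_mat[of _ n n _ n _ n] mult_carrier_mat[of _ n n _ n])
    also have "\<dots> = (E * E) * (F k * F k)"
      unfolding EF[symmetric] using E(1) Fc[of k]
      by (simp add: assoc_mult_mat[of _ n n _ n _ n] mult_carrier_mat[of _ n n _ n])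
    finally show "E * F k * (E * F k) = E * F k" using E(2) FF by simp
  qed
  define t where "t i = trace (E * M i)" for i
  have m_eq: "m k = (\<Sum>i<q. y k ^ i * t i) / of_nat q" for k
  proof -
    have "E * F k = (1 / of_nat q) \<cdot>\<^sub>m lin_comb n q (\<lambda>i. y k ^ i) (\<lambda>i. E * M i)"
      unfolding F_def using E M by (simp add: mult_smult_distrib[of _ n n _ n] lin_comb_mult_left)
    then show ?thesis unfolding m_def t_def
      using E M by (simp add: trace_smult[of _ n] trace_lin_comb mult_carrier_mat[of E n n _ n])
  qed
  \<comment> \<open>Orthogonality of the characters of the cyclic group of order \<open>q\<close>;
    it inverts the Fourier transform that leads from \<open>t\<close> to \<open>m\<close>.\<close>
  have orth: "(\<Sum>k<q. \<zeta> k ^ j * y k ^ i) = (if i = j then of_nat q else 0)" if "i < q" "j < q" for i j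
  proof -
    define w where "w = \<zeta> j * y i"
    have "\<zeta> k ^ j * y k ^ i = w ^ k" for k
      by (simp add: w_def power_mult_distrib y_def power_inverse zpow mult.commute)
    moreover have "w ^ q = 1" by (simp add: w_def power_mult_distrib zq yq)
    moreover have "w = 1 \<longleftrightarrow> i = j"
    proof
      assume "w = 1"
      then have "\<zeta> j = \<zeta> i" using z0[of i] by (simp add: w_def y_def field_simps)
      then have "cis (2 * pi * real j / real q) = cis (2 * pi * real i / real q)" by (simp add: \<zeta>_def)
      then show "i = j"
        using inj_onD[OF bij_betw_imp_inj_on[OF bij_betw_roots_unity[OF q0]], of i j] that by simp
    qed (simp add: w_def y_def z0)
    ultimately show ?thesis by (cases "i = j") (simp_all add: sum_gp_strict)
  qed
  have t_eq: "t j = (\<Sum>k<q. \<zeta> k ^ j * m k)" if j: "j < q" for j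
  proof -
    have "(\<Sum>k<q. \<zeta> k ^ j * m k) = (\<Sum>k<q. \<Sum>i<q. \<zeta> k ^ j * y k ^ i * t i / of_nat q)"
      by (simp add: m_eq sum_distrib_left sum_divide_distrib mult.assoc)
    also have "\<dots> = (\<Sum>i<q. \<Sum>k<q. \<zeta> k ^ j * y k ^ i * t i / of_nat q)" by (rule sum.swap)
    also have "\<dots> = (\<Sum>i<q. (\<Sum>k<q. \<zeta> k ^ j * y k ^ i) * t i / of_nat q)"
      by (simp add: sum_distrib_right sum_divide_distrib)
    also have "\<dots> = (\<Sum>i<q. (if i = j then of_nat q else 0) * t i / of_nat q)"
      using orth j by (intro sum.cong refl) simp
    also have "\<dots> = (\<Sum>i<q. if i = j then t i else 0)"
      using q0 by (intro sum.cong refl) auto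
    finally show ?thesis using j by simp
  qed
  \<comment> \<open>A Ramanujan sum: all residues minus the multiples of \<open>p\<close>, and both
    parts are full sums of powers of a root of unity.\<close>
  have ram: "(\<Sum>j | j < q \<and> coprime j p. \<zeta> k ^ j) \<in> \<int>" for k
  proof -
    have split: "{..<q} = {j. j < q \<and> coprime j p} \<union> (\<lambda>i. p * i) ` {..<p ^ r}"
    proof (intro equalityI subsetI)
      fix j assume j: "j \<in> {..<q}"
      show "j \<in> {j. j < q \<and> coprime j p} \<union> (\<lambda>i. p * i) ` {..<p ^ r}"
      proof (cases "p dvd j")
        case True
        then obtain i where "j = p * i" by blast
        then show ?thesis using j q p prime_gt_0_nat[OF p] by auto
      next
        case False
        then show ?thesis using j prime_imp_coprime[OF p False] by (simp add: coprime_commute)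
      qed
    qed (use q prime_gt_0_nat[OF p] in auto)
    have dis: "{j. j < q \<and> coprime j p} \<inter> (\<lambda>i. p * i) ` {..<p ^ r} = {}"
      using p by (auto simp: prime_nat_iff)
    have inj: "inj_on (\<lambda>i. p * i) {..<p ^ r}" using prime_gt_0_nat[OF p] by (auto simp: inj_on_def)
    have "(\<Sum>j<q. \<zeta> k ^ j) = (\<Sum>j | j < q \<and> coprime j p. \<zeta> k ^ j) + (\<Sum>i<p ^ r. (\<zeta> k ^ p) ^ i)"
      unfolding split by (subst sum.union_disjoint[OF _ _ dis]) (auto simp: sum.reindex[OF inj] power_mult)
    moreover have "(\<Sum>j<q. \<zeta> k ^ j) \<in> \<int>" using zq by (rule sum_powers_root_of_unity_in_Ints)
    moreover have "(\<Sum>i<p ^ r. (\<zeta> k ^ p) ^ i) \<in> \<int>"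
      using zq[of k] q by (intro sum_powers_root_of_unity_in_Ints) (simp add: power_mult[symmetric])
    ultimately show ?thesis by (metis Ints_diff add_diff_cancel_right')
  qed
  have "(\<Sum>j | j < q \<and> coprime j p. t j) = (\<Sum>j | j < q \<and> coprime j p. \<Sum>k<q. \<zeta> k ^ j * m k)"
    using t_eq by (intro sum.cong) auto
  also have "\<dots> = (\<Sum>k<q. \<Sum>j | j < q \<and> coprime j p. \<zeta> k ^ j * m k)" by (rule sum.swap)
  also have "\<dots> = (\<Sum>k<q. (\<Sum>j | j < q \<and> coprime j p. \<zeta> k ^ j) * m k)" by (simp add: sum_distrib_right)
  also have "\<dots> \<in> \<int>" by (rule Ints_sum) (rule Ints_mult[OF ram m_int])
  finally show ?thesis by (simp add: t_def)
qed

text \<open>Otherwise the nonzero integers \<open>C * \<theta> ^ k\<close> would tend to 0.\<close>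

lemma bounded_powers_Ints:
  fixes \<theta> C :: complex
  assumes C: "C \<noteq> 0" and i: "\<And>k. C * \<theta> ^ k \<in> \<int>"
  shows "cmod \<theta> = 0 \<or> 1 \<le> cmod \<theta>"
proof (rule ccontr)
  assume "\<not> ?thesis"
  then have t: "0 < cmod \<theta>" "cmod \<theta> < 1" by auto
  obtain k where "cmod \<theta> ^ k < 1 / cmod C"
    using t C real_arch_pow_inv[of "1 / cmod C" "cmod \<theta>"] by auto
  then have "cmod (C * \<theta> ^ k) < 1" using C by (simp add: norm_mult norm_power field_simps)
  moreover obtain z where z: "C * \<theta> ^ k = of_int z" using i Ints_cases by blast
  ultimately have "\<bar>z\<bar> < 1" by (metis norm_of_int of_int_abs of_int_less_1_iff)
  then show False using z C t by auto
qed

text \<open>One multiplier \<open>C\<close> for all powers forces modulus at least 1 on both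
  \<open>\<theta>\<close> and its inverse, hence modulus 1. The cases \<open>k = 0\<close> and
  \<open>k = 1\<close> exhibit \<open>\<theta>\<close> as a quotient of integers, so it is 1 or
  -1.\<close>

lemma Ints_powers_square_eq_1:
  fixes \<theta> C :: complex
  assumes C: "C \<noteq> 0" and i: "\<And>k. C * \<theta> ^ k \<in> \<int>" "\<And>k. C * inverse \<theta> ^ k \<in> \<int>" and t0: "\<theta> \<noteq> 0"
  shows "\<theta>\<^sup>2 = 1"
proof -
  have "1 \<le> cmod \<theta>" using bounded_powers_Ints[OF C i(1)] t0 by simp
  moreover have "1 \<le> cmod (inverse \<theta>)" using bounded_powers_Ints[OF C i(2)] t0 by simp
  ultimately have n1: "cmod \<theta> = 1" using t0 by (simp add: norm_inverse inverse_le_1_iff le_divide_eq_1 norm_divide divide_simps)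
  obtain a where a: "C = of_int a" using i(1)[of 0] by (auto elim: Ints_cases)
  obtain b where b: "C * \<theta> = of_int b" using i(1)[of 1] by (auto elim: Ints_cases)
  have "\<theta> = of_real (real_of_int b / real_of_int a)" using a b C by (simp add: field_simps)
  moreover from this have "\<bar>real_of_int b / real_of_int a\<bar> = 1" using n1 by (metis norm_of_real)
  ultimately show ?thesis by (metis abs_1 of_real_1 of_real_power power2_abs power_one)
qed

subsection \<open>Integral group rings of cyclic groups\<close>

text \<open>\<open>pcong m q\<close> is equality in \<open>(\<int>/q)[C\<^sub>m]\<close>, and in \<open>\<int>[C\<^sub>m]\<close> for \<open>q = 0\<close>.\<close>

definition pcong :: "nat \<Rightarrow> int \<Rightarrow> int poly \<Rightarrow> int poly \<Rightarrow> bool" where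
  "pcong m q f g \<longleftrightarrow> (\<exists>h k. f - g = (monom 1 m - 1) * h + smult q k)"

lemma pcongI: "f - g = (monom 1 m - 1) * h + smult q k \<Longrightarrow> pcong m q f g"
  unfolding pcong_def by blast

lemma pcong_refl [simp]: "pcong m q f f"
  by (rule pcongI[of _ _ _ 0 _ 0]) simp

lemma pcong_sym: "pcong m q f g \<Longrightarrow> pcong m q g f"
proof -
  assume "pcong m q f g"
  then obtain h k where "f - g = (monom 1 m - 1) * h + smult q k" unfolding pcong_def by blast
  then have "g - f = (monom 1 m - 1) * (- h) + smult q (- k)" by (simp add: algebra_simps)
  then show ?thesis by (rule pcongI)
qed

lemma pcong_add:
  assumes "pcong m q f g" "pcong m q f' g'"
  shows "pcong m q (f + f') (g + g')"
proof -
  obtain h k where 1: "f - g = (monom 1 m - 1) * h + smult q k" using assms(1) unfolding pcong_def by blast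
  obtain h' k' where 2: "f' - g' = (monom 1 m - 1) * h' + smult q k'" using assms(2) unfolding pcong_def by blast
  have "(f + f') - (g + g') = (f - g) + (f' - g')" by simp
  also have "\<dots> = (monom 1 m - 1) * (h + h') + smult q (k + k')"
    unfolding 1 2 by (simp add: algebra_simps smult_add_right)
  finally show ?thesis by (rule pcongI)
qed

lemma pcong_trans: "pcong m q f g \<Longrightarrow> pcong m q g h \<Longrightarrow> pcong m q f h"
proof -
  assume "pcong m q f g" "pcong m q g h"
  from pcong_add[OF this] obtain a b where "f + g - (g + h) = (monom 1 m - 1) * a + smult q b"
    unfolding pcong_def by blast
  then have "f - h = (monom 1 m - 1) * a + smult q b" by simp
  then show ?thesis by (rule pcongI)
qed

lemma pcong_scale: "pcong m q f g \<Longrightarrow> pcong m q (r * f) (r * g)"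
proof -
  assume "pcong m q f g"
  then obtain h k where 1: "f - g = (monom 1 m - 1) * h + smult q k" unfolding pcong_def by blast
  have "r * f - r * g = r * (f - g)" by (simp add: algebra_simps)
  also have "\<dots> = (monom 1 m - 1) * (r * h) + smult q (r * k)" unfolding 1 by (simp add: algebra_simps)
  finally show ?thesis by (rule pcongI)
qed

lemma pcong_mult:
  assumes "pcong m q f g" "pcong m q f' g'"
  shows "pcong m q (f * f') (g * g')"
proof -
  have "pcong m q (f * f') (f * g')" by (rule pcong_scale[OF assms(2)])
  moreover have "pcong m q (g' * f) (g' * g)" by (rule pcong_scale[OF assms(1)])
  ultimately show ?thesis using pcong_trans by (metis mult.commute)
qed

lemma pcong_pow: "pcong m q f g \<Longrightarrow> pcong m q (f ^ t) (g ^ t)"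
  by (induction t) (simp_all add: pcong_mult)

lemma pcong_smult: "pcong m q f g \<Longrightarrow> pcong m q (smult c f) (smult c g)"
  using pcong_scale[of m q f g "[:c:]"] by simp

lemma monom_minus_one_dvd:
  assumes "m dvd n"
  shows "(monom 1 m - 1 :: int poly) dvd monom 1 n - 1"
proof -
  obtain d where d: "n = m * d" using assms by blast
  have "monom 1 n - 1 = (monom 1 m :: int poly) ^ d - 1 ^ d" by (simp add: d monom_power mult.commute)
  then show ?thesis using power_diff_sumr2 dvd_triv_left by metis
qed

text \<open>Passage to a quotient of the cyclic group and to a coarser modulus. As every
  \<open>r\<close> divides 0, this also reduces an equality over the integers modulo
  \<open>r\<close>.\<close>

lemma pcong_weaken:
  assumes "pcong n q f g" "m dvd n" "r dvd q"
  shows "pcong m r f g"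
proof -
  obtain h k where 1: "f - g = (monom 1 n - 1) * h + smult q k" using assms(1) unfolding pcong_def by blast
  obtain d where d: "monom 1 n - 1 = (monom 1 m - 1 :: int poly) * d" using monom_minus_one_dvd[OF assms(2)] by blast
  obtain s where s: "q = r * s" using assms(3) by blast
  have "f - g = (monom 1 m - 1) * (d * h) + smult r (smult s k)" unfolding 1 d s by (simp add: mult.assoc)
  then show ?thesis by (rule pcongI)
qed

lemma pcong_monom_mod:
  assumes "[i = j] (mod m)"
  shows "pcong m q (monom 1 i) (monom 1 j)"
proof -
  have red: "pcong m q (monom 1 i) (monom 1 (i mod m))" for i
  proof -
    have "monom 1 i - monom 1 (i mod m) = (monom 1 (m * (i div m)) - 1) * (monom 1 (i mod m) :: int poly)"
      by (simp add: algebra_simps mult_monom)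
    then have "(monom 1 m - 1 :: int poly) dvd monom 1 i - monom 1 (i mod m)"
      using monom_minus_one_dvd[of m "m * (i div m)"] by simp
    then obtain h where "monom 1 i - monom 1 (i mod m) = (monom 1 m - 1 :: int poly) * h" by blast
    then show ?thesis by (intro pcongI[of _ _ _ h _ 0]) simp
  qed
  show ?thesis using red[of i] pcong_sym[OF red[of j]] assms pcong_trans unfolding cong_def by metis
qed

section \<open>Power substitutions and evaluation at complex numbers\<close>

definition subst_pow :: "nat \<Rightarrow> int poly \<Rightarrow> int poly" where
  "subst_pow k f = pcompose f (monom 1 k)"

lemma subst_pow_mult: "subst_pow k (f * g) = subst_pow k f * subst_pow k g"
  by (simp add: subst_pow_def pcompose_mult)

lemma subst_pow_add: "subst_pow k (f + g) = subst_pow k f + subst_pow k g"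
  by (simp add: subst_pow_def pcompose_add)

lemma subst_pow_diff: "subst_pow k (f - g) = subst_pow k f - subst_pow k g"
  by (simp add: subst_pow_def pcompose_diff)

lemma subst_pow_one [simp]: "subst_pow k 1 = 1"
  by (simp add: subst_pow_def pcompose_1)

lemma subst_pow_zero [simp]: "subst_pow k 0 = 0"
  by (simp add: subst_pow_def)

lemma subst_pow_power: "subst_pow k (f ^ t) = subst_pow k f ^ t"
  by (induction t) (simp_all add: subst_pow_mult)

lemma subst_pow_pCons: "subst_pow k (pCons c f) = [:c:] + monom 1 k * subst_pow k f"
  by (simp add: subst_pow_def pcompose_pCons)

lemma subst_pow_smult: "subst_pow k (smult c f) = smult c (subst_pow k f)"
  by (simp add: subst_pow_def pcompose_smult)

lemma subst_pow_monom: "subst_pow k (monom c i) = monom c (k * i)"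
proof (induction i)
  case (Suc i)
  have "monom c (Suc i) = pCons 0 (monom c i)" by (simp add: monom_Suc)
  then show ?case using Suc by (simp add: subst_pow_pCons mult_monom)
qed (simp add: subst_pow_def pcompose_const monom_0)

definition ceval :: "complex \<Rightarrow> int poly \<Rightarrow> complex" where
  "ceval z f = poly (map_poly of_int f) z"

lemma ceval_pCons: "ceval z (pCons c f) = of_int c + z * ceval z f"
proof -
  have "map_poly of_int (pCons c f) = pCons (of_int c) (map_poly of_int f :: complex poly)"
    by (intro poly_eqI) (simp add: coeff_map_poly coeff_pCons split: nat.split)
  then show ?thesis by (simp add: ceval_def)
qed

lemma ceval_zero [simp]: "ceval z 0 = 0"
  by (simp add: ceval_def)

lemma ceval_add: "ceval z (f + g) = ceval z f + ceval z g"
proof -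
  have "map_poly of_int (f + g) = map_poly of_int f + (map_poly of_int g :: complex poly)"
    by (intro poly_eqI) (simp add: coeff_map_poly)
  then show ?thesis by (simp add: ceval_def)
qed

lemma ceval_smult: "ceval z (smult c f) = of_int c * ceval z f"
  by (induction f) (simp_all add: ceval_pCons algebra_simps)

lemma ceval_mult: "ceval z (f * g) = ceval z f * ceval z g"
  by (induction f) (simp_all add: ceval_pCons ceval_add ceval_smult algebra_simps)

lemma ceval_diff: "ceval z (f - g) = ceval z f - ceval z g"
  using ceval_add[of z f "smult (-1) g"] ceval_smult[of z "-1" g] by simp

lemma ceval_monom: "ceval z (monom c i) = of_int c * z ^ i"
  by (simp add: ceval_def map_poly_monom poly_monom)

lemma ceval_one [simp]: "ceval z 1 = 1"
  using ceval_monom[of z 1 0] by simp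

lemma ceval_power: "ceval z (f ^ t) = ceval z f ^ t"
  by (induction t) (simp_all add: ceval_mult)

lemma ceval_sum: "ceval z (sum f A) = (\<Sum>i\<in>A. ceval z (f i))"
  by (induction A rule: infinite_finite_induct) (simp_all add: ceval_add)

lemma ceval_subst_pow: "ceval z (subst_pow k f) = ceval (z ^ k) f"
  by (induction f) (simp_all add: subst_pow_pCons ceval_add ceval_mult ceval_monom ceval_pCons)

lemma pcong_ceval:
  assumes "pcong m 0 f g" "z ^ m = 1"
  shows "ceval z f = ceval z g"
proof -
  obtain h where "f - g = (monom 1 m - 1) * h" using assms(1) unfolding pcong_def by auto
  then have "ceval z (f - g) = 0" using assms(2) by (simp add: ceval_mult ceval_diff ceval_monom)
  then show ?thesis by (simp add: ceval_diff)
qed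

text \<open>The substitution turns x^m - 1 into x^(k m) - 1, which is a multiple of it.\<close>

lemma pcong_subst_pow:
  assumes "pcong m q f g"
  shows "pcong m q (subst_pow k f) (subst_pow k g)"
proof -
  obtain h r where 1: "f - g = (monom 1 m - 1) * h + smult q r" using assms unfolding pcong_def by blast
  have "subst_pow k (f - g) = (monom 1 (k * m) - 1) * subst_pow k h + smult q (subst_pow k r)"
    unfolding 1 by (simp add: subst_pow_add subst_pow_mult subst_pow_diff subst_pow_monom subst_pow_smult)
  then have "pcong (k * m) q (subst_pow k f) (subst_pow k g)" by (intro pcongI) (simp add: subst_pow_diff)
  then show ?thesis by (rule pcong_weaken) simp_all
qed

lemma pcong_subst_pow_mod:
  assumes "[k = k'] (mod m)"
  shows "pcong m q (subst_pow k f) (subst_pow k' f)"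
  by (induction f) (auto simp: subst_pow_pCons intro!: pcong_add pcong_mult pcong_monom_mod[OF assms])

lemma subst_pow_const: "subst_pow k [:c:] = [:c:]"
  by (simp add: subst_pow_def)

lemma subst_pow_subst_pow: "subst_pow k (subst_pow l f) = subst_pow (k * l) f"
  by (induction f)
    (simp_all add: subst_pow_pCons subst_pow_add subst_pow_mult subst_pow_monom subst_pow_const)

section \<open>Coefficients in the integral group ring of a cyclic group\<close>

definition res_coeff :: "nat \<Rightarrow> nat \<Rightarrow> int poly \<Rightarrow> int" where
  "res_coeff m c f = (\<Sum>i\<le>degree f. if [i = c] (mod m) then coeff f i else 0)"

lemma res_coeff_bound:
  assumes "degree f \<le> d"
  shows "res_coeff m c f = (\<Sum>i\<le>d. if [i = c] (mod m) then coeff f i else 0)"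
  unfolding res_coeff_def using assms
  by (intro sum.mono_neutral_left) (auto simp: coeff_eq_0)

lemma res_coeff_add: "res_coeff m c (f + g) = res_coeff m c f + res_coeff m c g"
proof -
  define d where "d = max (degree f) (degree g)"
  have d: "degree f \<le> d" "degree g \<le> d" "degree (f + g) \<le> d"
    unfolding d_def by (auto simp: degree_add_le_max)
  show ?thesis unfolding d[THEN res_coeff_bound] sum.distrib[symmetric] by (intro sum.cong) auto
qed

lemma res_coeff_smult: "res_coeff m c (smult a f) = a * res_coeff m c f"
proof -
  have "res_coeff m c (smult a f) = (\<Sum>i\<le>degree f. if [i = c] (mod m) then coeff (smult a f) i else 0)"
    by (rule res_coeff_bound[OF degree_smult_le])
  also have "\<dots> = a * res_coeff m c f"
    unfolding res_coeff_def sum_distrib_left by (intro sum.cong) auto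
  finally show ?thesis .
qed

lemma res_coeff_zero [simp]: "res_coeff m c 0 = 0"
  using res_coeff_smult[of m c 0 0] by simp

lemma res_coeff_diff: "res_coeff m c (f - g) = res_coeff m c f - res_coeff m c g"
  using res_coeff_add[of m c f "smult (-1) g"] res_coeff_smult[of m c "-1" g] by simp

lemma res_coeff_monom: "res_coeff m c (monom a i) = (if [i = c] (mod m) then a else 0)"
proof -
  have "res_coeff m c (monom a i) = (\<Sum>j\<le>i. if [j = c] (mod m) then coeff (monom a i) j else 0)"
    by (rule res_coeff_bound[OF degree_monom_le])
  also have "\<dots> = (\<Sum>j\<in>{i}. if [j = c] (mod m) then coeff (monom a i) j else 0)"
    by (intro sum.mono_neutral_right) auto
  finally show ?thesis by simp
qed

lemma res_coeff_cong: "[c = c'] (mod m) \<Longrightarrow> res_coeff m c f = res_coeff m c' f"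
  by (simp add: res_coeff_def cong_def)

lemma int_poly_induct [case_names zero monom add]:
  fixes f :: "int poly"
  assumes "P 0" "\<And>a i. P (monom a i)" "\<And>f g. P f \<Longrightarrow> P g \<Longrightarrow> P (f + g)"
  shows "P f"
proof -
  have "P (\<Sum>i\<in>A. monom (coeff f i) i)" if "finite A" for A
    using that by (induction A rule: finite_induct) (simp_all add: assms)
  then show ?thesis using poly_as_sum_of_monoms[of f] by (metis finite_atMost)
qed

lemma res_coeff_ideal: "res_coeff m c ((monom 1 m - 1) * h) = 0"
proof (induction h rule: int_poly_induct)
  case (monom a i)
  have "(monom 1 m - 1) * monom a i = monom a (m + i) - monom a i"
    by (simp add: algebra_simps mult_monom)
  then show ?case by (simp only: res_coeff_diff res_coeff_monom) (simp add: cong_def)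
qed (simp_all add: res_coeff_add distrib_left)

lemma pcong_imp_res_coeff:
  assumes "pcong m q f g"
  shows "[res_coeff m c f = res_coeff m c g] (mod q)"
proof -
  obtain h k where 1: "f - g = (monom 1 m - 1) * h + smult q k" using assms unfolding pcong_def by blast
  have "res_coeff m c f - res_coeff m c g = q * res_coeff m c k"
    unfolding res_coeff_diff[symmetric] 1 by (simp add: res_coeff_add res_coeff_ideal res_coeff_smult)
  then show ?thesis by (simp add: cong_iff_dvd_diff)
qed

lemma pcong_sum_monoms:
  assumes "m > 0"
  shows "pcong m q f (\<Sum>c<m. monom (res_coeff m c f) c)"
proof (induction f rule: int_poly_induct)
  case (monom a i)
  have "(\<Sum>c<m. monom (res_coeff m c (monom a i)) c) = (\<Sum>c<m. if c = i mod m then monom a c else 0)"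
    by (intro sum.cong) (auto simp: res_coeff_monom cong_def)
  also have "\<dots> = monom a (i mod m)" using assms by simp
  finally have eq: "(\<Sum>c<m. monom (res_coeff m c (monom a i)) c) = smult a (monom 1 (i mod m))"
    by (simp add: smult_monom)
  have "pcong m q (smult a (monom 1 i)) (smult a (monom 1 (i mod m)))"
    by (intro pcong_smult pcong_monom_mod) (simp add: cong_def)
  then show ?case unfolding eq by (simp add: smult_monom)
next
  case (add f g)
  then show ?case using pcong_add[OF add] by (simp add: res_coeff_add add_monom[symmetric] sum.distrib)
qed simp

lemma smult_sum_right: "smult q (\<Sum>c\<in>A. f c) = (\<Sum>c\<in>A. smult q (f c))"
  by (induction A rule: infinite_finite_induct) (simp_all add: smult_add_right)

lemma pcong_if_res_coeff:
  assumes m: "m > 0" and q: "\<And>c. c < m \<Longrightarrow> [res_coeff m c f = res_coeff m c g] (mod q)"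
  shows "pcong m q f g"
proof -
  have "\<exists>d. \<forall>c<m. res_coeff m c f - res_coeff m c g = q * d c"
    using q unfolding cong_iff_dvd_diff dvd_def by metis
  then obtain d where d: "\<And>c. c < m \<Longrightarrow> res_coeff m c f - res_coeff m c g = q * d c" by blast
  have "(\<Sum>c<m. monom (res_coeff m c f) c) - (\<Sum>c<m. monom (res_coeff m c g) c) =
      (\<Sum>c<m. monom (res_coeff m c f - res_coeff m c g) c)"
    by (simp add: diff_monom sum_subtractf[symmetric])
  also have "\<dots> = smult q (\<Sum>c<m. monom (d c) c)"
    unfolding smult_sum_right using d by (intro sum.cong) (auto simp: smult_monom)
  finally have "pcong m q (\<Sum>c<m. monom (res_coeff m c f) c) (\<Sum>c<m. monom (res_coeff m c g) c)"
    by (intro pcongI[of _ _ _ 0]) simp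
  then show ?thesis using pcong_sum_monoms[OF m, of q f] pcong_sym[OF pcong_sum_monoms[OF m, of q g]] pcong_trans
    by blast
qed

text \<open>As \<open>k'\<close> inverts \<open>k\<close> modulo \<open>m\<close>, the exponent
  \<open>i\<close> is sent to \<open>c\<close> exactly when it is congruent to
  \<open>k' * c\<close>.\<close>

lemma res_coeff_subst_pow:
  assumes "[k * k' = 1] (mod m)"
  shows "res_coeff m c (subst_pow k f) = res_coeff m (k' * c) f"
proof (induction f rule: int_poly_induct)
  case (monom a i)
  have "[k * i = c] (mod m) \<longleftrightarrow> [i = k' * c] (mod m)"
  proof
    assume "[k * i = c] (mod m)"
    then have "[k' * (k * i) = k' * c] (mod m)" by (rule cong_scalar_left)
    moreover have "[k' * (k * i) = 1 * i] (mod m)"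
      using cong_scalar_right[OF assms, of i] by (simp add: mult_ac)
    ultimately show "[i = k' * c] (mod m)" using cong_sym cong_trans by (metis mult_1)
  next
    assume "[i = k' * c] (mod m)"
    then have "[k * i = k * (k' * c)] (mod m)" by (rule cong_scalar_left)
    moreover have "[k * (k' * c) = 1 * c] (mod m)"
      using cong_scalar_right[OF assms, of c] by (simp add: mult_ac)
    ultimately show "[k * i = c] (mod m)" using cong_trans by (metis mult_1)
  qed
  then show ?case by (simp add: subst_pow_monom res_coeff_monom)
qed (simp_all add: res_coeff_add subst_pow_add)

text \<open>A difference of coefficients that is divisible by every power of \<open>q\<close> is
  zero.\<close>

lemma pcong_all_powers:
  assumes m: "m > 0" and q: "q \<ge> 2" and all: "\<And>j. pcong m (q ^ j) f g"
  shows "pcong m 0 f g"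
proof (rule pcong_if_res_coeff[OF m])
  fix c
  define d where "d = res_coeff m c f - res_coeff m c g"
  have dv: "q ^ j dvd d" for j
    using pcong_imp_res_coeff[OF all] by (simp add: d_def cong_iff_dvd_diff)
  have "d = 0"
  proof (rule ccontr)
    assume d0: "d \<noteq> 0"
    have "\<bar>d\<bar> < 2 ^ nat \<bar>d\<bar>" using of_nat_less_two_power[of "nat \<bar>d\<bar>", where 'a = int] by simp
    also have "\<dots> \<le> q ^ nat \<bar>d\<bar>" using q by (intro power_mono) auto
    also have "\<dots> \<le> \<bar>d\<bar>" using dvd_imp_le_int[OF d0 dv[of "nat \<bar>d\<bar>"]] by linarith
    finally show False by simp
  qed
  then show "[res_coeff m c f = res_coeff m c g] (mod 0)" by (simp add: d_def)
qed

section \<open>Lifting the exponent and its converse\<close>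

lemma binomial_expansion_cubic:
  fixes w :: "'a::comm_ring_1"
  shows "\<exists>R. (1 + w) ^ n = 1 + of_nat n * w + of_nat (n choose 2) * w\<^sup>2 + w ^ 3 * R"
proof (induction n)
  case 0
  show ?case by (intro exI[of _ 0]) (simp add: binomial_eq_0)
next
  case (Suc n)
  then obtain R where R: "(1 + w) ^ n = 1 + of_nat n * w + of_nat (n choose 2) * w\<^sup>2 + w ^ 3 * R" by blast
  have ch: "Suc n choose 2 = n + (n choose 2)" by (simp add: numeral_2_eq_2)
  have "(1 + w) ^ Suc n = 1 + of_nat (Suc n) * w + of_nat (Suc n choose 2) * w\<^sup>2 + w ^ 3 * (of_nat (n choose 2) + R + w * R)"
    unfolding power_Suc R ch by (simp add: algebra_simps power2_eq_square power3_eq_cube)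
  then show ?case by blast
qed

text \<open>For odd \<open>q\<close> the second binomial coefficient is divisible by
  \<open>q\<close>, so the quadratic term carries at least 2 i + 1 factors \<open>q\<close> and the
  cubic remainder 3 i; both numbers are at least i + 2 as \<open>i \<ge> 1\<close>.\<close>

lemma pcong_power_prime:
  fixes q :: int
  assumes q: "odd q" "q > 0" and i: "i \<ge> 1" and z: "pcong m 0 Z (1 + smult (q ^ i) z)"
  shows "pcong m (q ^ (i + 2)) (Z ^ nat q) (1 + smult (q ^ (i + 1)) z)"
proof -
  define w where "w = smult (q ^ i) z"
  obtain R where R: "(1 + w) ^ nat q = 1 + of_nat (nat q) * w + of_nat (nat q choose 2) * w\<^sup>2 + w ^ 3 * R"
    using binomial_expansion_cubic by blast
  have nq: "of_nat (nat q) = [:q:]" using q by (simp add: of_nat_poly)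
  have "nat q choose 2 = nat q * ((nat q - 1) div 2)"
    using q by (simp add: choose_two even_nat_iff div_mult_swap)
  then have cq: "of_nat (nat q choose 2) = smult q (of_nat ((nat q - 1) div 2) :: int poly)"
    using nq by (simp add: of_nat_mult)
  obtain s where s: "i = Suc s" using i by (cases i) auto
  have t1: "of_nat (nat q) * w = smult (q ^ (i + 1)) z" by (simp add: nq w_def mult.commute)
  have t2: "of_nat (nat q choose 2) * w\<^sup>2 = smult (q ^ (i + 2)) (smult (q ^ s) (of_nat ((nat q - 1) div 2) * z\<^sup>2))"
    unfolding cq by (simp add: w_def s power2_eq_square power_add mult_ac)
  have t3: "w ^ 3 * R = smult (q ^ (i + 2)) (smult (q ^ s * q ^ s) (z ^ 3 * R))"
    by (simp add: w_def s power3_eq_cube power_add mult_ac)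
  have "(1 + w) ^ nat q - (1 + smult (q ^ (i + 1)) z) =
     smult (q ^ (i + 2)) (smult (q ^ s) (of_nat ((nat q - 1) div 2) * z\<^sup>2) + smult (q ^ s * q ^ s) (z ^ 3 * R))"
    unfolding R t1 t2 t3 by (simp add: smult_add_right)
  then have "pcong m (q ^ (i + 2)) ((1 + w) ^ nat q) (1 + smult (q ^ (i + 1)) z)"
    by (intro pcongI[of _ _ _ 0]) simp
  moreover have "pcong m (q ^ (i + 2)) (Z ^ nat q) ((1 + w) ^ nat q)"
    unfolding w_def by (intro pcong_pow pcong_weaken[OF z]) simp_all
  ultimately show ?thesis using pcong_trans by blast
qed

lemma pcong_one_E:
  assumes "pcong m Q Z 1"
  obtains z where "pcong m 0 Z (1 + smult Q z)"
proof -
  obtain h k where "Z - 1 = (monom 1 m - 1) * h + smult Q k" using assms unfolding pcong_def by blast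
  then have "Z - (1 + smult Q k) = (monom 1 m - 1) * h + smult 0 0" by (simp add: algebra_simps)
  then show ?thesis using that pcongI by blast
qed

lemma pcong_power_lift:
  fixes q :: int
  assumes q: "odd q" "q > 0" and i: "i \<ge> 1" and Z: "pcong m (q ^ i) Z 1"
  shows "pcong m (q ^ (i + 1)) (Z ^ nat q) 1"
proof -
  obtain z where z: "pcong m 0 Z (1 + smult (q ^ i) z)" using Z by (rule pcong_one_E)
  have "pcong m (q ^ (i + 1)) (Z ^ nat q) (1 + smult (q ^ (i + 1)) z)"
    by (rule pcong_weaken[OF pcong_power_prime[OF q i z]]) simp_all
  moreover have "pcong m (q ^ (i + 1)) (1 + smult (q ^ (i + 1)) z) 1"
    by (rule pcongI[of _ _ _ 0 _ z]) simp
  ultimately show ?thesis using pcong_trans by blast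
qed

lemma pcong_power_lift_iterate:
  fixes q :: int
  assumes q: "odd q" "q > 0" and Z: "pcong m q Z 1"
  shows "pcong m (q ^ (e + 1)) (Z ^ (nat q ^ e)) 1"
proof (induction e)
  case (Suc e)
  then show ?case using pcong_power_lift[OF q _ Suc] by (simp add: power_mult[symmetric] mult.commute)
qed (use Z in simp)

text \<open>Writing \<open>Z\<close> as 1 + q^i z, the expansion of its \<open>q\<close>-th power
  makes q^(i+1) z vanish modulo q^(i+2). Cancelling coefficientwise, z vanishes modulo
  \<open>q\<close>.\<close>

lemma pcong_power_descend:
  fixes q :: int
  assumes q: "odd q" "q > 0" and m: "m > 0" and i: "i \<ge> 1" and Z: "pcong m (q ^ i) Z 1"
    and Zq: "pcong m (q ^ (i + 2)) (Z ^ nat q) 1"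
  shows "pcong m (q ^ (i + 1)) Z 1"
proof -
  obtain z where z: "pcong m 0 Z (1 + smult (q ^ i) z)" using Z by (rule pcong_one_E)
  have c: "pcong m (q ^ (i + 2)) (1 + smult (q ^ (i + 1)) z) 1"
    using pcong_trans[OF pcong_sym[OF pcong_power_prime[OF q i z]] Zq] .
  have "pcong m q z 0"
  proof (rule pcong_if_res_coeff[OF m])
    fix c'
    have "q ^ (i + 2) dvd q ^ (i + 1) * res_coeff m c' z"
      using pcong_imp_res_coeff[OF c, of c'] by (simp add: cong_iff_dvd_diff res_coeff_add res_coeff_smult)
    then have "q ^ (i + 1) * q dvd q ^ (i + 1) * res_coeff m c' z" by (simp add: mult.commute)
    then have "q dvd res_coeff m c' z" using q by (subst (asm) dvd_mult_cancel_left) auto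
    then show "[res_coeff m c' z = res_coeff m c' 0] (mod q)" by (simp add: cong_iff_dvd_diff)
  qed
  then obtain h k where hk: "z = (monom 1 m - 1) * h + smult q k" unfolding pcong_def by auto
  have "pcong m (q ^ (i + 1)) (1 + smult (q ^ i) z) 1"
    by (rule pcongI[of _ _ _ "smult (q ^ i) h" _ k]) (simp add: hk smult_add_right mult.commute)
  moreover have "pcong m (q ^ (i + 1)) Z (1 + smult (q ^ i) z)"
    by (rule pcong_weaken[OF z]) simp_all
  ultimately show ?thesis using pcong_trans by blast
qed

text \<open>A \<open>q\<close>-th power gains exactly one factor \<open>q\<close> unless a surplus
  was there before, so a surplus found after \<open>r\<close> powers descends to \<open>Z\<close>.
  The induction trades \<open>Z\<close> at level \<open>i\<close> for \<open>Z ^ nat q\<close> at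
  level \<open>i + 1\<close>.\<close>

lemma pcong_power_descend_iterate:
  fixes q :: int
  assumes q: "odd q" "q > 0" and m: "m > 0"
  shows "i \<ge> 1 \<Longrightarrow> pcong m (q ^ i) Z 1 \<Longrightarrow> pcong m (q ^ (i + r + 1)) (Z ^ (nat q ^ r)) 1 \<Longrightarrow>
    pcong m (q ^ (i + 1)) Z 1"
proof (induction r arbitrary: i Z)
  case (Suc r)
  have "pcong m (q ^ (i + 1)) (Z ^ nat q) 1" using pcong_power_lift[OF q Suc.prems(1,2)] .
  moreover have "pcong m (q ^ (i + 1 + r + 1)) ((Z ^ nat q) ^ (nat q ^ r)) 1"
    using Suc.prems(3) by (simp add: power_mult[symmetric])
  ultimately have "pcong m (q ^ (i + 1 + 1)) (Z ^ nat q) 1" using Suc.IH[of "i + 1" "Z ^ nat q"] by simp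
  then have "pcong m (q ^ (i + 2)) (Z ^ nat q) 1" by simp
  then show ?case using pcong_power_descend[OF q m Suc.prems(1,2)] by blast
qed simp

text \<open>Powering explains exponents growing like \<open>e\<close>; the hypothesis has them
  growing like 2 e. So there is a surplus at every level, and \<open>Z\<close> is 1 modulo all
  powers of \<open>q\<close>.\<close>

lemma pcong_one_of_quadratic_convergence:
  fixes q :: int
  assumes q: "odd q" "q \<ge> 2" and m: "m > 0"
    and Z: "\<And>e. pcong m (q ^ (2 * (e + 1))) (Z ^ (nat q ^ e)) 1"
  shows "pcong m 0 Z 1"
proof (rule pcong_all_powers[OF m q(2)])
  have q0: "q > 0" using q by simp
  have pos: "pcong m (q ^ Suc j) Z 1" for j
  proof (induction j)
    case 0
    show ?case by (rule pcong_weaken[OF Z[of 0, simplified]]) simp_all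
  next
    case (Suc j)
    \<comment> \<open>Descending at level \<open>Suc j\<close> after \<open>Suc j\<close> powers
      requires the exponent 2 j + 3; the hypothesis supplies 2 j + 4.\<close>
    have "pcong m (q ^ (Suc j + Suc j + 1)) (Z ^ (nat q ^ Suc j)) 1"
      by (rule pcong_weaken[OF Z[of "Suc j"]]) (simp_all add: le_imp_power_dvd)
    then show ?case using pcong_power_descend_iterate[OF q(1) q0 m _ Suc, of "Suc j"] by simp
  qed
  show "pcong m (q ^ j) Z 1" for j
    by (rule pcong_weaken[OF pos[of j]]) simp_all
qed

text \<open>The group ring modulo \<open>q\<close> is finite, so two powers of \<open>Y\<close>
  coincide there, and the inverse \<open>Y'\<close> cancels the smaller one.\<close>

lemma pcong_torsion_mod:
  assumes n: "n > 0" and q: "q > 0" and inv: "pcong n 0 (Y * Y') 1"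
  shows "\<exists>t>0. pcong n q (Y ^ t) 1"
proof -
  define F where "F i = (\<lambda>c\<in>{..<n}. res_coeff n c (Y ^ i) mod q)" for i :: nat
  have "F i \<in> {..<n} \<rightarrow>\<^sub>E {0..<q}" for i unfolding F_def restrict_PiE_iff using q by simp
  then have "range F \<subseteq> {..<n} \<rightarrow>\<^sub>E {0..<q}" by blast
  then have "finite (range F)" using finite_PiE[of "{..<n}" "\<lambda>_. {0..<q}"] finite_subset by auto
  then have "\<not> inj F" using finite_imageD infinite_UNIV_nat by blast
  then obtain i j where ij: "F i = F j" "i < j" by (metis injI linorder_neqE_nat)
  have "pcong n q (Y ^ i) (Y ^ j)"
  proof (rule pcong_if_res_coeff[OF n])
    fix c assume "c < n"
    then show "[res_coeff n c (Y ^ i) = res_coeff n c (Y ^ j)] (mod q)"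
      using fun_cong[OF ij(1), of c] by (simp add: F_def cong_def)
  qed
  then have "pcong n q (Y' ^ i * Y ^ i) (Y' ^ i * Y ^ j)" by (rule pcong_scale)
  moreover have inv': "pcong n q ((Y * Y') ^ i) (1 ^ i)"
    by (intro pcong_pow pcong_weaken[OF inv]) simp_all
  moreover have "Y' ^ i * Y ^ i = (Y * Y') ^ i" by (simp add: power_mult_distrib mult.commute)
  moreover have "Y' ^ i * Y ^ j = Y ^ (j - i) * (Y * Y') ^ i"
    using ij(2) power_add[of Y "j - i" i] by (simp add: power_mult_distrib mult_ac)
  ultimately have "pcong n q (Y ^ (j - i) * (Y * Y') ^ i) (1 ^ i)"
    using pcong_sym pcong_trans by metis
  moreover have "pcong n q (Y ^ (j - i) * (Y * Y') ^ i) (Y ^ (j - i) * 1 ^ i)"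
    by (rule pcong_scale[OF inv'])
  ultimately have "pcong n q (Y ^ (j - i)) 1" using pcong_sym pcong_trans by (metis mult_1_right power_one)
  then show ?thesis using ij(2) by (intro exI[of _ "j - i"]) simp
qed

section \<open>Geometric sums and Bass units\<close>

definition geo :: "nat \<Rightarrow> nat \<Rightarrow> int poly" where
  "geo k j = (\<Sum>i<k. monom 1 (j * i))"

text \<open>\<open>geo k j\<close> is the quotient of x^(j k) - 1 by x^j - 1, so the product
  telescopes. The special case \<open>geo n 1\<close> is the norm element, the sum of all elements
  of the cyclic group.\<close>

lemma geo_mult: "geo k j * geo l (j * k) = geo (k * l) j"
proof (induction l)
  case (Suc l)
  have "geo k j * monom 1 (j * k * l) = (\<Sum>i<k. monom 1 (j * (k * l + i)))"
    by (simp add: geo_def sum_distrib_right mult_monom distrib_left mult.assoc add.commute)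
  also have "geo (k * l) j + \<dots> = geo (k * Suc l) j"
  proof -
    have "{..<k * l + k} = {..<k * l} \<union> {k * l..<k * l + k}" by auto
    then have "geo (k * Suc l) j = geo (k * l) j + (\<Sum>i\<in>{k * l..<k * l + k}. monom 1 (j * i))"
      unfolding geo_def by (simp add: add.commute[of k] sum.union_disjoint ivl_disj_int)
    also have "(\<Sum>i\<in>{k * l..<k * l + k}. monom 1 (j * i)) = (\<Sum>i<k. monom (1::int) (j * (k * l + i)))"
      using sum.shift_bounds_nat_ivl[of "\<lambda>i. monom (1::int) (j * i)" 0 "k * l" k]
      by (simp add: atLeast0LessThan add.commute)
    finally show ?thesis by simp
  qed
  finally show ?case using Suc by (simp add: geo_def distrib_left algebra_simps)
qed (simp add: geo_def)

lemma poly_geo_1: "poly (geo k j) 1 = int k"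
  by (simp add: geo_def poly_sum poly_monom)

lemma pcong_poly_1: "pcong m 0 f g \<Longrightarrow> poly f 1 = poly g 1"
proof -
  assume "pcong m 0 f g"
  then obtain h where "f - g = (monom 1 m - 1) * h" unfolding pcong_def by auto
  then have "poly (f - g) 1 = 0" by (simp add: poly_monom)
  then show ?thesis by simp
qed

lemma norm_element_shift: "pcong n 0 (monom 1 i * geo n 1) (geo n 1)"
proof (induction i)
  case (Suc i)
  have "monom 1 1 * geo n 1 = (\<Sum>i<n. monom 1 (Suc i))"
    by (simp add: geo_def sum_distrib_left mult_monom)
  also have "\<dots> = geo n 1 + (monom 1 n - 1)"
  proof -
    have "(\<Sum>i<Suc n. monom (1::int) i) = monom 1 0 + (\<Sum>i<n. monom 1 (Suc i))"
      by (rule sum.lessThan_Suc_shift)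
    then show ?thesis by (simp add: geo_def algebra_simps)
  qed
  finally have "monom 1 1 * geo n 1 - geo n 1 = (monom 1 n - 1) * 1 + smult 0 0" by simp
  then have 1: "pcong n 0 (monom 1 1 * geo n 1) (geo n 1)" by (rule pcongI)
  have "monom (1::int) (Suc i) = monom 1 i * monom 1 1" by (simp add: mult_monom)
  then have "monom 1 (Suc i) * geo n 1 = monom 1 i * (monom 1 1 * geo n 1)" by (simp only: mult.assoc)
  then show ?case using pcong_trans[OF pcong_scale[OF 1, of "monom 1 i"] Suc] by (simp only:)
qed (simp add: monom_0 one_pCons[symmetric])

text \<open>Every power of x fixes the norm element, so \<open>f\<close> acts on it through its
  augmentation \<open>poly f 1\<close>.\<close>

lemma norm_element_absorb: "pcong n 0 (f * geo n 1) (smult (poly f 1) (geo n 1))"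
proof (induction f rule: int_poly_induct)
  case (monom a i)
  have "pcong n 0 (smult a (monom 1 i * geo n 1)) (smult a (geo n 1))"
    by (rule pcong_smult[OF norm_element_shift])
  then show ?case by (simp add: smult_monom poly_monom mult_smult_left[symmetric] del: mult_smult_left)
next
  case (add f g)
  then show ?case using pcong_add[OF add] by (simp add: distrib_right smult_add_left)
qed simp

text \<open>After the constant term the sum runs through the whole cyclic group \<open>d\<close>
  times.\<close>

lemma pcong_geo_one_plus:
  "pcong n 0 (geo (Suc (n * d)) 1) (1 + smult (int d) (geo n 1))"
proof -
  have "geo (Suc (n * d)) 1 = 1 + monom 1 1 * geo (n * d) 1"
    unfolding geo_def sum.lessThan_Suc_shift by (simp add: sum_distrib_left mult_monom monom_0)
  also have "geo (n * d) 1 = geo d n * geo n 1" using geo_mult[of n 1 d] by (simp add: mult.commute)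
  finally have "geo (Suc (n * d)) 1 = 1 + (monom 1 1 * geo d n) * geo n 1" by (simp add: mult.assoc)
  moreover have "pcong n 0 ((monom 1 1 * geo d n) * geo n 1) (smult (int d) (geo n 1))"
    using norm_element_absorb[of n "monom 1 1 * geo d n"] by (simp add: poly_monom poly_geo_1)
  ultimately show ?thesis by (simp add: pcong_add)
qed

lemma pcong_norm_element_mult:
  "pcong n 0 ((1 + smult a (geo n 1)) * (1 + smult b (geo n 1))) (1 + smult (a + b + a * b * int n) (geo n 1))"
proof -
  have "pcong n 0 (geo n 1 * geo n 1) (smult (int n) (geo n 1))"
    using norm_element_absorb[of n "geo n 1"] by (simp add: poly_geo_1)
  from pcong_smult[OF this, of "a * b"]
  have "pcong n 0 (1 + smult (a + b) (geo n 1) + smult (a * b) (geo n 1 * geo n 1))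
      (1 + smult (a + b) (geo n 1) + smult (a * b) (smult (int n) (geo n 1)))"
    by (intro pcong_add pcong_refl)
  then show ?thesis by (simp add: algebra_simps smult_add_left)
qed

text \<open>For \<open>l\<close> inverse to \<open>\<kappa>\<close> modulo \<open>n\<close>, the
  product of \<open>geo \<kappa> 1\<close> and \<open>geo l \<kappa>\<close> is 1 up to a multiple
  of the norm element \<open>N\<close>. The power \<open>r\<close> makes both augmentations 1 modulo
  \<open>n\<close>, so multiples of \<open>N\<close> can correct them to 1. Then
  \<open>u * u'\<close> is 1 plus a multiple of \<open>N\<close>, and comparing augmentations
  removes that multiple.\<close>

lemma bass_unit:
  assumes n: "n > 0" and \<kappa>: "coprime \<kappa> n"
  obtains u u' c r where "r > 0" "u = geo \<kappa> 1 ^ r + smult c (geo n 1)" "pcong n 0 (u * u') 1"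
proof -
  define N where "N = geo n 1"
  obtain l0 where l0: "[\<kappa> * l0 = 1] (mod n)" using cong_solve_coprime_nat[OF \<kappa>] by auto
  \<comment> \<open>The shift by \<open>n\<close> keeps the congruence and makes
    \<open>\<kappa> * l\<close> positive unless \<open>\<kappa> = 0\<close>, which can happen only
    for \<open>n = 1\<close>.\<close>
  define l where "l = l0 + n * (if \<kappa> * l0 = 0 then 1 else 0)"
  have "[\<kappa> * l = \<kappa> * l0] (mod n)" by (simp add: l_def cong_def distrib_left)
  then have l: "[\<kappa> * l = 1] (mod n)" using l0 cong_trans by blast
  define r where "r = totient n"
  have r: "r > 0" using n by (simp add: r_def)
  have \<kappa>r: "[\<kappa> ^ r = 1] (mod n)" unfolding r_def by (rule euler_theorem[OF \<kappa>])
  have "coprime l n"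
    unfolding coprime_iff_invertible_nat using l by (intro exI[of _ \<kappa>]) (simp add: mult.commute)
  then have lr: "[l ^ r = 1] (mod n)" unfolding r_def by (rule euler_theorem)
  have div: "\<exists>c. int w + c * int n = 1" if "[w = 1] (mod n)" for w
  proof -
    have "[int w = 1] (mod int n)" using that by (metis cong_int_iff of_nat_1)
    then obtain e where "int w - 1 = int n * e" by (auto simp: cong_iff_dvd_diff)
    then show ?thesis by (intro exI[of _ "- e"]) (simp add: algebra_simps)
  qed
  obtain c where c: "int (\<kappa> ^ r) + c * int n = 1" using div[OF \<kappa>r] by blast
  obtain c' where c': "int (l ^ r) + c' * int n = 1" using div[OF lr] by blast
  define u where "u = geo \<kappa> 1 ^ r + smult c N"
  define u' where "u' = geo l \<kappa> ^ r + smult c' N"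
  have pu: "poly u 1 = 1" "poly u' 1 = 1"
    using c c' by (simp_all add: u_def u'_def N_def poly_geo_1 poly_power)
  have "\<exists>e. pcong n 0 (geo (\<kappa> * l) 1) (1 + smult e N)"
  proof (cases "\<kappa> * l = 0")
    case True
    then have "n = 1" using l n by (auto simp: cong_def split: if_splits) 
    then have "N = 1" by (simp add: N_def geo_def monom_0)
    then have "geo (\<kappa> * l) 1 = 1 + smult (-1) N" unfolding True by (simp add: geo_def one_pCons)
    then show ?thesis by (metis pcong_refl)
  next
    case False
    obtain d where "\<kappa> * l = 1 + n * d"
      using l False cong_to_1'_nat[of "\<kappa> * l" n] by (metis add.commute mult.commute less_numeral_extra(3) neq0_conv)
    then show ?thesis using pcong_geo_one_plus[of n d] by (auto simp: N_def)
  qed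
  then obtain e where e: "pcong n 0 (geo (\<kappa> * l) 1) (1 + smult e N)" by blast
  have "\<exists>e'. pcong n 0 ((1 + smult e N) ^ j) (1 + smult e' N)" for j
  proof (induction j)
    case 0
    show ?case by (intro exI[of _ 0]) simp
  next
    case (Suc j)
    then obtain e' where "pcong n 0 ((1 + smult e N) ^ j) (1 + smult e' N)" by blast
    then have "pcong n 0 ((1 + smult e N) ^ Suc j) ((1 + smult e N) * (1 + smult e' N))"
      unfolding power_Suc by (rule pcong_scale)
    then show ?case using pcong_norm_element_mult[of n e e'] pcong_trans unfolding N_def by blast
  qed
  then obtain e' where e': "pcong n 0 ((1 + smult e N) ^ r) (1 + smult e' N)" by blast
  have "geo \<kappa> 1 * geo l \<kappa> = geo (\<kappa> * l) 1" using geo_mult[of \<kappa> 1 l] by simp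
  then have gl: "pcong n 0 (geo \<kappa> 1 ^ r * geo l \<kappa> ^ r) (1 + smult e' N)"
    using pcong_trans[OF pcong_pow[OF e] e'] by (metis power_mult_distrib)
  have ab: "pcong n 0 (f * N) (smult (poly f 1) N)" for f
    unfolding N_def by (rule norm_element_absorb)
  define b where "b = e' + c * poly u' 1 + c' * poly (geo \<kappa> 1 ^ r) 1"
  have "u * u' = geo \<kappa> 1 ^ r * geo l \<kappa> ^ r + smult c (u' * N) + smult c' (geo \<kappa> 1 ^ r * N)"
    by (simp add: u_def u'_def algebra_simps smult_add_right)
  moreover have "pcong n 0 (geo \<kappa> 1 ^ r * geo l \<kappa> ^ r + smult c (u' * N) + smult c' (geo \<kappa> 1 ^ r * N))
     (1 + smult e' N + smult c (smult (poly u' 1) N) + smult c' (smult (poly (geo \<kappa> 1 ^ r) 1) N))"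
    by (intro pcong_add gl pcong_smult ab)
  ultimately have uu: "pcong n 0 (u * u') (1 + smult b N)"
    by (simp add: b_def smult_add_left add.assoc)
  have "1 = 1 + b * int n"
    using pcong_poly_1[OF uu] pu by (simp add: N_def poly_geo_1)
  then have "b = 0" using n by simp
  then have "pcong n 0 (u * u') 1" using uu by simp
  then show ?thesis using that[OF r, of u c u'] by (simp add: u_def N_def)
qed

lemma cmod_eq_if_power_eq:
  fixes x y :: complex
  assumes "x ^ t = y ^ t" "t > 0"
  shows "cmod x = cmod y"
  using assms power_eq_iff_eq_base[of t "cmod x" "cmod y"] by (metis norm_ge_zero norm_power)

text \<open>For a symmetric unit \<open>Y\<close> of \<open>\<int>[C\<^sub>n]\<close>, the divisibility hypothesis says that the coefficients of
  \<open>Y\<^sup>t \<equiv> 1\<close> at the generators vanish to twice the expected order.  Hence \<open>Y\<^sup>t\<close> and its image under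
  \<open>x \<mapsto> x\<^sup>k\<close> agree to twice the expected order in \<open>\<int>[C\<^sub>m]\<close>; by lifting the exponent they are equal,
  which contradicts the absolute values at a primitive \<open>m\<close>-th root of unity.\<close>
lemma generator_coefficients_contradiction:
  fixes q :: int and m n k k' \<kappa> :: nat
  assumes n: "n > 0" and mn: "m dvd n" and m2: "m \<ge> 2" and \<kappa>: "coprime \<kappa> n"
    and kk: "[k * k' = 1] (mod m)"
    and nonunit: "\<And>c. c < m \<Longrightarrow> \<not> coprime c m \<Longrightarrow> [k' * c = c] (mod m) \<or> [k' * c + c = 0] (mod m)"
    and q: "odd q" "q \<ge> 3"
    and \<omega>: "\<omega> = cis (2 * pi / real m)"
    and neq: "cmod (\<Sum>i<\<kappa>. (\<omega> ^ k) ^ i) \<noteq> cmod (\<Sum>i<\<kappa>. \<omega> ^ i)"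
    and key: "\<And>V V' y e c. pcong n 0 (V * V') 1 \<Longrightarrow> pcong n 0 V (1 + smult (q ^ Suc e) y) \<Longrightarrow>
      coprime c m \<Longrightarrow> c < m \<Longrightarrow> q ^ Suc e dvd res_coeff m c y + res_coeff m (m - c) y"
  shows False
proof -
  have m: "m > 0" using m2 by simp
  obtain u u' b r where u: "r > 0" "u = geo \<kappa> 1 ^ r + smult b (geo n 1)" "pcong n 0 (u * u') 1"
    by (rule bass_unit[OF n \<kappa>])
  \<comment> \<open>Inversion, as \<open>n - 1\<close> is -1 modulo \<open>n\<close>. Multiplying
    \<open>u\<close> by its image makes coefficients at opposite exponents agree and turns values at
    roots of unity into squared absolute values.\<close>
  define \<sigma> where "\<sigma> = subst_pow (n - 1)"
  define Y where "Y = u * \<sigma> u"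
  define Y' where "Y' = u' * \<sigma> u'"
  have YY: "pcong n 0 (Y * Y') 1"
  proof -
    have "pcong n 0 (\<sigma> (u * u')) (\<sigma> 1)" unfolding \<sigma>_def by (rule pcong_subst_pow[OF u(3)])
    then have "pcong n 0 (\<sigma> u * \<sigma> u') 1" by (simp add: \<sigma>_def subst_pow_mult)
    from pcong_mult[OF u(3) this] show ?thesis by (simp add: Y_def Y'_def mult_ac)
  qed
  have nn: "[(n - 1) * (n - 1) = 1] (mod n)"
  proof -
    have "int ((n - 1) * (n - 1)) - 1 = int n * (int n - 2)"
      using n by (cases n) (simp_all add: algebra_simps)
    then have "[int ((n - 1) * (n - 1)) = int 1] (mod int n)" by (simp add: cong_iff_dvd_diff)
    then show ?thesis unfolding cong_int_iff .
  qed
  have \<sigma>Y: "pcong n 0 (\<sigma> Y) Y"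
  proof -
    have "pcong n 0 (\<sigma> (\<sigma> u)) (subst_pow 1 u)"
      unfolding \<sigma>_def subst_pow_subst_pow by (rule pcong_subst_pow_mod[OF nn])
    then have "pcong n 0 (\<sigma> (\<sigma> u)) u" by (simp add: subst_pow_def monom_altdef pcompose_idR)
    then have "pcong n 0 (\<sigma> u * \<sigma> (\<sigma> u)) (\<sigma> u * u)" by (rule pcong_scale)
    then show ?thesis by (simp add: Y_def \<sigma>_def subst_pow_mult mult.commute)
  qed
  have nnm: "[(n - 1) * (n - 1) = 1] (mod m)" using cong_dvd_modulus_nat[OF nn mn] .
  have sym: "res_coeff m c (Y ^ t) = res_coeff m c' (Y ^ t)" if c: "[c + c' = 0] (mod m)" for c c' t
  proof -
    have "pcong m 0 (\<sigma> Y ^ t) (Y ^ t)" by (rule pcong_pow[OF pcong_weaken[OF \<sigma>Y mn]]) simp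
    then have "pcong m 0 (\<sigma> (Y ^ t)) (Y ^ t)" by (simp add: \<sigma>_def subst_pow_power)
    then have "res_coeff m c (Y ^ t) = res_coeff m c (\<sigma> (Y ^ t))"
      using pcong_imp_res_coeff[of m 0 "\<sigma> (Y ^ t)" "Y ^ t" c] by simp
    also have "\<dots> = res_coeff m ((n - 1) * c) (Y ^ t)"
      unfolding \<sigma>_def by (rule res_coeff_subst_pow[OF nnm])
    also have "\<dots> = res_coeff m c' (Y ^ t)"
    proof (rule res_coeff_cong)
      have "(n - 1) * c + c = n * c" using n by (cases n) auto
      then have "[(n - 1) * c + c = 0] (mod m)" using mn by (simp add: cong_0_iff)
      moreover have "[c' + c = 0] (mod m)" using c by (simp add: add.commute)
      ultimately have "[(n - 1) * c + c = c' + c] (mod m)" using cong_sym cong_trans by blast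
      then show "[(n - 1) * c = c'] (mod m)" by (simp add: cong_add_rcancel_nat)
    qed
    finally show ?thesis .
  qed
  obtain t0 where t0: "t0 > 0" "pcong n q (Y ^ t0) 1"
    using pcong_torsion_mod[OF n _ YY, of q] q by auto
  \<comment> \<open>The quotient of the two units to be compared; the aim is
    \<open>X ^ t0 = 1\<close> in the group ring of order \<open>m\<close>.\<close>
  define X where "X = subst_pow k Y * Y'"
  have conv: "pcong m (q ^ (2 * (e + 1))) ((X ^ t0) ^ (nat q ^ e)) 1" for e
  proof -
    define t where "t = t0 * nat q ^ e"
    define V where "V = Y ^ t"
    define Q where "Q = q ^ Suc e"
    have Q: "odd Q" "Q \<noteq> 0" using q by (simp_all add: Q_def)
    have "pcong n Q V 1"
      using pcong_power_lift_iterate[OF q(1) _ t0(2), of e] q by (simp add: Q_def V_def t_def power_mult)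
    then obtain y where y: "pcong n 0 V (1 + smult Q y)" by (rule pcong_one_E)
    have VV: "pcong n 0 (V * Y' ^ t) 1"
      using pcong_pow[OF YY, of t] by (simp add: V_def power_mult_distrib)
    \<comment> \<open>Away from 0 a coefficient of \<open>V\<close> is \<open>Q\<close> times that
      of \<open>y\<close>. By symmetry the sum in \<open>key\<close> is twice a coefficient of
      \<open>y\<close>, and \<open>Q\<close> is odd: this is the second factor
      \<open>Q\<close>.\<close>
    have dv: "Q * Q dvd res_coeff m c V" if c: "coprime c m" "c < m" for c
    proof -
      have c0: "c \<noteq> 0"
      proof
        assume "c = 0"
        then show False using c(1) m2 by simp
      qed
      have eq: "res_coeff m d V = Q * res_coeff m d y" if d: "d < m" "d \<noteq> 0" for d
      proof -
        have "res_coeff m d V = res_coeff m d (1 + smult Q y)"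
          using pcong_imp_res_coeff[OF pcong_weaken[OF y mn, of 0], of d] by simp
        moreover have "res_coeff m d 1 = 0"
          using res_coeff_monom[of m d 1 0] d by (simp add: monom_0 one_pCons cong_def)
        ultimately show ?thesis by (simp add: res_coeff_add res_coeff_smult)
      qed
      have "res_coeff m c V = res_coeff m (m - c) V"
        unfolding V_def using c by (intro sym) (simp add: cong_0_iff)
      then have "res_coeff m c y = res_coeff m (m - c) y"
        using eq[of c] eq[of "m - c"] c c0 Q by simp
      moreover have "Q dvd res_coeff m c y + res_coeff m (m - c) y"
        using key[OF VV y[unfolded Q_def] c] by (simp add: Q_def)
      ultimately have "Q dvd 2 * res_coeff m c y" by simp
      then have "Q dvd res_coeff m c y" using Q by (simp add: coprime_dvd_mult_right_iff)
      then show ?thesis using eq[of c] c c0 by (simp add: mult_dvd_mono)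
    qed
    \<comment> \<open>At exponents prime to \<open>m\<close> both coefficients vanish modulo
      \<open>Q * Q\<close>. At the others \<open>k' * c\<close> is \<open>c\<close> or
      \<open>- c\<close> modulo \<open>m\<close>, and the symmetry of \<open>V\<close>
      applies.\<close>
    have "pcong m (Q * Q) (subst_pow k V) V"
    proof (rule pcong_if_res_coeff[OF m])
      fix c assume c: "c < m"
      have 1: "res_coeff m c (subst_pow k V) = res_coeff m (k' * c) V" by (rule res_coeff_subst_pow[OF kk])
      show "[res_coeff m c (subst_pow k V) = res_coeff m c V] (mod (Q * Q))"
      proof (cases "coprime c m")
        case True
        have "coprime k' m"
          unfolding coprime_iff_invertible_nat using kk by (intro exI[of _ k]) (simp add: mult.commute)
        then have "coprime ((k' * c) mod m) m" using True m by simp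
        then have "Q * Q dvd res_coeff m ((k' * c) mod m) V" using dv m by simp
        moreover have "res_coeff m ((k' * c) mod m) V = res_coeff m (k' * c) V"
          by (rule res_coeff_cong) (simp add: cong_def)
        ultimately show ?thesis using dv[OF True c] unfolding 1 by (simp add: cong_iff_dvd_diff)
      next
        case False
        have "res_coeff m (k' * c) V = res_coeff m c V"
          using nonunit[OF c False] sym[of "k' * c" c t] res_coeff_cong unfolding V_def by blast
        then show ?thesis unfolding 1 by simp
      qed
    qed
    then have "pcong m (Q * Q) (Y' ^ t * subst_pow k V) (Y' ^ t * V)" by (rule pcong_scale)
    moreover have "pcong m (Q * Q) (V * Y' ^ t) 1" by (rule pcong_weaken[OF VV mn]) simp
    ultimately have "pcong m (Q * Q) (subst_pow k V * Y' ^ t) 1"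
      using pcong_trans by (metis mult.commute)
    moreover have "subst_pow k V * Y' ^ t = (X ^ t0) ^ (nat q ^ e)"
      by (simp add: V_def X_def subst_pow_power t_def power_mult power_mult_distrib)
    moreover have "Q * Q = q ^ (2 * (e + 1))" by (simp only: Q_def power_add[symmetric] mult_2 Suc_eq_plus1)
    ultimately show ?thesis by simp
  qed
  have "pcong m 0 (X ^ t0) 1"
    by (rule pcong_one_of_quadratic_convergence[OF q(1) _ m conv]) (use q in simp)
  moreover have \<omega>m: "\<omega> ^ m = 1" using m by (simp add: \<omega> DeMoivre)
  ultimately have "ceval \<omega> X ^ t0 = 1" using pcong_ceval[of m "X ^ t0" 1 \<omega>] by (simp add: ceval_power)
  then have X1: "(ceval (\<omega> ^ k) Y * ceval \<omega> Y') ^ t0 = 1" by (simp add: X_def ceval_mult ceval_subst_pow)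
  have "ceval \<omega> Y * ceval \<omega> Y' = 1"
    using pcong_ceval[OF pcong_weaken[OF YY mn, of 0] \<omega>m] by (simp add: ceval_mult)
  then have "(ceval (\<omega> ^ k) Y) ^ t0 = (ceval \<omega> Y) ^ t0"
    using X1 by (metis (no_types, lifting) mult.commute mult.left_commute mult_1 power_mult_distrib power_one)
  then have abs: "cmod (ceval (\<omega> ^ k) Y) = cmod (ceval \<omega> Y)" using t0(1) by (rule cmod_eq_if_power_eq)
  \<comment> \<open>At a root of unity other than 1 the norm element vanishes, so only the geometric
    sum survives in \<open>u\<close>; inversion becomes complex conjugation.\<close>
  have val: "cmod (ceval z Y) = (cmod (\<Sum>i<\<kappa>. z ^ i) ^ r)\<^sup>2" if z: "z ^ m = 1" "z \<noteq> 1" "cmod z = 1" for z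
  proof -
    obtain d where d: "n = m * d" using mn by blast
    have zn: "z ^ n = 1" by (simp add: d power_mult z)
    have "z * z ^ (n - 1) = 1" using zn n by (metis power_minus_mult mult.commute)
    moreover have "z * cnj z = 1" using z(3) complex_norm_square[of z] by simp
    ultimately have cn: "z ^ (n - 1) = cnj z" by (metis mult_cancel_left mult_eq_0_iff zero_neq_one)
    have e: "ceval w u = (\<Sum>i<\<kappa>. w ^ i) ^ r" if w: "w ^ n = 1" "w \<noteq> 1" for w
    proof -
      have "ceval w (geo n 1) = (\<Sum>i<n. w ^ i)" by (simp add: geo_def ceval_sum ceval_monom)
      also have "\<dots> = 0" using w by (simp add: sum_gp_strict)
      finally show ?thesis unfolding u(2) by (simp add: ceval_add ceval_smult ceval_power geo_def ceval_sum ceval_monom)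
    qed
    have "cnj z ^ n = 1" using zn by (metis complex_cnj_one complex_cnj_power)
    moreover have "cnj z \<noteq> 1" using z(2) by (metis complex_cnj_cnj complex_cnj_one)
    ultimately have "ceval (cnj z) u = cnj (ceval z u)" using e[OF zn z(2)] e[of "cnj z"] by simp
    then have "ceval z Y = ceval z u * cnj (ceval z u)"
      unfolding Y_def \<sigma>_def ceval_mult ceval_subst_pow cn by (simp only:)
    then have "cmod (ceval z Y) = cmod (ceval z u) * cmod (ceval z u)"
      by (simp only: norm_mult complex_mod_cnj)
    then show ?thesis unfolding e[OF zn z(2)] norm_power power2_eq_square .
  qed
  have root: "\<omega> ^ j \<noteq> 1" if "\<not> m dvd j" for j
  proof
    assume "\<omega> ^ j = 1"
    have "cis (2 * pi * real (j mod m) / real m) = cis (2 * pi * real 0 / real m)"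
    proof -
      have "\<omega> ^ (j mod m) = \<omega> ^ j"
      proof -
        have "\<omega> ^ j = \<omega> ^ (m * (j div m) + j mod m)" by simp
        also have "\<dots> = \<omega> ^ (j mod m)" unfolding power_add power_mult \<omega>m by simp
        finally show ?thesis by simp
      qed
      then show ?thesis using \<open>\<omega> ^ j = 1\<close> by (simp add: \<omega> DeMoivre mult_ac)
    qed
    then have "j mod m = 0"
      using inj_onD[OF bij_betw_imp_inj_on[OF bij_betw_roots_unity[OF m]], of "j mod m" 0] m by simp
    then show False using that by (simp add: dvd_eq_mod_eq_0)
  qed
  have "\<not> m dvd 1" using m2 by simp
  moreover have "\<not> m dvd k"
  proof
    assume "m dvd k"
    then have "[k * k' = 0] (mod m)" by (simp add: cong_0_iff)
    then have "[0 = 1] (mod m)" using kk cong_sym cong_trans by blast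
    then show False using m2 by (simp add: cong_def)
  qed
  ultimately have r1: "\<omega> \<noteq> 1" "\<omega> ^ k \<noteq> 1" using root[of 1] root[of k] by auto
  have km: "(\<omega> ^ k) ^ m = 1" using \<omega>m by (metis power_mult mult.commute power_one)
  have n1: "cmod \<omega> = 1" "cmod (\<omega> ^ k) = 1" by (simp_all add: \<omega> norm_power)
  have "(cmod (\<Sum>i<\<kappa>. (\<omega> ^ k) ^ i) ^ r)\<^sup>2 = (cmod (\<Sum>i<\<kappa>. \<omega> ^ i) ^ r)\<^sup>2"
    using abs val[OF km r1(2) n1(2)] val[OF \<omega>m r1(1) n1(1)] by simp
  then have "cmod (\<Sum>i<\<kappa>. (\<omega> ^ k) ^ i) = cmod (\<Sum>i<\<kappa>. \<omega> ^ i)"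
    using u(1) power_eq_iff_eq_base[of "r * 2" "cmod (\<Sum>i<\<kappa>. (\<omega> ^ k) ^ i)" "cmod (\<Sum>i<\<kappa>. \<omega> ^ i)"]
    by (simp add: power_mult)
  then show False using neq by simp
qed

subsection \<open>Integral group rings\<close>

abbreviation coeff_at :: "('a \<Rightarrow>\<^sub>0 int) \<Rightarrow> 'a \<Rightarrow> int" where "coeff_at \<equiv> Poly_Mapping.lookup"
abbreviation supp :: "('a \<Rightarrow>\<^sub>0 int) \<Rightarrow> 'a set" where "supp \<equiv> Poly_Mapping.keys"

lemma coeff_at_frag_extend:
  "coeff_at (frag_extend b f) g = (\<Sum>x\<in>supp f. coeff_at f x * coeff_at (b x) g)"
  by (simp add: frag_extend_def lookup_sum)

lemma coeff_at_frag_of: "coeff_at (frag_of x) g = (if x = g then 1 else 0)"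
  by (auto simp: lookup_single)

context group
begin

definition gmult :: "('a \<Rightarrow>\<^sub>0 int) \<Rightarrow> ('a \<Rightarrow>\<^sub>0 int) \<Rightarrow> ('a \<Rightarrow>\<^sub>0 int)" (infixl "\<star>" 70) where
  "f \<star> g = frag_extend (\<lambda>x. frag_extend (\<lambda>y. frag_of (x \<otimes> y)) g) f"

abbreviation ZG where "ZG \<equiv> integral_group_ring G"

lemma ZG_simps:
  "carrier ZG = {f. supp f \<subseteq> carrier G}" "f \<otimes>\<^bsub>ZG\<^esub> g = f \<star> g" "\<one>\<^bsub>ZG\<^esub> = frag_of \<one>"
  "\<zero>\<^bsub>ZG\<^esub> = 0" "f \<oplus>\<^bsub>ZG\<^esub> g = f + g"
  by (auto simp: integral_group_ring_def gmult_def)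

lemma gmult_add_left: "(f + g) \<star> h = f \<star> h + g \<star> h"
  by (simp add: gmult_def frag_extend_add)

lemma gmult_add_right: "f \<star> (g + h) = f \<star> g + f \<star> h"
  by (simp add: gmult_def frag_extend_add frag_extend_add_fun)

lemma gmult_cmul_left: "frag_cmul c f \<star> h = frag_cmul c (f \<star> h)"
  by (simp add: gmult_def frag_extend_cmul)

lemma gmult_cmul_right: "f \<star> frag_cmul c h = frag_cmul c (f \<star> h)"
proof -
  have "frag_extend (\<lambda>x. frag_cmul c (b x)) f = frag_cmul c (frag_extend b f)" for b
    by (simp add: frag_extend_def frag_cmul_sum mult.commute)
  then show ?thesis by (simp add: gmult_def frag_extend_cmul)
qed

lemma gmult_minus_left: "(- f) \<star> h = - (f \<star> h)"
  by (simp add: gmult_def frag_extend_minus)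

lemma gmult_minus_right: "f \<star> (- h) = - (f \<star> h)"
  using gmult_cmul_right[of f "-1" h] by simp

lemma gmult_diff_left: "(f - g) \<star> h = f \<star> h - g \<star> h"
  by (simp add: gmult_def frag_extend_diff)

lemma gmult_diff_right: "f \<star> (g - h) = f \<star> g - f \<star> h"
  using gmult_add_right[of f g "- h"] by (simp add: gmult_minus_right)

lemma gmult_zero [simp]: "0 \<star> h = 0" "f \<star> 0 = 0"
  using gmult_cmul_right[of f 0] by (simp_all add: gmult_def)

lemma gmult_frag_of: "frag_of x \<star> frag_of y = frag_of (x \<otimes> y)"
  by (simp add: gmult_def)

lemma supp_gmult:
  assumes "subgroup D G" "supp f \<subseteq> D" "supp g \<subseteq> D"
  shows "supp (f \<star> g) \<subseteq> D"
  unfolding gmult_def using assms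
  by (intro keys_frag_extend_subset) (auto simp: subgroup.m_closed subset_iff)

lemma supp_gmult_carrier:
  "supp f \<subseteq> carrier G \<Longrightarrow> supp g \<subseteq> carrier G \<Longrightarrow> supp (f \<star> g) \<subseteq> carrier G"
  using supp_gmult subgroup_self by blast

lemma ring_ZG: "ring ZG"
  using ring_integral_group_ring is_group by blast

lemma gmult_assoc:
  "supp f \<subseteq> carrier G \<Longrightarrow> supp g \<subseteq> carrier G \<Longrightarrow> supp h \<subseteq> carrier G \<Longrightarrow> f \<star> g \<star> h = f \<star> (g \<star> h)"
  using ring.ring_simprules(11)[OF ring_ZG, of f g h] by (simp add: ZG_simps)

lemma gmult_one:
  "supp f \<subseteq> carrier G \<Longrightarrow> frag_of \<one> \<star> f = f" "supp f \<subseteq> carrier G \<Longrightarrow> f \<star> frag_of \<one> = f"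
  using ring.ring_simprules(12)[OF ring_ZG, of f] monoid.r_one[OF ring.is_monoid[OF ring_ZG], of f]
  by (simp_all add: ZG_simps)

lemma coeff_at_gmult_frag_of_right:
  assumes "supp f \<subseteq> carrier G" "x \<in> carrier G" "g \<in> carrier G"
  shows "coeff_at (f \<star> frag_of x) g = coeff_at f (g \<otimes> inv x)"
proof -
  have "coeff_at (f \<star> frag_of x) g = (\<Sum>y\<in>supp f. coeff_at f y * (if y \<otimes> x = g then 1 else 0))"
    by (simp only: gmult_def coeff_at_frag_extend coeff_at_frag_of frag_extend_of)
  also have "\<dots> = (\<Sum>y\<in>supp f. if y = g \<otimes> inv x then coeff_at f y else 0)"
    using assms by (intro sum.cong) (auto simp: inv_solve_right subset_iff)
  also have "\<dots> = coeff_at f (g \<otimes> inv x)"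
    by (simp add: in_keys_iff)
  finally show ?thesis .
qed

lemma coeff_at_gmult_frag_of_left:
  assumes "supp f \<subseteq> carrier G" "x \<in> carrier G" "g \<in> carrier G"
  shows "coeff_at (frag_of x \<star> f) g = coeff_at f (inv x \<otimes> g)"
proof -
  have "coeff_at (frag_of x \<star> f) g = (\<Sum>y\<in>supp f. coeff_at f y * (if x \<otimes> y = g then 1 else 0))"
    by (simp only: gmult_def coeff_at_frag_extend coeff_at_frag_of frag_extend_of)
  also have "\<dots> = (\<Sum>y\<in>supp f. if y = inv x \<otimes> g then coeff_at f y else 0)"
    using assms by (intro sum.cong) (auto simp: inv_solve_left subset_iff)
  also have "\<dots> = coeff_at f (inv x \<otimes> g)"
    by (simp add: in_keys_iff)
  finally show ?thesis .
qed

lemma coeff_at_gmult: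
  assumes "supp f \<subseteq> N" "finite N" "N \<subseteq> carrier G" "supp h \<subseteq> carrier G" "g \<in> carrier G"
  shows "coeff_at (f \<star> h) g = (\<Sum>x\<in>N. coeff_at f x * coeff_at h (inv x \<otimes> g))"
proof -
  have "coeff_at (f \<star> h) g = (\<Sum>x\<in>supp f. coeff_at f x * coeff_at (frag_of x \<star> h) g)"
    by (simp add: gmult_def coeff_at_frag_extend[of _ f])
  also have "\<dots> = (\<Sum>x\<in>N. coeff_at f x * coeff_at (frag_of x \<star> h) g)"
    using assms by (intro sum.mono_neutral_left) (auto simp: in_keys_iff)
  also have "\<dots> = (\<Sum>x\<in>N. coeff_at f x * coeff_at h (inv x \<otimes> g))"
    using assms by (intro sum.cong refl) (auto simp: coeff_at_gmult_frag_of_left subset_iff)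
  finally show ?thesis .
qed

section \<open>The canonical involution and conjugation by group elements\<close>

definition star :: "('a \<Rightarrow>\<^sub>0 int) \<Rightarrow> ('a \<Rightarrow>\<^sub>0 int)" where
  "star f = frag_extend (\<lambda>x. frag_of (inv x)) f"

lemma supp_star: "subgroup D G \<Longrightarrow> supp f \<subseteq> D \<Longrightarrow> supp (star f) \<subseteq> D"
  unfolding star_def by (intro keys_frag_extend_subset) (auto simp: subgroup.m_inv_closed)

lemma supp_star_carrier: "supp f \<subseteq> carrier G \<Longrightarrow> supp (star f) \<subseteq> carrier G"
  using supp_star subgroup_self by blast

lemma coeff_at_star:
  assumes "supp f \<subseteq> carrier G" "g \<in> carrier G"
  shows "coeff_at (star f) g = coeff_at f (inv g)"
proof -
  have "coeff_at (star f) g = (\<Sum>y\<in>supp f. if y = inv g then coeff_at f y else 0)"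
    unfolding star_def coeff_at_frag_extend coeff_at_frag_of
    using assms by (intro sum.cong) (auto simp: subset_iff)
  also have "\<dots> = coeff_at f (inv g)" by (simp add: in_keys_iff)
  finally show ?thesis .
qed

lemma star_star: "supp f \<subseteq> carrier G \<Longrightarrow> star (star f) = f"
  unfolding star_def frag_extend_compose by (rule frag_extend_id) auto

lemma star_diff: "star (f - g) = star f - star g"
  by (simp add: star_def frag_extend_diff)

lemma star_frag_of [simp]: "star (frag_of x) = frag_of (inv x)"
  by (simp add: star_def)

lemma star_zero [simp]: "star 0 = 0" by (simp add: star_def)

lemma star_gmult:
  assumes f: "supp f \<subseteq> carrier G" and g: "supp g \<subseteq> carrier G"
  shows "star (f \<star> g) = star g \<star> star f"
  using f
proof (induction f rule: frag_induction)
  case (one x)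
  show ?case using g
    by (induction g rule: frag_induction)
      (use one in \<open>auto simp: gmult_frag_of inv_mult_group star_diff gmult_diff_left gmult_diff_right\<close>)
qed (auto simp: star_diff gmult_diff_left gmult_diff_right)

text \<open>The same convention as in \<open>conjugate\<close>, hence a right action: conjugating by
  \<open>x\<close> and then by \<open>y\<close> is conjugating by
  \<open>x \<otimes> y\<close>.\<close>

definition cj :: "'a \<Rightarrow> ('a \<Rightarrow>\<^sub>0 int) \<Rightarrow> ('a \<Rightarrow>\<^sub>0 int)" where
  "cj x f = frag_of (inv x) \<star> f \<star> frag_of x"

lemma supp_cj_carrier: "x \<in> carrier G \<Longrightarrow> supp f \<subseteq> carrier G \<Longrightarrow> supp (cj x f) \<subseteq> carrier G"
  unfolding cj_def by (intro supp_gmult_carrier) auto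

lemma coeff_at_cj:
  assumes "x \<in> carrier G" "supp f \<subseteq> carrier G" "g \<in> carrier G"
  shows "coeff_at (cj x f) g = coeff_at f (x \<otimes> g \<otimes> inv x)"
  using assms unfolding cj_def
  by (subst coeff_at_gmult_frag_of_right)
     (auto simp: coeff_at_gmult_frag_of_left supp_gmult_carrier m_assoc)

lemma cj_diff: "cj x (f - g) = cj x f - cj x g"
  by (simp add: cj_def gmult_diff_left gmult_diff_right)
lemma cj_add: "cj x (f + g) = cj x f + cj x g"
  by (simp add: cj_def gmult_add_left gmult_add_right)
lemma cj_cmul: "cj x (frag_cmul c f) = frag_cmul c (cj x f)"
  by (simp add: cj_def gmult_cmul_left gmult_cmul_right)
lemma cj_zero [simp]: "cj x 0 = 0" by (simp add: cj_def)
lemma cj_frag_of: "cj x (frag_of y) = frag_of (inv x \<otimes> y \<otimes> x)"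
  by (simp add: cj_def gmult_frag_of)

lemma cj_one [simp]: "x \<in> carrier G \<Longrightarrow> cj x (frag_of \<one>) = frag_of \<one>"
  by (simp add: cj_frag_of)

lemma cj_by_one: "supp f \<subseteq> carrier G \<Longrightarrow> cj \<one> f = f"
  by (simp add: cj_def gmult_one)

lemma cj_cj:
  assumes "x \<in> carrier G" "y \<in> carrier G" "supp f \<subseteq> carrier G"
  shows "cj y (cj x f) = cj (x \<otimes> y) f"
  using assms(3) by (induction f rule: frag_induction)
    (use assms in \<open>auto simp: cj_diff cj_frag_of inv_mult_group m_assoc\<close>)

lemma cj_gmult:
  assumes x: "x \<in> carrier G" and f: "supp f \<subseteq> carrier G" and g: "supp g \<subseteq> carrier G"
  shows "cj x (f \<star> g) = cj x f \<star> cj x g"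
  using f
proof (induction f rule: frag_induction)
  case (one y)
  show ?case using g
  proof (induction g rule: frag_induction)
    case (one z)
    have "inv x \<otimes> (y \<otimes> z) \<otimes> x = inv x \<otimes> y \<otimes> x \<otimes> (inv x \<otimes> z \<otimes> x)"
      using x \<open>y \<in> carrier G\<close> one m_assoc[of x "inv x" "z \<otimes> x"] by (simp add: m_assoc)
    then show ?case by (simp add: gmult_frag_of cj_frag_of)
  qed (auto simp: cj_diff gmult_diff_right)
qed (auto simp: cj_diff gmult_diff_left)

lemma cj_eq_iff_commute:
  assumes x: "x \<in> carrier G" and f: "supp f \<subseteq> carrier G"
  shows "cj x f = f \<longleftrightarrow> f \<star> frag_of x = frag_of x \<star> f"
proof
  have *: "frag_of x \<star> cj x f = f \<star> frag_of x"
    using x f by (simp add: cj_def gmult_assoc[symmetric] supp_gmult_carrier gmult_frag_of gmult_one)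
  then show "f \<star> frag_of x = frag_of x \<star> f" if "cj x f = f" using that by simp
  assume "f \<star> frag_of x = frag_of x \<star> f"
  then have "cj x f = frag_of (inv x) \<star> (frag_of x \<star> f)"
    using x f by (simp add: cj_def gmult_assoc)
  also have "\<dots> = f"
    using x f by (simp add: gmult_assoc[symmetric] supp_gmult_carrier gmult_frag_of gmult_one)
  finally show "cj x f = f" .
qed

lemma gmult_commute_span:
  assumes f: "supp f \<subseteq> D" and h: "\<And>d. d \<in> D \<Longrightarrow> h \<star> frag_of d = frag_of d \<star> h"
  shows "h \<star> f = f \<star> h"
  using f by (induction f rule: frag_induction) (auto simp: h gmult_diff_left gmult_diff_right)

lemma Units_ZG:
  "u \<in> Units ZG \<longleftrightarrow> supp u \<subseteq> carrier G \<and> (\<exists>v. supp v \<subseteq> carrier G \<and> u \<star> v = frag_of \<one> \<and> v \<star> u = frag_of \<one>)"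
  by (auto simp: Units_def ZG_simps)

lemma frag_of_Units: "x \<in> carrier G \<Longrightarrow> frag_of x \<in> Units ZG"
  unfolding Units_ZG by (auto simp: gmult_frag_of intro!: exI[of _ "frag_of (inv x)"])

text \<open>Group elements are units and they span the group ring, so centrality in the unit group
  can be tested on them alone.\<close>

lemma center_units_iff:
  "u \<in> group_center (units_of ZG) \<longleftrightarrow> u \<in> Units ZG \<and> (\<forall>x\<in>carrier G. cj x u = u)"
proof -
  have *: "u \<in> group_center (units_of ZG) \<longleftrightarrow> u \<in> Units ZG \<and> (\<forall>v\<in>Units ZG. u \<star> v = v \<star> u)"
    by (simp add: group_center_def units_of_carrier units_of_mult ZG_simps)
  have c: "supp v \<subseteq> carrier G" if "v \<in> Units ZG" for v using that unfolding Units_ZG by blast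
  show ?thesis
  proof
    assume u: "u \<in> group_center (units_of ZG)"
    then have uU: "u \<in> Units ZG" using * by blast
    moreover have "cj x u = u" if "x \<in> carrier G" for x
      using u * frag_of_Units[OF that] cj_eq_iff_commute[OF that c[OF uU]] by blast
    ultimately show "u \<in> Units ZG \<and> (\<forall>x\<in>carrier G. cj x u = u)" by blast
  next
    assume u: "u \<in> Units ZG \<and> (\<forall>x\<in>carrier G. cj x u = u)"
    then have "u \<star> frag_of x = frag_of x \<star> u" if "x \<in> carrier G" for x
      using cj_eq_iff_commute[OF that c] that by blast
    then have "u \<star> v = v \<star> u" if "v \<in> Units ZG" for v
      using gmult_commute_span[OF c[OF that]] by blast
    then show "u \<in> group_center (units_of ZG)" using u * by blast
  qed
qed

text \<open>The inclusion in \<open>cut_group\<close> that holds in every group.\<close>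

lemma trivial_units_central:
  assumes z: "z \<in> group_center G"
  shows "frag_of z \<in> group_center (units_of ZG)" "- frag_of z \<in> group_center (units_of ZG)"
proof -
  have zc: "z \<in> carrier G" using z by (simp add: group_center_def)
  have c: "cj x (frag_of z) = frag_of z" if "x \<in> carrier G" for x
    using that z zc by (subst cj_eq_iff_commute) (auto simp: gmult_frag_of group_center_def)
  then show "frag_of z \<in> group_center (units_of ZG)"
    using frag_of_Units[OF zc] by (simp add: center_units_iff)
  have "- frag_of z \<in> Units ZG"
    unfolding Units_ZG
    by (intro conjI exI[of _ "- frag_of (inv z)"])
      (use zc in \<open>auto simp: gmult_frag_of gmult_minus_left gmult_minus_right\<close>)
  moreover have "cj x (- frag_of z) = - frag_of z" if "x \<in> carrier G" for x
    using c[OF that] cj_cmul[of x "-1"] by simp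
  ultimately show "- frag_of z \<in> group_center (units_of ZG)"
    by (simp add: center_units_iff)
qed

end

subsection \<open>Central units under the conjugacy condition\<close>

text \<open>A collection argument in the style of Dietzmann: conjugation moves repeated letters of a word to
  the front, where a power of the exponent disappears, so bounded words already give all products.\<close>

context group
begin

definition word_prod :: "'a list \<Rightarrow> 'a" where
  "word_prod l = foldr (\<lambda>x y. x \<otimes> y) l \<one>"

lemma word_prod_simps [simp]:
  "word_prod [] = \<one>" "word_prod (x # l) = x \<otimes> word_prod l"
  by (simp_all add: word_prod_def)

lemma word_prod_closed: "set l \<subseteq> carrier G \<Longrightarrow> word_prod l \<in> carrier G"
  by (induction l) auto

lemma word_prod_append:
  "set l \<subseteq> carrier G \<Longrightarrow> set l' \<subseteq> carrier G \<Longrightarrow> word_prod (l @ l') = word_prod l \<otimes> word_prod l'"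
  by (induction l) (auto simp: m_assoc word_prod_closed)

lemma collect_letter:
  assumes S: "S \<subseteq> carrier G" "\<And>x y. x \<in> carrier G \<Longrightarrow> y \<in> S \<Longrightarrow> inv x \<otimes> y \<otimes> x \<in> S" and x: "x \<in> S"
  shows "set l \<subseteq> S \<Longrightarrow> k \<le> count_list l x \<Longrightarrow>
    \<exists>l'. set l' \<subseteq> S \<and> word_prod l = x [^] k \<otimes> word_prod l' \<and> length l' + k = length l"
proof (induction l arbitrary: k)
  case Nil
  then show ?case by (auto intro!: exI[of _ "[]"])
next
  case (Cons y l)
  have xc: "x \<in> carrier G" using x S by auto
  show ?case
  proof (cases "k = 0")
    case True
    have "word_prod (y # l) \<in> carrier G" using Cons S by (intro word_prod_closed) auto
    then show ?thesis using True Cons by (intro exI[of _ "y # l"]) auto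
  next
    case k: False
    show ?thesis
    proof (cases "y = x")
      case True
      then obtain l' where l': "set l' \<subseteq> S" "word_prod l = x [^] (k - 1) \<otimes> word_prod l'"
          "length l' + (k - 1) = length l"
        using Cons.IH[of "k - 1"] Cons.prems by (auto simp: le_diff_conv)
      have "word_prod (y # l) = x \<otimes> x [^] (k - 1) \<otimes> word_prod l'"
        using l' S xc True word_prod_closed[of l'] by (auto simp: m_assoc)
      also have "x \<otimes> x [^] (k - 1) = x [^] k"
        using k xc nat_pow_Suc2[OF xc, of "k - 1"] by simp
      finally show ?thesis using l' k by (intro exI[of _ l']) auto
    next
      case False
      then obtain l' where l': "set l' \<subseteq> S" "word_prod l = x [^] k \<otimes> word_prod l'"
          "length l' + k = length l"
        using Cons.IH[of k] Cons.prems by auto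
      define z where "z = inv (x [^] k) \<otimes> y \<otimes> x [^] k"
      have zS: "z \<in> S" using Cons.prems S xc by (auto simp: z_def)
      have c: "y \<in> carrier G" "x [^] k \<in> carrier G" "word_prod l' \<in> carrier G"
        using Cons.prems S xc l' word_prod_closed[of l'] by auto
      have "word_prod (y # l) = x [^] k \<otimes> (z \<otimes> word_prod l')"
        using c l' by (simp add: z_def m_assoc[symmetric])
      then show ?thesis using l' zS by (intro exI[of _ "z # l'"]) auto
    qed
  qed
qed

lemma finite_normal_hull:
  assumes S: "finite S" "S \<subseteq> carrier G" "\<And>x y. x \<in> carrier G \<Longrightarrow> y \<in> S \<Longrightarrow> inv x \<otimes> y \<otimes> x \<in> S"
    and m: "m > 0" "\<And>x. x \<in> S \<Longrightarrow> x [^] (m::nat) = \<one>"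
    and tor: "\<And>x. x \<in> carrier G \<Longrightarrow> \<exists>k>0. x [^] (k::nat) = \<one>"
  obtains N where "finite N" "subgroup N G" "S \<subseteq> N"
    "\<And>x y. x \<in> carrier G \<Longrightarrow> y \<in> N \<Longrightarrow> inv x \<otimes> y \<otimes> x \<in> N"
proof
  define N where "N = word_prod ` lists S"
  have Nc: "N \<subseteq> carrier G" using S by (auto simp: N_def intro!: word_prod_closed)
  have short: "\<exists>l'. set l' \<subseteq> S \<and> word_prod l' = word_prod l \<and> length l' \<le> card S * m" if "set l \<subseteq> S" for l
    using that
  proof (induction "length l" arbitrary: l rule: less_induct)
    case less
    show ?case
    proof (cases "length l \<le> card S * m")
      case False
      \<comment> \<open>Pigeonhole: a word longer than \<open>card S * m\<close> contains some
        letter at least \<open>m\<close> times.\<close>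
      have "\<exists>x\<in>S. m \<le> count_list l x"
      proof (rule ccontr)
        assume "\<not> ?thesis"
        then have "count_list l x \<le> m" if "x \<in> S" for x using that by force
        then have "(\<Sum>x\<in>S. count_list l x) \<le> (\<Sum>x\<in>S. m)" by (intro sum_mono)
        moreover have "(\<Sum>x\<in>S. count_list l x) = length l"
          by (rule sum_count_set[OF less.prems S(1)])
        ultimately show False using False by simp
      qed
      then obtain x where x: "x \<in> S" "m \<le> count_list l x" by blast
      then obtain l' where l': "set l' \<subseteq> S" "word_prod l = x [^] m \<otimes> word_prod l'" "length l' + m = length l"
        using collect_letter[OF S(2,3) x(1) less.prems x(2)] by blast
      then have "word_prod l = word_prod l'" using m(2)[OF x(1)] word_prod_closed[of l'] S by auto
      then show ?thesis using less.hyps[of l'] l' m(1) by auto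
    qed (use less in auto)
  qed
  have "N \<subseteq> word_prod ` {l. set l \<subseteq> S \<and> length l \<le> card S * m}"
  proof
    fix y assume "y \<in> N"
    then obtain l where "set l \<subseteq> S" "y = word_prod l" by (auto simp: N_def)
    then show "y \<in> word_prod ` {l. set l \<subseteq> S \<and> length l \<le> card S * m}" using short[of l] by (auto simp: image_iff)
  qed
  then show "finite N" using finite_subset finite_imageI[OF finite_lists_length_le[OF S(1)]] by blast
  have mult: "a \<otimes> b \<in> N" if ab: "a \<in> N" "b \<in> N" for a b
  proof -
    obtain l where "set l \<subseteq> S" "a = word_prod l" using ab(1) by (auto simp: N_def)
    moreover obtain l' where "set l' \<subseteq> S" "b = word_prod l'" using ab(2) by (auto simp: N_def)
    ultimately show ?thesis using word_prod_append[of l l'] S(2) unfolding N_def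
      by (intro image_eqI[of _ _ "l @ l'"]) auto
  qed
  have one: "\<one> \<in> N" unfolding N_def by (intro image_eqI[of _ _ "[]"]) auto
  show "subgroup N G"
  proof (rule subgroupI)
    \<comment> \<open>By torsion an inverse is a nonnegative power, so words without inverses
      already form a subgroup.\<close>
    show "inv a \<in> N" if a: "a \<in> N" for a
    proof -
      have ac: "a \<in> carrier G" using a Nc by auto
      obtain k where k: "k > 0" "a [^] (k::nat) = \<one>" using tor[OF ac] by blast
      have "a [^] (k - 1) \<otimes> a = \<one>" using k ac nat_pow_Suc[of a "k - 1"] by simp
      then have "inv a = a [^] (k - 1)" using ac by (simp add: inv_equality)
      moreover have "a [^] j \<in> N" for j :: nat using a one mult by (induction j) auto
      ultimately show ?thesis by simp
    qed
  qed (use Nc one mult in auto)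
  show "S \<subseteq> N"
  proof
    fix x assume "x \<in> S"
    then show "x \<in> N" unfolding N_def using S by (intro image_eqI[of _ _ "[x]"]) auto
  qed
  show "inv x \<otimes> y \<otimes> x \<in> N" if x: "x \<in> carrier G" and y: "y \<in> N" for x y
  proof -
    obtain l where l: "set l \<subseteq> S" "y = word_prod l" using y by (auto simp: N_def)
    have "inv x \<otimes> word_prod l \<otimes> x \<in> N" using l(1)
    proof (induction l)
      case Nil
      then show ?case using x one by simp
    next
      case (Cons z l)
      have c: "z \<in> carrier G" "word_prod l \<in> carrier G" using Cons S word_prod_closed[of l] by auto
      have "inv x \<otimes> word_prod (z # l) \<otimes> x = (inv x \<otimes> z \<otimes> x) \<otimes> (inv x \<otimes> word_prod l \<otimes> x)"
        using c x m_assoc[of x "inv x" "word_prod l \<otimes> x"] by (simp add: m_assoc)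
      moreover have "inv x \<otimes> z \<otimes> x \<in> N" using S(3)[of x z] x Cons \<open>S \<subseteq> N\<close> by auto
      ultimately show ?case using Cons mult by simp
    qed
    then show ?thesis using l by simp
  qed
qed


text \<open>The matrix of left multiplication by \<open>x\<close> in the basis \<open>f\<close>: the
  element carrying \<open>f j\<close> to \<open>f i\<close> is
  \<open>f i \<otimes> inv (f j)\<close>.\<close>

definition reg_mat :: "(nat \<Rightarrow> 'a) \<Rightarrow> nat \<Rightarrow> ('a \<Rightarrow>\<^sub>0 int) \<Rightarrow> complex mat" where
  "reg_mat f n x = mat n n (\<lambda>(i, j). complex_of_int (coeff_at x (f i \<otimes> inv (f j))))"

lemma reg_mat_carrier [simp]: "reg_mat f n x \<in> carrier_mat n n"
  by (simp add: reg_mat_def)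

lemma nat_pow_ZG_simps:
  "x [^]\<^bsub>ZG\<^esub> (0::nat) = frag_of \<one>" "x [^]\<^bsub>ZG\<^esub> Suc k = x [^]\<^bsub>ZG\<^esub> k \<star> x"
  by (simp_all add: ZG_simps nat_pow_def)

context
  fixes N :: "'a set" and f :: "nat \<Rightarrow> 'a" and n :: nat
  assumes N: "finite N" "subgroup N G" and f: "bij_betw f {..<n} N"
begin

lemma N_carrier: "N \<subseteq> carrier G"
  using N subgroup.subset by blast

lemma f_closed: "i < n \<Longrightarrow> f i \<in> N" "i < n \<Longrightarrow> f i \<in> carrier G"
  using f N_carrier by (auto simp: bij_betw_def)

lemma reg_mat_mult:
  assumes x: "supp x \<subseteq> N" and y: "supp y \<subseteq> N"
  shows "reg_mat f n (x \<star> y) = reg_mat f n x * reg_mat f n y"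
proof (intro eq_matI)
  fix i j assume "i < dim_row (reg_mat f n x * reg_mat f n y)" "j < dim_col (reg_mat f n x * reg_mat f n y)"
  then have ij: "i < n" "j < n" by (auto simp: reg_mat_def)
  note c = f_closed(2)
  have bij: "bij_betw (\<lambda>k. f i \<otimes> inv (f k)) {..<n} N"
    unfolding bij_betw_def
  proof (intro conjI)
    show "inj_on (\<lambda>k. f i \<otimes> inv (f k)) {..<n}"
      using f c ij by (auto simp: inj_on_def bij_betw_def)
    show "(\<lambda>k. f i \<otimes> inv (f k)) ` {..<n} = N"
    proof (intro equalityI subsetI)
      fix h assume h: "h \<in> N"
      then have "inv h \<otimes> f i \<in> N"
        using N ij f_closed by (simp add: subgroup.m_closed subgroup.m_inv_closed)
      then obtain k where k: "k < n" "f k = inv h \<otimes> f i" using f by (auto simp: bij_betw_def)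
      have "f i \<otimes> inv (f k) = h"
        using k h c[OF ij(1)] N_carrier by (auto simp: inv_mult_group m_assoc[symmetric])
      then show "h \<in> (\<lambda>k. f i \<otimes> inv (f k)) ` {..<n}" using k(1) by (intro image_eqI[of _ _ k]) auto
    next
      fix h assume "h \<in> (\<lambda>k. f i \<otimes> inv (f k)) ` {..<n}"
      then show "h \<in> N" using N ij f_closed by (auto simp: subgroup.m_closed subgroup.m_inv_closed)
    qed
  qed
  have "coeff_at (x \<star> y) (f i \<otimes> inv (f j)) = (\<Sum>h\<in>N. coeff_at x h * coeff_at y (inv h \<otimes> (f i \<otimes> inv (f j))))"
    using x y N N_carrier c ij by (intro coeff_at_gmult) auto
  also have "\<dots> = (\<Sum>k<n. coeff_at x (f i \<otimes> inv (f k)) * coeff_at y (inv (f i \<otimes> inv (f k)) \<otimes> (f i \<otimes> inv (f j))))"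
    by (rule sum.reindex_bij_betw[OF bij, symmetric])
  also have "\<dots> = (\<Sum>k<n. coeff_at x (f i \<otimes> inv (f k)) * coeff_at y (f k \<otimes> inv (f j)))"
  proof (intro sum.cong refl)
    fix k assume k: "k \<in> {..<n}"
    have "inv (f i \<otimes> inv (f k)) \<otimes> (f i \<otimes> inv (f j)) = f k \<otimes> inv (f j)"
      using c ij k m_assoc[of "inv (f i)" "f i" "inv (f j)"] by (simp add: inv_mult_group m_assoc)
    then show "coeff_at x (f i \<otimes> inv (f k)) * coeff_at y (inv (f i \<otimes> inv (f k)) \<otimes> (f i \<otimes> inv (f j))) =
      coeff_at x (f i \<otimes> inv (f k)) * coeff_at y (f k \<otimes> inv (f j))" by simp
  qed
  finally show "reg_mat f n (x \<star> y) $$ (i, j) = (reg_mat f n x * reg_mat f n y) $$ (i, j)"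
    using ij by (simp add: reg_mat_def scalar_prod_def atLeast0LessThan)
qed (auto simp: reg_mat_def)

lemma reg_mat_one: "reg_mat f n (frag_of \<one>) = 1\<^sub>m n"
proof (intro eq_matI)
  fix i j assume "i < dim_row (1\<^sub>m n :: complex mat)" "j < dim_col (1\<^sub>m n :: complex mat)"
  then have ij: "i < n" "j < n" by auto
  have "\<one> = f i \<otimes> inv (f j) \<longleftrightarrow> f i = f j"
  proof
    assume "\<one> = f i \<otimes> inv (f j)"
    then have "\<one> \<otimes> f j = f i \<otimes> inv (f j) \<otimes> f j" by simp
    then show "f i = f j" using f_closed(2)[OF ij(1)] f_closed(2)[OF ij(2)] by (simp add: m_assoc)
  qed (use f_closed(2)[OF ij(2)] in simp)
  then have "\<one> = f i \<otimes> inv (f j) \<longleftrightarrow> i = j"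
    using f ij by (auto simp: bij_betw_def inj_on_def)
  then have "coeff_at (frag_of \<one>) (f i \<otimes> inv (f j)) = (if i = j then 1 else 0)"
    unfolding coeff_at_frag_of by (simp only:)
  moreover have "reg_mat f n (frag_of \<one>) $$ (i, j) = of_int (coeff_at (frag_of \<one>) (f i \<otimes> inv (f j)))"
    using ij by (simp add: reg_mat_def del: lookup_frag_of)
  ultimately show "reg_mat f n (frag_of \<one>) $$ (i, j) = 1\<^sub>m n $$ (i, j)"
    using ij by simp
qed (auto simp: reg_mat_def)

lemma reg_mat_conj_transpose:
  assumes "supp x \<subseteq> N"
  shows "conj_transpose (reg_mat f n x) = reg_mat f n (star x)"
proof (intro eq_matI)
  fix i j assume "i < dim_row (reg_mat f n (star x))" "j < dim_col (reg_mat f n (star x))"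
  then have ij: "i < n" "j < n" by (auto simp: reg_mat_def)
  then show "conj_transpose (reg_mat f n x) $$ (i, j) = reg_mat f n (star x) $$ (i, j)"
    using f_closed(2) assms N_carrier
    by (simp add: reg_mat_def conj_transpose_def coeff_at_star inv_mult_group)
qed (auto simp: reg_mat_def conj_transpose_def)

lemma trace_reg_mat: "trace (reg_mat f n x) = of_nat n * of_int (coeff_at x \<one>)"
  using f_closed(2) by (simp add: trace_def reg_mat_def)

lemma reg_mat_inj:
  assumes x: "supp x \<subseteq> N" and y: "supp y \<subseteq> N" and eq: "reg_mat f n x = reg_mat f n y"
  shows "x = y"
proof (rule poly_mapping_eqI)
  fix g
  show "coeff_at x g = coeff_at y g"
  proof (cases "g \<in> N")
    case True
    obtain i where i: "i < n" "f i = g" using True f by (auto simp: bij_betw_def)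
    have "\<one> \<in> f ` {..<n}" using f subgroup.one_closed[OF N(2)] by (simp add: bij_betw_def)
    then obtain j where j: "j < n" "f j = \<one>" by auto
    have "reg_mat f n x $$ (i, j) = reg_mat f n y $$ (i, j)" using eq by simp
    then show ?thesis using i j f_closed(2)[OF i(1)] by (simp add: reg_mat_def)
  next
    case False
    then show ?thesis using x y by (metis in_keys_iff subsetD)
  qed
qed

text \<open>Integrality on group elements extends additively to integral combinations.\<close>

lemma trace_mult_reg_mat_in_Ints:
  assumes E: "E \<in> carrier_mat n n" and int: "\<And>g. g \<in> N \<Longrightarrow> c * trace (E * reg_mat f n (frag_of g)) \<in> \<int>"
    and x: "supp x \<subseteq> N"
  shows "c * trace (E * reg_mat f n x) \<in> \<int>"
  using x
proof (induction x rule: frag_induction)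
  case zero
  have "reg_mat f n 0 = 0\<^sub>m n n" by (intro eq_matI) (auto simp: reg_mat_def)
  then show ?case using right_mult_zero_mat[OF E] by (simp add: trace_def)
next
  case (diff a b)
  have "reg_mat f n (a - b) = reg_mat f n a - reg_mat f n b"
    by (intro eq_matI) (auto simp: reg_mat_def lookup_minus)
  then have "E * reg_mat f n (a - b) = E * reg_mat f n a - E * reg_mat f n b"
    using mult_minus_distrib_mat[OF E reg_mat_carrier reg_mat_carrier] by simp
  then have "c * trace (E * reg_mat f n (a - b)) = c * trace (E * reg_mat f n a) - c * trace (E * reg_mat f n b)"
    using trace_minus[OF mult_carrier_mat[OF E reg_mat_carrier] mult_carrier_mat[OF E reg_mat_carrier]]
    by (simp add: right_diff_distrib)
  then show ?case using diff by simp
qed (use int in auto)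

end

text \<open>Conjugation runs over all of \<open>G\<close>, so coefficients are constant on the
  classes of \<open>G\<close> and not merely on those of \<open>N\<close>; invariance under
  \<open>star\<close> makes the regular matrix hermitian. Such elements commute with each other,
  which keeps their products in the set.\<close>

definition real_class_elements :: "'a set \<Rightarrow> ('a \<Rightarrow>\<^sub>0 int) set" where
  "real_class_elements N = {x. supp x \<subseteq> N \<and> star x = x \<and> (\<forall>g\<in>carrier G. cj g x = x)}"

lemma real_class_elements_mult:
  assumes N: "subgroup N G" and x: "x \<in> real_class_elements N" and y: "y \<in> real_class_elements N"
  shows "x \<star> y = y \<star> x" "x \<star> y \<in> real_class_elements N"
proof -
  have c: "supp x \<subseteq> carrier G" "supp y \<subseteq> carrier G"
    using assms subgroup.subset[OF N] by (auto simp: real_class_elements_def)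
  show comm: "x \<star> y = y \<star> x"
    using x c by (intro gmult_commute_span[OF c(2)]) (auto simp: real_class_elements_def cj_eq_iff_commute)
  show "x \<star> y \<in> real_class_elements N"
    using x y c N comm by (auto simp: real_class_elements_def star_gmult cj_gmult dest: subsetD[OF supp_gmult[OF N]])
qed

lemma real_class_elements_pow:
  assumes N: "subgroup N G" and x: "x \<in> real_class_elements N"
  shows "x [^]\<^bsub>ZG\<^esub> (k::nat) \<in> real_class_elements N"
proof (induction k)
  case 0
  then show ?case using subgroup.one_closed[OF N] by (simp add: ZG_simps real_class_elements_def)
next
  case (Suc k)
  then show ?case using real_class_elements_mult(2)[OF N _ x] unfolding nat_pow_ZG_simps by blast
qed

lemma coeff_at_conjugate:
  assumes "cj y x = x" "supp x \<subseteq> carrier G" "y \<in> carrier G" "h \<in> carrier G"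
  shows "coeff_at x (inv y \<otimes> h \<otimes> y) = coeff_at x h"
proof -
  have "y \<otimes> (inv y \<otimes> h \<otimes> y) \<otimes> inv y = h"
    using assms by (simp add: m_assoc) (simp add: m_assoc[symmetric])
  then show ?thesis using coeff_at_cj[of y x "inv y \<otimes> h \<otimes> y"] assms by simp
qed

lemma real_class_elements_coeff_power:
  assumes N: "subgroup N G" and x: "x \<in> real_class_elements N" and g: "g \<in> N"
    and cl: "conjugate G (g [^] j) g \<or> conjugate G (g [^] j) (inv g)"
  shows "coeff_at x (g [^] (j::nat)) = coeff_at x g"
proof -
  have c: "supp x \<subseteq> carrier G" "g \<in> carrier G"
    using x g subgroup.subset[OF N] by (auto simp: real_class_elements_def)
  have sym: "coeff_at x (inv g) = coeff_at x g"
    using coeff_at_star[OF c] x by (simp add: real_class_elements_def)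
  obtain y where y: "y \<in> carrier G" "g = inv y \<otimes> g [^] j \<otimes> y \<or> inv g = inv y \<otimes> g [^] j \<otimes> y"
    using cl unfolding conjugate_def by blast
  have "coeff_at x (g [^] j) = coeff_at x (inv y \<otimes> g [^] j \<otimes> y)"
    using coeff_at_conjugate[OF _ c(1) y(1) nat_pow_closed[OF c(2)]] x y(1)
    by (simp add: real_class_elements_def)
  also have "\<dots> = coeff_at x g" using y(2) sym by metis
  finally show ?thesis .
qed

text \<open>An eigenvalue \<open>\<theta>\<close> of \<open>S\<close> with
  \<open>\<theta>\<^sup>2 \<noteq> 1\<close> would come with a nonzero integer \<open>c\<close> such
  that all \<open>c * \<theta> ^ k\<close> and \<open>c * inverse \<theta> ^ k\<close> are integers,
  being \<open>\<phi>\<close> times traces of the spectral idempotent against powers of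
  \<open>s\<close> and \<open>s'\<close>. That forces \<open>\<theta>\<^sup>2 = 1\<close> after
  all.\<close>

lemma real_class_unit_involution:
  assumes N: "finite N" "subgroup N G"
    and p: "prime p" and exp: "\<And>g. g \<in> N \<Longrightarrow> g [^] (p ^ Suc r) = \<one>"
    and cl: "\<And>g j. g \<in> N \<Longrightarrow> coprime j p \<Longrightarrow> conjugate G (g [^] j) g \<or> conjugate G (g [^] (j::nat)) (inv g)"
    and s: "s \<in> real_class_elements N" and s': "s' \<in> real_class_elements N" and inv: "s \<star> s' = frag_of \<one>"
  shows "s \<star> s = frag_of \<one>"
proof -
  define n where "n = card N"
  obtain f where f: "bij_betw f {..<n} N"
    using ex_bij_betw_nat_finite[OF N(1)] by (auto simp: n_def atLeast0LessThan)
  define L where "L = reg_mat f n"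
  have Lc [simp]: "L x \<in> carrier_mat n n" for x by (simp add: L_def)
  have Lm: "L (x \<star> y) = L x * L y" if "supp x \<subseteq> N" "supp y \<subseteq> N" for x y
    using reg_mat_mult[OF N f that] by (simp add: L_def)
  have L1: "L (frag_of \<one>) = 1\<^sub>m n" using reg_mat_one[OF N f] by (simp add: L_def)
  have Nc: "g \<in> carrier G" if "g \<in> N" for g using that N subgroup.subset by blast
  have sup: "supp x \<subseteq> N" if "x \<in> real_class_elements N" for x using that by (simp add: real_class_elements_def)
  have powN: "g [^] (j::nat) \<in> N" if "g \<in> N" for g j
    using that N(2) by (induction j) (auto simp: subgroup.one_closed subgroup.m_closed)
  have supg: "supp (frag_of g) \<subseteq> N" if "g \<in> N" for g using that by simp
  note supp = sup[OF real_class_elements_pow[OF N(2) s]] sup[OF real_class_elements_pow[OF N(2) s']] sup[OF s] sup[OF s']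
  define S where "S = L s"
  have S: "S \<in> carrier_mat n n" by (simp add: S_def)
  have herm: "conj_transpose S = S"
    using reg_mat_conj_transpose[OF N f sup[OF s]] s by (simp add: S_def L_def real_class_elements_def)
  have "S * S = 1\<^sub>m n"
  proof (rule ccontr)
    assume "S * S \<noteq> 1\<^sub>m n"
    then obtain E \<theta> where E: "E \<in> carrier_mat n n" "E * E = E" "E \<noteq> 0\<^sub>m n n" "E * S = \<theta> \<cdot>\<^sub>m E" "\<theta>\<^sup>2 \<noteq> 1"
      and EC: "\<And>C. power_closed n S C \<Longrightarrow> E \<in> C"
      using hermitian_spectral_idempotent[OF S herm] by blast
    have EL: "E * L (frag_of g) = L (frag_of g) * E" if g: "g \<in> N" for g
    proof -
      have "s \<star> frag_of g = frag_of g \<star> s"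
        using s cj_eq_iff_commute[of g s] Nc[OF g] sup[OF s] N subgroup.subset
        by (auto simp: real_class_elements_def)
      then have "S * L (frag_of g) = L (frag_of g) * S"
        using Lm[OF sup[OF s] supg[OF g]] Lm[OF supg[OF g] sup[OF s]] by (simp add: S_def)
      then show ?thesis using EC[OF power_closed_commute[OF S Lc]] by simp
    qed
    have Etr: "trace (E * L (frag_of (g [^] j))) = trace (E * L (frag_of g))"
      if g: "g \<in> N" and j: "coprime j p" for g and j :: nat
    proof -
      \<comment> \<open>All powers of \<open>s\<close> are included to make the space stable under
        right multiplication by \<open>S\<close>; for \<open>E\<close> only \<open>k = 0\<close> is
        then used.\<close>
      define C where "C = {X \<in> carrier_mat n n. \<forall>k. trace (X * L (s [^]\<^bsub>ZG\<^esub> (k::nat)) * L (frag_of (g [^] j))) =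
        trace (X * L (s [^]\<^bsub>ZG\<^esub> k) * L (frag_of g))}"
      have "power_closed n S C"
        unfolding power_closed_def
      proof (intro conjI ballI allI)
        have "trace (L (s [^]\<^bsub>ZG\<^esub> k) * L (frag_of (g [^] j))) = trace (L (s [^]\<^bsub>ZG\<^esub> k) * L (frag_of g))" for k :: nat
        proof -
          define x where "x = s [^]\<^bsub>ZG\<^esub> k"
          have x: "x \<in> real_class_elements N" unfolding x_def by (rule real_class_elements_pow[OF N(2) s])
          have xc: "supp x \<subseteq> carrier G" using sup[OF x] N subgroup.subset by blast
          \<comment> \<open>The regular trace reads off the coefficient at the identity, so pairing
            with \<open>h\<close> gives the coefficient at \<open>inv h\<close>.\<close>
          have 1: "trace (L x * L (frag_of h)) = of_nat n * of_int (coeff_at x (inv h))" if h: "h \<in> N" for h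
            using Lm[OF sup[OF x] supg[OF h], symmetric] trace_reg_mat[OF N f]
              coeff_at_gmult_frag_of_right[OF xc Nc[OF h] one_closed] Nc[OF h] by (simp add: L_def)
          have 2: "coeff_at x (inv h) = coeff_at x h" if h: "h \<in> N" for h
            using coeff_at_star[OF xc Nc[OF h]] x by (simp add: real_class_elements_def)
          show ?thesis
            unfolding x_def[symmetric] 1[OF g] 1[OF powN[OF g]] 2[OF g] 2[OF powN[OF g]]
            using real_class_elements_coeff_power[OF N(2) x g cl[OF g j]] by simp
        qed
        then show "1\<^sub>m n \<in> C" using left_mult_one_mat[OF Lc] by (simp add: C_def)
      next
        fix X assume X: "X \<in> C"
        have "X * S * L (s [^]\<^bsub>ZG\<^esub> k) = X * L (s [^]\<^bsub>ZG\<^esub> Suc k)" for k :: nat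
        proof -
          have "S * L (s [^]\<^bsub>ZG\<^esub> k) = L (s [^]\<^bsub>ZG\<^esub> Suc k)"
            using real_class_elements_mult(1)[OF N(2) s real_class_elements_pow[OF N(2) s, of k]]
            by (simp add: S_def Lm[OF sup[OF s] supp(1), symmetric] ZG_simps)
          then show ?thesis using X S by (simp add: C_def assoc_mult_mat[of X n n S n _ n])
        qed
        note XS = this
        have "trace (X * S * L (s [^]\<^bsub>ZG\<^esub> k) * L (frag_of (g [^] j))) =
            trace (X * S * L (s [^]\<^bsub>ZG\<^esub> k) * L (frag_of g))" for k :: nat
          unfolding XS using X unfolding C_def by blast
        then show "X * S \<in> C" using X S mult_carrier_mat[of X n n S n] unfolding C_def by blast
      next
        fix X Y assume XY: "X \<in> C" "Y \<in> C"
        then have "(X + Y) * L a * L b = X * L a * L b + Y * L a * L b" for a b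
          using mult_carrier_mat[of X n n "L a" n] mult_carrier_mat[of Y n n "L a" n]
          by (simp add: C_def add_mult_distrib_mat[of _ n n _ _ n])
        moreover have "trace (X * L a * L b + Y * L a * L b) = trace (X * L a * L b) + trace (Y * L a * L b)" for a b
          using XY by (intro trace_add[of _ n] mult_carrier_mat[of _ n n _ n]) (auto simp: C_def)
        ultimately show "X + Y \<in> C" using XY by (simp add: C_def)
      next
        fix c X assume X: "X \<in> C"
        then have "(c \<cdot>\<^sub>m X) * L a * L b = c \<cdot>\<^sub>m (X * L a * L b)" for a b
          using mult_carrier_mat[of X n n "L a" n]
          by (simp add: C_def mult_smult_assoc_mat[of _ n n _ n])
        moreover have "trace (c \<cdot>\<^sub>m (X * L a * L b)) = c * trace (X * L a * L b)" for a b
          using X by (intro trace_smult[of _ n] mult_carrier_mat[of _ n n _ n]) (auto simp: C_def)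
        ultimately show "c \<cdot>\<^sub>m X \<in> C" using X by (simp add: C_def)
      qed (auto simp: C_def)
      then have "E \<in> C" by (rule EC)
      then have "trace (E * L (s [^]\<^bsub>ZG\<^esub> (0::nat)) * L (frag_of (g [^] j))) = trace (E * L (s [^]\<^bsub>ZG\<^esub> (0::nat)) * L (frag_of g))"
        unfolding C_def by blast
      then show ?thesis using right_mult_one_mat[OF E(1)] by (simp add: ZG_simps L1)
    qed
    define q where "q = p ^ Suc r"
    define \<phi> where "\<phi> = card {j. j < q \<and> coprime j p}"
    have q1: "1 < q" unfolding q_def using prime_gt_1_nat[OF p] by (metis one_less_power zero_less_Suc)
    have \<phi>0: "\<phi> > 0"
      unfolding \<phi>_def card_gt_0_iff using q1 by (auto intro!: exI[of _ 1])
    have int: "of_nat \<phi> * trace (E * L (frag_of g)) \<in> \<int>" if g: "g \<in> N" for g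
    proof -
      define M where "M i = L (frag_of (g [^] (i::nat)))" for i
      have "(\<Sum>j | j < q \<and> coprime j p. trace (E * M j)) \<in> \<int>"
      proof (rule sum_coprime_traces_in_Ints[OF _ _ _ _ q_def p E(1,2)])
        show "M (Suc i) = M 1 * M i" for i
          using Lm[OF supg[OF g] supg[OF powN[OF g]], of i] nat_pow_Suc2[OF Nc[OF g], of i] Nc[OF g]
          by (simp add: M_def gmult_frag_of)
        show "M q = M 0" using exp[OF g] by (simp add: M_def q_def)
        show "M 0 = 1\<^sub>m n" by (simp add: M_def L1)
        show "E * M i = M i * E" for i unfolding M_def by (rule EL[OF powN[OF g]])
      qed (simp add: M_def)
      \<comment> \<open>All summands agree, so the integral sum is \<open>\<phi>\<close> times a
        single trace.\<close>
      also have "(\<Sum>j | j < q \<and> coprime j p. trace (E * M j)) = (\<Sum>j | j < q \<and> coprime j p. trace (E * L (frag_of g)))"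
        using Etr[OF g] by (intro sum.cong) (auto simp: M_def)
      finally show ?thesis by (simp add: \<phi>_def)
    qed
    define c where "c = of_nat \<phi> * trace E"
    have c0: "c \<noteq> 0" using idempotent_trace(2)[OF E(1,2)] E(3) \<phi>0 by (auto simp: c_def)
    have \<theta>0: "\<theta> \<noteq> 0"
    proof
      assume "\<theta> = 0"
      then have "E * S = 0\<^sub>m n n" using E(1,4) by (simp, intro eq_matI, auto)
      then have "E * S * L s' = 0\<^sub>m n n" using left_mult_zero_mat[OF Lc] by simp
      moreover have "E * S * L s' = E"
        using Lm[OF sup[OF s] sup[OF s'], symmetric] inv L1 E(1)
        unfolding assoc_mult_mat[OF E(1) S Lc] by (simp add: S_def)
      ultimately show False using E(3) by simp
    qed
    have ES': "E * L s' = inverse \<theta> \<cdot>\<^sub>m E"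
    proof -
      have "E = E * (S * L s')"
        using Lm[OF sup[OF s] sup[OF s'], symmetric] inv L1 E(1) by (simp add: S_def)
      also have "\<dots> = \<theta> \<cdot>\<^sub>m (E * L s')"
        using E S mult_smult_assoc_mat[OF E(1) Lc] by (simp add: assoc_mult_mat[OF E(1) S Lc, symmetric])
      finally have "inverse \<theta> \<cdot>\<^sub>m E = inverse \<theta> \<cdot>\<^sub>m (\<theta> \<cdot>\<^sub>m (E * L s'))" by simp
      also have "\<dots> = E * L s'" using \<theta>0 by (intro eq_matI) (auto simp: mult.assoc[symmetric])
      finally show ?thesis by simp
    qed
    \<comment> \<open>To be applied to \<open>s\<close> with \<open>\<theta>\<close> and to its
      inverse \<open>s'\<close> with \<open>inverse \<theta>\<close>.\<close>
    have pow: "c * w ^ k \<in> \<int>" if x: "x \<in> real_class_elements N" and w: "E * L x = w \<cdot>\<^sub>m E" for x w k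
    proof -
      have xk: "x [^]\<^bsub>ZG\<^esub> k \<in> real_class_elements N" for k :: nat by (rule real_class_elements_pow[OF N(2) x])
      have "E * L (x [^]\<^bsub>ZG\<^esub> k) = w ^ k \<cdot>\<^sub>m E"
      proof (induction k)
        case 0
        then show ?case using E(1) by (simp add: ZG_simps L1) (intro eq_matI, auto)
      next
        case (Suc k)
        have "E * L (x [^]\<^bsub>ZG\<^esub> Suc k) = E * L (x [^]\<^bsub>ZG\<^esub> k) * L x"
          using Lm[OF sup[OF xk] sup[OF x], of k] by (simp add: ZG_simps assoc_mult_mat[OF E(1) Lc Lc])
        also have "\<dots> = w ^ k \<cdot>\<^sub>m (w \<cdot>\<^sub>m E)"
          using Suc w mult_smult_assoc_mat[OF E(1) Lc] by simp
        finally show ?case by (simp add: smult_smult_times mult.commute)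
      qed
      then have "of_nat \<phi> * trace (E * L (x [^]\<^bsub>ZG\<^esub> k)) = c * w ^ k"
        using trace_smult[OF E(1)] by (simp add: c_def)
      then show ?thesis
        using trace_mult_reg_mat_in_Ints[OF N f E(1), of "of_nat \<phi>"] int sup[OF xk] by (metis L_def)
    qed
    have "\<theta>\<^sup>2 = 1"
      using Ints_powers_square_eq_1[OF c0 pow[OF s] pow[OF s' ES'] \<theta>0] E(4) by (simp add: S_def)
    then show False using E(5) by simp
  qed
  then have "L (s \<star> s) = L (frag_of \<one>)" using Lm[OF sup[OF s] sup[OF s]] L1 by (simp add: S_def)
  then show ?thesis
    using reg_mat_inj[OF N f supp_gmult[OF N(2) sup[OF s] sup[OF s]] supg[OF subgroup.one_closed[OF N(2)]]]
    by (simp add: L_def)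
qed


lemma cj_star:
  assumes x: "x \<in> carrier G" and f: "supp f \<subseteq> carrier G"
  shows "cj x (star f) = star (cj x f)"
  using f
proof (induction f rule: frag_induction)
  case (one y)
  then show ?case using x by (simp add: cj_frag_of inv_mult_group m_assoc)
qed (auto simp: cj_diff star_diff)

lemma coeff_one_gmult_star:
  assumes "supp x \<subseteq> carrier G"
  shows "coeff_at (x \<star> star x) \<one> = (\<Sum>g\<in>supp x. (coeff_at x g)\<^sup>2)"
proof -
  have "coeff_at (x \<star> star x) \<one> = (\<Sum>g\<in>supp x. coeff_at x g * coeff_at (star x) (inv g \<otimes> \<one>))"
    using assms supp_star_carrier by (intro coeff_at_gmult) auto
  also have "\<dots> = (\<Sum>g\<in>supp x. (coeff_at x g)\<^sup>2)"
    using assms by (intro sum.cong refl) (auto simp: coeff_at_star power2_eq_square subset_iff)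
  finally show ?thesis .
qed

lemma p_group_exponent:
  assumes "p_group p G" "prime p" "finite N" "N \<subseteq> carrier G"
  shows "\<exists>r. \<forall>g\<in>N. g [^] (p ^ Suc r) = \<one>"
proof -
  have "\<forall>g\<in>N. \<exists>k. ord g = p ^ k" using assms by (auto simp: p_group_def)
  then obtain k where k: "\<And>g. g \<in> N \<Longrightarrow> ord g = p ^ k g" by metis
  define r where "r = Max (insert 0 (k ` N))"
  have "g [^] (p ^ Suc r) = \<one>" if g: "g \<in> N" for g
  proof -
    have "k g \<le> r" unfolding r_def using assms g by (intro Max_ge) auto
    then have "ord g dvd p ^ Suc r" using k[OF g] by (simp add: le_imp_power_dvd)
    then show ?thesis using g assms by (simp add: pow_eq_id subset_iff)
  qed
  then show ?thesis by blast
qed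

theorem cut_group_if_power_conjugate:
  assumes p: "prime p" and pG: "p_group p G"
    and cl: "\<And>a j. a \<in> FC_subgroup G \<Longrightarrow> coprime j p \<Longrightarrow>
      conjugate G (a [^] j) a \<or> conjugate G (a [^] (j::nat)) (inv a)"
  shows "cut_group G"
proof -
  have "u \<in> frag_of ` group_center G \<union> (\<lambda>z. - frag_of z) ` group_center G"
    if u: "u \<in> group_center (units_of ZG)" for u
  proof -
    note uu = u[unfolded center_units_iff]
    have uU: "u \<in> Units ZG" by (rule conjunct1[OF uu])
    have ucj: "cj x u = u" if "x \<in> carrier G" for x by (rule bspec[OF conjunct2[OF uu] that])
    obtain u' where uc: "supp u \<subseteq> carrier G" and u'c: "supp u' \<subseteq> carrier G"
      and inv: "u \<star> u' = frag_of \<one>" "u' \<star> u = frag_of \<one>"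
      using uU[unfolded Units_ZG] by (elim conjE exE)
    have u'cj: "cj x u' = u'" if x: "x \<in> carrier G" for x
    proof -
      have c: "supp (cj x u') \<subseteq> carrier G" using supp_cj_carrier[OF x u'c] .
      have "cj x u' = cj x u' \<star> (u \<star> u')" using inv c by (simp add: gmult_one)
      also have "\<dots> = cj x u' \<star> cj x u \<star> u'" using uc u'c c by (simp add: gmult_assoc ucj[OF x])
      also have "\<dots> = u'" using cj_gmult[OF x u'c uc, symmetric] inv x u'c by (simp add: gmult_one)
      finally show ?thesis .
    qed
    \<comment> \<open>The support of the inverse is included so that \<open>s\<close> and
      \<open>s'\<close> live over one finite normal subgroup.\<close>
    define S where "S = supp u \<union> supp u'"
    have S: "finite S" "S \<subseteq> carrier G" using uc u'c by (auto simp: S_def)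
    have Scl: "inv x \<otimes> y \<otimes> x \<in> S" if "x \<in> carrier G" "y \<in> S" for x y
    proof -
      have yc: "y \<in> carrier G" using that S by auto
      show ?thesis using that(2) coeff_at_conjugate[OF ucj[OF that(1)] uc that(1) yc]
          coeff_at_conjugate[OF u'cj[OF that(1)] u'c that(1) yc]
        by (simp add: S_def in_keys_iff)
    qed
    have tor: "\<exists>k>0. x [^] (k::nat) = \<one>" if "x \<in> carrier G" for x
      using p_group_exponent[OF pG p, of "{x}"] that prime_gt_0_nat[OF p] zero_less_power by blast
    obtain r where r: "\<And>x. x \<in> S \<Longrightarrow> x [^] (p ^ Suc r) = \<one>"
      using p_group_exponent[OF pG p S] by blast
    have m0: "p ^ Suc r > 0" using prime_gt_0_nat[OF p] by simp
    obtain N where N: "finite N" "subgroup N G" "S \<subseteq> N"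
      and Ncl: "\<And>x y. x \<in> carrier G \<Longrightarrow> y \<in> N \<Longrightarrow> inv x \<otimes> y \<otimes> x \<in> N"
      using finite_normal_hull[OF S Scl m0 r tor] by blast
    have Nc: "N \<subseteq> carrier G" using N subgroup.subset by blast
    have FC: "N \<subseteq> FC_subgroup G"
    proof
      fix a assume a: "a \<in> N"
      have "{b. conjugate G a b} \<subseteq> N" using Ncl a by (auto simp: conjugate_def)
      then show "a \<in> FC_subgroup G" using a Nc N finite_subset by (auto simp: FC_subgroup_def)
    qed
    obtain r' where r': "\<And>x. x \<in> N \<Longrightarrow> x [^] (p ^ Suc r') = \<one>"
      using p_group_exponent[OF pG p N(1) Nc] by blast
    have mem: "w \<star> star w \<in> real_class_elements N"
      if w: "supp w \<subseteq> N" and wcj: "\<And>x. x \<in> carrier G \<Longrightarrow> cj x w = w" for w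
    proof -
      have wc: "supp w \<subseteq> carrier G" "supp (star w) \<subseteq> carrier G"
        using w Nc supp_star_carrier by auto
      show ?thesis
        unfolding real_class_elements_def mem_Collect_eq
        using wc supp_gmult[OF N(2) w supp_star[OF N(2) w]]
        by (simp add: star_gmult star_star cj_gmult cj_star wcj)
    qed
    have supN: "supp u \<subseteq> N" "supp u' \<subseteq> N" using N by (auto simp: S_def)
    define s where "s = u \<star> star u"
    define s' where "s' = u' \<star> star u'"
    have s: "s \<in> real_class_elements N" unfolding s_def by (rule mem[OF supN(1) ucj])
    have s': "s' \<in> real_class_elements N" unfolding s'_def by (rule mem[OF supN(2) u'cj])
    note sc = supp_star_carrier[OF uc] supp_star_carrier[OF u'c]
    have "s \<star> s' = frag_of \<one>"
    proof -
      have comm: "u' \<star> star u = star u \<star> u'"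
      proof (rule gmult_commute_span[OF sc(1)])
        fix d assume d: "d \<in> carrier G"
        show "u' \<star> frag_of d = frag_of d \<star> u'" using u'cj[OF d] unfolding cj_eq_iff_commute[OF d u'c] .
      qed
      have "s \<star> s' = u \<star> (star u \<star> u') \<star> star u'"
        unfolding s_def s'_def using uc u'c sc by (simp add: gmult_assoc supp_gmult_carrier)
      also have "\<dots> = (u \<star> u') \<star> (star u \<star> star u')"
        unfolding comm[symmetric] using uc u'c sc by (simp add: gmult_assoc supp_gmult_carrier)
      also have "star u \<star> star u' = frag_of \<one>"
        using star_gmult[OF u'c uc, symmetric] inv by simp
      finally show ?thesis using inv by (simp add: gmult_frag_of)
    qed
    then have ss: "s \<star> s = frag_of \<one>"
      using real_class_unit_involution[OF N(1,2) p r' cl s s'] FC by blast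
    have s_c: "supp s \<subseteq> carrier G" and s_star: "star s = s"
      using s Nc by (auto simp: real_class_elements_def)
    define A where "A = (\<Sum>g\<in>supp u. (coeff_at u g)\<^sup>2)"
    have sA: "coeff_at s \<one> = A" using coeff_one_gmult_star[OF uc] by (simp add: A_def s_def)
    have A1: "(\<Sum>g\<in>supp s. (coeff_at s g)\<^sup>2) = 1"
      using coeff_one_gmult_star[OF s_c] ss s_star by simp
    have pos: "1 \<le> (coeff_at u g)\<^sup>2" if "g \<in> supp u" for g
      using that by (simp add: in_keys_iff int_one_le_iff_zero_less)
    have cardA: "int (card (supp u)) \<le> A"
      unfolding A_def using sum_mono[of "supp u" "\<lambda>_. 1" "\<lambda>g. (coeff_at u g)\<^sup>2"] pos by simp
    have "u \<noteq> 0"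
    proof
      assume "u = 0"
      then have "frag_of \<one> = (0 :: 'a \<Rightarrow>\<^sub>0 int)" using inv by simp
      then show False by simp
    qed
    then have card1: "card (supp u) \<ge> 1" by (simp add: Suc_le_eq card_gt_0_iff)
    \<comment> \<open>\<open>A\<close> is the coefficient of \<open>s\<close> at the identity. As
      \<open>s\<close> is fixed by \<open>star\<close> and squares to 1, the squares of its
      coefficients sum to 1, so \<open>A\<^sup>2 \<le> 1\<close>; this leaves \<open>u\<close> a
      single coefficient, 1 or -1.\<close>
    have A_le: "A \<le> 1"
    proof -
      have A0: "A \<ge> 1" using card1 cardA by linarith
      then have one: "\<one> \<in> supp s" using sA by (simp add: in_keys_iff)
      have "(coeff_at s \<one>)\<^sup>2 \<le> (\<Sum>g\<in>supp s. (coeff_at s g)\<^sup>2)"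
        using one by (intro member_le_sum) auto
      then have "A\<^sup>2 \<le> 1" using A1 sA by simp
      then show ?thesis using A0 by (simp add: abs_square_le_1)
    qed
    have "card (supp u) = 1" using A_le card1 cardA by linarith
    then obtain z where z: "supp u = {z}" by (auto simp: card_1_singleton_iff)
    then have "(coeff_at u z)\<^sup>2 = 1" using A_le pos[of z] by (simp add: A_def)
    then have uz: "coeff_at u z = 1 \<or> coeff_at u z = -1" by (simp add: power2_eq_1_iff)
    have u_eq: "u = frag_cmul (coeff_at u z) (frag_of z)"
    proof (rule poly_mapping_eqI)
      fix g
      show "coeff_at u g = coeff_at (frag_cmul (coeff_at u z) (frag_of z)) g"
      proof (cases "g = z")
        case False
        then have "g \<notin> supp u" using z by simp
        then have "coeff_at u g = 0" unfolding in_keys_iff by simp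
        then show ?thesis using False unfolding lookup_frag_cmul coeff_at_frag_of by simp
      qed simp
    qed
    have zc: "z \<in> carrier G" using z uc by auto
    have "z \<in> group_center G"
    proof -
      have "z \<otimes> x = x \<otimes> z" if x: "x \<in> carrier G" for x
      proof -
        have "coeff_at u (inv x \<otimes> z \<otimes> x) = coeff_at u z"
          using coeff_at_conjugate[OF ucj[OF x] uc x zc] .
        then have "inv x \<otimes> z \<otimes> x \<in> supp u" using uz by (auto simp: in_keys_iff)
        then have "inv x \<otimes> z \<otimes> x = z" using z by simp
        then have "x \<otimes> (inv x \<otimes> (z \<otimes> x)) = x \<otimes> z" using x zc by (simp add: m_assoc)
        then show ?thesis using x zc by (simp add: m_assoc[symmetric])
      qed
      then show ?thesis using zc by (simp add: group_center_def)
    qed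
    with uz show ?thesis
    proof (elim disjE)
      assume "coeff_at u z = 1"
      with u_eq have "u = frag_of z" by (metis frag_cmul_one)
      with \<open>z \<in> group_center G\<close> show ?thesis by blast
    next
      assume "coeff_at u z = - 1"
      with u_eq have "u = - frag_of z" by (metis frag_cmul_minus_one)
      with \<open>z \<in> group_center G\<close> show ?thesis by blast
    qed
  qed
  then show ?thesis
    unfolding cut_group_def using trivial_units_central by blast
qed

end

subsection \<open>Exponents fixing a conjugacy class\<close>

lemma one_plus_power_cong:
  fixes z :: int
  shows "[(1 + z) ^ t = 1 + int t * z] (mod z\<^sup>2)"
proof (induction t)
  case (Suc t)
  have "[(1 + z) ^ Suc t = (1 + int t * z) * (1 + z)] (mod z\<^sup>2)"
    using cong_scalar_right[OF Suc, of "1 + z"] by (simp add: mult.commute)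
  also have "(1 + int t * z) * (1 + z) = 1 + int (Suc t) * z + z\<^sup>2 * int t"
    by (simp add: algebra_simps power2_eq_square)
  also have "[1 + int (Suc t) * z + z\<^sup>2 * int t = 1 + int (Suc t) * z] (mod z\<^sup>2)"
    by (simp add: cong_iff_dvd_diff)
  finally show ?case .
qed simp

text \<open>Each \<open>p\<close>-th power moves the difference from 1 by exactly one factor
  \<open>p\<close>. For \<open>p = 2\<close> this regularity starts only at \<open>B = 4\<close>:
  already 3 = 1 + 2 has the square 1 + 8.\<close>

lemma principal_unit_power:
  fixes p B h :: int
  assumes pB: "p = 2 \<and> B = 4 \<or> p = 3 \<and> B = 3" and h: "[h = 1] (mod B)" "\<not> [h = 1] (mod p * B)"
  shows "\<exists>c. h ^ (nat p ^ e) = 1 + B * p ^ e * c \<and> \<not> p dvd c"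
proof (induction e)
  case 0
  obtain c where c: "h - 1 = B * c" using h(1) by (auto simp: cong_iff_dvd_diff)
  have "\<not> p dvd c"
  proof
    assume "p dvd c"
    then have "p * B dvd h - 1" using c by (auto simp: mult.commute)
    then show False using h(2) by (simp add: cong_iff_dvd_diff)
  qed
  then show ?case using c by (intro exI[of _ c]) auto
next
  case (Suc e)
  then obtain c where c: "h ^ (nat p ^ e) = 1 + B * p ^ e * c" "\<not> p dvd c" by blast
  \<comment> \<open>From the square, respectively the cube, of \<open>1 + B * p ^ e * c\<close>:
    subtract 1 and divide by \<open>B * p ^ Suc e\<close>.\<close>
  define d where "d = (if p = 2 then c + 2 * 2 ^ e * c\<^sup>2 else c + 3 * 3 ^ e * c\<^sup>2 + 3 * (3 ^ e)\<^sup>2 * c ^ 3)"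
  have "h ^ (nat p ^ Suc e) = (1 + B * p ^ e * c) ^ nat p"
    by (simp only: power_Suc2 power_mult c(1))
  also have "\<dots> = 1 + B * p ^ Suc e * d"
    using pB by (auto simp: d_def power2_eq_square power3_eq_cube algebra_simps)
  finally have "h ^ (nat p ^ Suc e) = 1 + B * p ^ Suc e * d" .
  moreover have "\<not> p dvd d"
  proof
    assume "p dvd d"
    moreover have "p dvd d - c" using pB by (auto simp: d_def mult.assoc)
    ultimately have "p dvd c" using dvd_diff[of p d "d - c"] by simp
    then show False using c(2) by simp
  qed
  ultimately show ?case by blast
qed

text \<open>The p-adic group 1 + B Z_p is topologically generated by any element that is 1 modulo
  \<open>B\<close> but not modulo \<open>p * B\<close>. The induction corrects the exponent by
  \<open>nat p ^ k * t\<close>, where the digit \<open>t\<close> solves a linear congruence modulo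
  \<open>p\<close>.\<close>

lemma principal_units_generated:
  fixes p B h x :: int
  assumes pB: "p = 2 \<and> B = 4 \<or> p = 3 \<and> B = 3" and h: "[h = 1] (mod B)" "\<not> [h = 1] (mod p * B)"
    and x: "[x = 1] (mod B)"
  shows "\<exists>i. [x = h ^ i] (mod B * p ^ k)"
proof (induction k)
  case 0
  then show ?case using x by (intro exI[of _ 0]) auto
next
  case (Suc k)
  then obtain i where i: "[x = h ^ i] (mod B * p ^ k)" by blast
  then obtain d where d: "x - h ^ i = B * p ^ k * d" by (auto simp: cong_iff_dvd_diff)
  obtain c where c: "h ^ (nat p ^ k) = 1 + B * p ^ k * c" "\<not> p dvd c"
    using principal_unit_power[OF pB h] by blast
  have p: "prime p" using pB by auto
  have "coprime c p" using prime_imp_coprime[OF p c(2)] by (simp add: coprime_commute)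
  then obtain c' where c': "[c * c' = 1] (mod p)" using cong_solve_coprime_int by blast
  define t where "t = nat ((c' * d) mod p)"
  have p0: "p > 0" using pB by auto
  have t: "[c * int t = d] (mod p)"
  proof -
    have "[int t = c' * d] (mod p)" using p0 by (simp add: t_def cong_def)
    then have "[c * int t = c * (c' * d)] (mod p)" by (rule cong_scalar_left)
    also have "[c * (c' * d) = d] (mod p)" using cong_scalar_right[OF c', of d] by (simp add: mult.assoc)
    finally show ?thesis .
  qed
  define z where "z = B * p ^ k * c"
  have pdB: "p dvd B" using pB by auto
  have hi: "[h ^ i = 1] (mod p)"
    using cong_pow[OF cong_dvd_modulus[OF h(1) pdB], of i] by simp
  have dz: "B * p ^ Suc k dvd z\<^sup>2"
  proof -
    obtain B' where B': "B = p * B'" using pdB by blast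
    have "z\<^sup>2 = (B * p ^ Suc k) * (B' * p ^ k * c\<^sup>2)"
      by (simp add: z_def B' power2_eq_square algebra_simps)
    then show ?thesis by simp
  qed
  have "[h ^ (i + nat p ^ k * t) = h ^ i * (1 + int t * z)] (mod B * p ^ Suc k)"
  proof -
    have "h ^ (i + nat p ^ k * t) = h ^ i * (1 + z) ^ t"
      using c(1) by (simp add: power_add power_mult z_def)
    then show ?thesis
      using cong_scalar_left[OF cong_dvd_modulus[OF one_plus_power_cong[of z t] dz], of "h ^ i"] by simp
  qed
  also have "[h ^ i * (1 + int t * z) = x] (mod B * p ^ Suc k)"
  proof -
    have "[h ^ i * (c * int t) = 1 * d] (mod p)" using hi t by (rule cong_mult)
    then obtain w where w: "h ^ i * (c * int t) - d = p * w" by (auto simp: cong_iff_dvd_diff)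
    have "h ^ i * (1 + int t * z) - x = B * p ^ k * (h ^ i * (c * int t) - d)"
      using d by (simp add: z_def algebra_simps)
    also have "\<dots> = B * p ^ Suc k * w" unfolding w by simp
    finally show ?thesis by (simp add: cong_iff_dvd_diff)
  qed
  finally show ?case using cong_sym by blast
qed

lemma principal_units_in_closed_set:
  fixes p B h x :: int and K :: "int set"
  assumes pB: "p = 2 \<and> B = 4 \<or> p = 3 \<and> B = 3" and h: "[h = 1] (mod B)" "\<not> [h = 1] (mod p * B)"
    and x: "[x = 1] (mod B)"
    and K: "1 \<in> K" "\<And>x y. x \<in> K \<Longrightarrow> y \<in> K \<Longrightarrow> x * y \<in> K"
      "\<And>x y. [x = y] (mod p ^ k) \<Longrightarrow> x \<in> K \<Longrightarrow> y \<in> K" "h \<in> K"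
  shows "x \<in> K"
proof -
  obtain i where i: "[x = h ^ i] (mod B * p ^ k)"
    using principal_units_generated[OF pB h x] by blast
  have "h ^ i \<in> K" using K by (induction i) auto
  moreover have "[h ^ i = x] (mod p ^ k)"
    using cong_dvd_modulus[OF i, of "p ^ k"] by (simp add: cong_sym)
  ultimately show ?thesis using K(3) by blast
qed

context group
begin

section \<open>Conjugacy of powers\<close>

lemma conjugate_refl: "a \<in> carrier G \<Longrightarrow> conjugate G a a"
  by (auto simp: conjugate_def intro!: bexI[of _ \<one>])

lemma conjugate_trans:
  assumes "a \<in> carrier G" "conjugate G a b" "conjugate G b c"
  shows "conjugate G a c"
proof -
  obtain x where x: "x \<in> carrier G" "b = inv x \<otimes> a \<otimes> x" using assms(2) by (auto simp: conjugate_def)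
  obtain y where y: "y \<in> carrier G" "c = inv y \<otimes> b \<otimes> y" using assms(3) by (auto simp: conjugate_def)
  have "c = inv (x \<otimes> y) \<otimes> a \<otimes> (x \<otimes> y)"
    using x y assms(1) by (simp add: inv_mult_group m_assoc)
  then show ?thesis using x(1) y(1) unfolding conjugate_def by blast
qed

lemma conjugate_sym:
  assumes "a \<in> carrier G" "conjugate G a b"
  shows "conjugate G b a"
proof -
  obtain x where x: "x \<in> carrier G" "b = inv x \<otimes> a \<otimes> x" using assms(2) by (auto simp: conjugate_def)
  have "x \<otimes> (inv x \<otimes> a \<otimes> x) \<otimes> inv x = a"
    using x(1) assms(1) by (simp add: m_assoc) (simp add: m_assoc[symmetric])
  then show ?thesis using x unfolding conjugate_def by (intro bexI[of _ "inv x"]) auto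
qed

lemma nat_pow_conjugate:
  assumes "a \<in> carrier G" "x \<in> carrier G"
  shows "(inv x \<otimes> a \<otimes> x) [^] (n::nat) = inv x \<otimes> a [^] n \<otimes> x"
proof (induction n)
  case (Suc n)
  then show ?case using assms m_assoc[of x "inv x" "a \<otimes> x"] by (simp add: m_assoc)
qed (use assms in simp)

lemma int_pow_conjugate:
  assumes "a \<in> carrier G" "x \<in> carrier G"
  shows "(inv x \<otimes> a \<otimes> x) [^] (j::int) = inv x \<otimes> a [^] j \<otimes> x"
  unfolding int_pow_def2 nat_pow_conjugate[OF assms] using assms by (simp add: inv_mult_group m_assoc)

lemma conjugate_int_pow:
  "a \<in> carrier G \<Longrightarrow> conjugate G a b \<Longrightarrow> conjugate G (a [^] (j::int)) (b [^] j)"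
  by (auto simp: conjugate_def int_pow_conjugate)

lemma conjugate_inv:
  assumes a: "a \<in> carrier G" and "conjugate G a b"
  shows "conjugate G (inv a) (inv b)"
proof -
  obtain x where x: "x \<in> carrier G" "b = inv x \<otimes> a \<otimes> x" using assms(2) by (auto simp: conjugate_def)
  then have "inv b = inv x \<otimes> inv a \<otimes> x" using a by (simp add: inv_mult_group m_assoc)
  then show ?thesis using x(1) unfolding conjugate_def by blast
qed

text \<open>Modulo the order of \<open>a\<close>, the stabilizer of the class of \<open>a\<close>
  among the exponents. Integer exponents let -1 take part.\<close>

definition class_exps :: "'a \<Rightarrow> int set" where
  "class_exps a = {j. conjugate G (a [^] j) a}"

definition real_class_exps :: "'a \<Rightarrow> int set" where
  "real_class_exps a = {j. j \<in> class_exps a \<or> - j \<in> class_exps a}"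

lemma class_exps_one: "a \<in> carrier G \<Longrightarrow> 1 \<in> class_exps a"
  by (simp add: class_exps_def conjugate_refl)

lemma class_exps_mult:
  assumes a: "a \<in> carrier G" and "i \<in> class_exps a" "j \<in> class_exps a"
  shows "i * j \<in> class_exps a"
proof -
  have "conjugate G ((a [^] i) [^] j) (a [^] j)"
    using assms by (intro conjugate_int_pow) (auto simp: class_exps_def)
  then have "conjugate G (a [^] (i * j)) (a [^] j)" using a by (simp add: int_pow_pow)
  then show ?thesis using assms conjugate_trans[of "a [^] (i * j)"] by (simp add: class_exps_def)
qed

lemma class_exps_cong:
  assumes a: "a \<in> carrier G" and "a [^] (m::nat) = \<one>" "[i = j] (mod int m)" "i \<in> class_exps a"
  shows "j \<in> class_exps a"
proof -
  have "ord a dvd m" using a assms(2) by (simp add: pow_eq_id)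
  then have "[i = j] (mod int (ord a))" by (intro cong_dvd_modulus[OF assms(3)]) simp
  then have "a [^] i = a [^] j" using a by (simp add: int_pow_eq cong_iff_dvd_diff dvd_diff_commute)
  then show ?thesis using assms(4) by (simp add: class_exps_def)
qed

lemma real_class_exps_mult:
  assumes a: "a \<in> carrier G" and "i \<in> real_class_exps a" "j \<in> real_class_exps a"
  shows "i * j \<in> real_class_exps a"
  using assms class_exps_mult[OF a, of i j] class_exps_mult[OF a, of "- i" j]
    class_exps_mult[OF a, of i "- j"] class_exps_mult[OF a, of "- i" "- j"]
  by (auto simp: real_class_exps_def)

lemma real_class_exps_cong:
  assumes a: "a \<in> carrier G" and "a [^] (m::nat) = \<one>" "[i = j] (mod int m)" "i \<in> real_class_exps a"
  shows "j \<in> real_class_exps a"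
  using assms(4) class_exps_cong[OF a assms(2,3)] class_exps_cong[OF a assms(2), of "- i" "- j"] assms(3)
  by (auto simp: real_class_exps_def cong_minus_minus_iff)

lemma real_class_exps_iff:
  assumes a: "a \<in> carrier G"
  shows "j \<in> real_class_exps a \<longleftrightarrow> conjugate G (a [^] j) a \<or> conjugate G (a [^] j) (inv a)"
proof -
  have "conjugate G (a [^] (- j)) a \<longleftrightarrow> conjugate G (a [^] j) (inv a)"
    using conjugate_inv[of "a [^] (- j)" a] conjugate_inv[of "a [^] j" "inv a"] a
    by (auto simp: int_pow_neg)
  then show ?thesis by (auto simp: real_class_exps_def class_exps_def)
qed

lemma principal_units_in_class_exps:
  fixes p B h x :: int
  assumes a: "a \<in> carrier G" "a [^] (nat p ^ k) = \<one>" and K: "K = class_exps a \<or> K = real_class_exps a"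
    and pB: "p = 2 \<and> B = 4 \<or> p = 3 \<and> B = 3" and h: "h \<in> K" "[h = 1] (mod B)" "\<not> [h = 1] (mod p * B)"
    and x: "[x = 1] (mod B)"
  shows "x \<in> K"
proof (rule principal_units_in_closed_set[OF pB h(2,3) x _ _ _ h(1)])
  show "1 \<in> K" using K by (elim disjE) (simp_all add: class_exps_one[OF a(1)] real_class_exps_def)
  show "x * y \<in> K" if "x \<in> K" "y \<in> K" for x y
    using K that by (elim disjE) (simp_all add: class_exps_mult[OF a(1)] real_class_exps_mult[OF a(1)])
  show "y \<in> K" if xy: "[x = y] (mod p ^ k)" "x \<in> K" for x y
  proof -
    have "int (nat p ^ k) = p ^ k" using pB by auto
    then have xy': "[x = y] (mod int (nat p ^ k))" using xy(1) by (simp only:)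
    from K show ?thesis
    proof
      assume K: "K = class_exps a"
      show ?thesis using class_exps_cong[OF a xy'] xy(2) unfolding K .
    next
      assume K: "K = real_class_exps a"
      show ?thesis using real_class_exps_cong[OF a xy'] xy(2) unfolding K .
    qed
  qed
qed

text \<open>The hypothesis makes -3 an exponent fixing the class up to inversion. It is 1 modulo 4
  but not modulo 8, so it generates all exponents that are 1 modulo 4, and every odd number is such
  an exponent up to sign.\<close>

lemma power_conjugate_2:
  assumes a: "a \<in> carrier G" "a [^] ((2::nat) ^ k) = \<one>"
    and cl: "conjugate G (a [^] (3::nat)) a \<or> conjugate G (a [^] (3::nat)) (inv a)"
    and j: "odd (j::nat)"
  shows "conjugate G (a [^] j) a \<or> conjugate G (a [^] j) (inv a)"
proof -
  have "3 \<in> real_class_exps a"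
    unfolding real_class_exps_iff[OF a(1)] using cl int_pow_int[of G a 3] by simp
  then have 3: "-3 \<in> real_class_exps a" unfolding real_class_exps_def by auto
  have main: "x \<in> real_class_exps a" if x: "[x = 1] (mod 4)" for x
    by (rule principal_units_in_class_exps[where p = 2 and B = 4 and k = k, OF a(1) _ _ _ 3 _ _ x])
      (simp_all add: a(2) cong_def)
  have "\<exists>q. j = 4 * q + 1 \<or> j = 4 * q + 3" using j by presburger
  then obtain q where q: "j = 4 * q + 1 \<or> j = 4 * q + 3" by blast
  have "int j \<in> real_class_exps a"
    using q
  proof
    assume "j = 4 * q + 1"
    then have "[int j = 1] (mod 4)" by (simp add: cong_iff_dvd_diff)
    then show ?thesis by (rule main)
  next
    assume "j = 4 * q + 3"
    then have "- int j - 1 = 4 * (- int q - 1)" by simp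
    then have "[- int j = 1] (mod 4)" unfolding cong_iff_dvd_diff by (metis dvd_triv_left)
    then have "- int j \<in> real_class_exps a" by (rule main)
    then show ?thesis unfolding real_class_exps_def by auto
  qed
  then show ?thesis unfolding real_class_exps_iff[OF a(1)] int_pow_int .
qed

text \<open>By inversion -2 fixes the class. It is 1 modulo 3 but not modulo 9, so it generates all
  exponents that are 1 modulo 3; a number prime to 3 is of this form up to sign.\<close>

lemma power_conjugate_3:
  assumes a: "a \<in> carrier G" "a [^] ((3::nat) ^ k) = \<one>"
    and cl: "conjugate G (a [^] (2::nat)) (inv a)"
    and j: "\<not> 3 dvd (j::nat)"
  shows "conjugate G (a [^] j) a \<or> conjugate G (a [^] j) (inv a)"
proof -
  have "conjugate G (inv (a [^] (2::nat))) (inv (inv a))" using cl a(1) by (intro conjugate_inv) auto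
  moreover have "inv (a [^] (2::nat)) = a [^] (-2::int)"
    using int_pow_neg[OF a(1), of 2] int_pow_int[of G a 2] by simp
  ultimately have 2: "-2 \<in> class_exps a" using a(1) unfolding class_exps_def by simp
  have main: "x \<in> class_exps a" if x: "[x = 1] (mod 3)" for x
    by (rule principal_units_in_class_exps[where p = 3 and B = 3 and k = k, OF a(1) _ _ _ 2 _ _ x])
      (simp_all add: a(2) cong_def)
  have "\<exists>q. j = 3 * q + 1 \<or> j = 3 * q + 2" using j by presburger
  then obtain q where q: "j = 3 * q + 1 \<or> j = 3 * q + 2" by blast
  have "int j \<in> real_class_exps a"
    using q
  proof
    assume "j = 3 * q + 1"
    then have "[int j = 1] (mod 3)" by (simp add: cong_iff_dvd_diff)
    then show ?thesis using main unfolding real_class_exps_def by blast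
  next
    assume "j = 3 * q + 2"
    then have "- int j - 1 = 3 * (- int q - 1)" by simp
    then have "[- int j = 1] (mod 3)" unfolding cong_iff_dvd_diff by (metis dvd_triv_left)
    then show ?thesis using main unfolding real_class_exps_def by blast
  qed
  then show ?thesis unfolding real_class_exps_iff[OF a(1)] int_pow_int .
qed

text \<open>Conjugates of \<open>a\<close> have its order, whereas the power by a multiple of
  \<open>p\<close> has a smaller one.\<close>

lemma class_exps_coprime:
  assumes p: "prime (p::nat)" and a: "a \<in> carrier G" "ord a = p ^ Suc k" and j: "j \<in> class_exps a"
  shows "\<not> int p dvd j"
proof
  assume "int p dvd j"
  then obtain i where i: "j = int p * i" by blast
  have "conjugate G ((a [^] j) [^] int (p ^ k)) (a [^] int (p ^ k))"
    using j a(1) by (intro conjugate_int_pow) (auto simp: class_exps_def)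
  moreover have "(a [^] j) [^] int (p ^ k) = \<one>"
  proof -
    have "(a [^] j) [^] int (p ^ k) = a [^] (int (ord a) * i)"
      using a by (simp add: int_pow_pow i mult_ac)
    also have "\<dots> = \<one>" using a(1) by (subst int_pow_eq_id) auto
    finally show ?thesis .
  qed
  ultimately have "a [^] int (p ^ k) = \<one>" by (auto simp: conjugate_def)
  then have "a [^] (p ^ k) = \<one>" unfolding int_pow_int .
  then have "p ^ Suc k dvd p ^ k" using a by (simp add: pow_eq_id)
  then show False using p prime_gt_1_nat[OF p] by (simp add: power_dvd_imp_le dvd_imp_le)
qed

text \<open>If the order divided 4, then 3 would act as -1. An odd exponent other than 1 and -1
  modulo 8 is 5 modulo 8 up to sign; it would generate everything that is 1 modulo 4, including -3,
  contrary to \<open>bad\<close>.\<close>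

lemma class_exps_bad_2:
  assumes a: "a \<in> carrier G" "ord a = 2 ^ k"
    and bad: "\<not> (conjugate G (a [^] (3::nat)) a \<or> conjugate G (a [^] (3::nat)) (inv a))"
  shows "8 dvd ord a" "\<And>j. j \<in> class_exps a \<Longrightarrow> [j = 1] (mod 8) \<or> [j = -1] (mod 8)"
proof -
  have ak: "a [^] ((2::nat) ^ k) = \<one>" using pow_ord_eq_1[OF a(1)] a(2) by simp
  have n3: "3 \<notin> real_class_exps a"
    unfolding real_class_exps_iff[OF a(1)] using bad int_pow_int[of G a 3] by simp
  have "k \<ge> 3"
  proof (rule ccontr)
    assume "\<not> k \<ge> 3"
    then have "(2::nat) ^ k dvd 2 ^ 2" by (intro le_imp_power_dvd) simp
    then have "int (2 ^ k) dvd int (2 ^ 2)" unfolding of_nat_dvd_iff .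
    then have "[-1 = 3] (mod int (2 ^ k))" by (simp add: cong_iff_dvd_diff)
    moreover have "-1 \<in> real_class_exps a" using class_exps_one[OF a(1)] unfolding real_class_exps_def by simp
    ultimately show False using n3 real_class_exps_cong[OF a(1) ak] by blast
  qed
  then have "(2::nat) ^ 3 dvd 2 ^ k" by (rule le_imp_power_dvd)
  then show "8 dvd ord a" using a(2) by simp
  show "[j = 1] (mod 8) \<or> [j = -1] (mod 8)" if j: "j \<in> class_exps a" for j
  proof (rule ccontr)
    assume n: "\<not> ?thesis"
    have two: "prime (2::nat)" by simp
    have "odd j" using class_exps_coprime[OF two a(1) _ j, of "k - 1"] a(2) \<open>k \<ge> 3\<close> by simp
    then have "\<exists>q. j = 8 * q + 1 \<or> j = 8 * q + 3 \<or> j = 8 * q + 5 \<or> j = 8 * q + 7" by presburger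
    then obtain q where "j = 8 * q + 1 \<or> j = 8 * q + 3 \<or> j = 8 * q + 5 \<or> j = 8 * q + 7" by blast
    with n have q: "j = 8 * q + 3 \<or> j = 8 * q + 5" by (auto simp: cong_iff_dvd_diff)
    define h where "h = (if j = 8 * q + 5 then j else - j)"
    have hK: "h \<in> real_class_exps a" using j unfolding h_def real_class_exps_def by auto
    have h: "h = 8 * q + 5 \<or> h = 8 * (- q - 1) + 5" using q by (auto simp: h_def)
    have h4: "[h = 1] (mod 4)"
      unfolding cong_iff_dvd_diff using h by (auto intro: dvdI[of _ _ "2 * q + 1"] dvdI[of _ _ "2 * (- q - 1) + 1"])
    have h8: "\<not> [h = 1] (mod 2 * 4)" using h unfolding cong_iff_dvd_diff by presburger
    have "-3 \<in> real_class_exps a"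
      by (rule principal_units_in_class_exps[where p = 2 and k = k, OF a(1) _ _ _ hK h4 h8])
        (simp_all add: ak cong_def)
    then show False using n3 unfolding real_class_exps_def by auto
  qed
qed

text \<open>If the order divided 3, then -2 would act as 1. An exponent prime to 3 other than 1 and
  -1 modulo 9 has a square that is 1 modulo 3 but not modulo 9, and this square would generate
  -2.\<close>

lemma class_exps_bad_3:
  assumes a: "a \<in> carrier G" "ord a = 3 ^ k"
    and bad: "\<not> conjugate G (a [^] (2::nat)) (inv a)"
  shows "9 dvd ord a" "\<And>j. j \<in> class_exps a \<Longrightarrow> [j = 1] (mod 9) \<or> [j = -1] (mod 9)"
proof -
  have ak: "a [^] ((3::nat) ^ k) = \<one>" using pow_ord_eq_1[OF a(1)] a(2) by simp
  have n2: "-2 \<notin> class_exps a"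
  proof
    assume "-2 \<in> class_exps a"
    then have "conjugate G (a [^] (-2::int)) a" by (simp add: class_exps_def)
    then have "conjugate G (inv (a [^] (-2::int))) (inv a)" using a(1) by (intro conjugate_inv) auto
    moreover have "inv (a [^] (-2::int)) = a [^] (2::nat)"
      using int_pow_neg[OF a(1), of 2] int_pow_int[of G a 2] a(1) by simp
    ultimately show False using bad by simp
  qed
  have "k \<ge> 2"
  proof (rule ccontr)
    assume "\<not> k \<ge> 2"
    then have "(3::nat) ^ k dvd 3 ^ 1" by (intro le_imp_power_dvd) simp
    then have "int (3 ^ k) dvd int (3 ^ 1)" unfolding of_nat_dvd_iff .
    then have "[1 = -2] (mod int (3 ^ k))" by (simp add: cong_iff_dvd_diff)
    then show False using n2 class_exps_cong[OF a(1) ak] class_exps_one[OF a(1)] by blast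
  qed
  then have "(3::nat) ^ 2 dvd 3 ^ k" by (rule le_imp_power_dvd)
  then show "9 dvd ord a" using a(2) by simp
  show "[j = 1] (mod 9) \<or> [j = -1] (mod 9)" if j: "j \<in> class_exps a" for j
  proof (rule ccontr)
    assume n: "\<not> ?thesis"
    have three: "prime (3::nat)" by simp
    have "\<not> 3 dvd j" using class_exps_coprime[OF three a(1) _ j, of "k - 1"] a(2) \<open>k \<ge> 2\<close>
      by (simp add: power_Suc[symmetric] del: power_Suc)
    moreover have "\<exists>q r. j = 9 * q + r \<and> r \<in> {0..8}"
      by (intro exI[of _ "j div 9"] exI[of _ "j mod 9"]) auto
    then obtain q r where r: "j = 9 * q + r" "r \<in> {0..8}" by blast
    have "r \<in> {0,1,2,3,4,5,6,7,8}" using r(2) by auto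
    ultimately have "r \<in> {2,4,5,7}" using n r(1) by (auto simp: cong_iff_dvd_diff)
    \<comment> \<open>Modulo 9 the squares of 2, 4, 5, 7 are 4, 7, 7, 4.\<close>
    then have "\<exists>s. (s = 4 \<or> s = 7) \<and> 9 dvd r * r - s" by auto
    then obtain s where s: "s = 4 \<or> s = 7" "9 dvd r * r - s" by blast
    have "9 dvd j * j - s"
    proof -
      have "j * j - s = 9 * (9 * q * q + 2 * q * r) + (r * r - s)" unfolding r(1) by (simp add: algebra_simps)
      then show ?thesis using s(2) by (metis dvd_add dvd_triv_left)
    qed
    then obtain t where t: "j * j = 9 * t + s" by (metis dvdE diff_eq_eq)
    have h3: "[j * j = 1] (mod 3)"
      unfolding cong_iff_dvd_diff t using s(1) by presburger
    have h9: "\<not> [j * j = 1] (mod 3 * 3)"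
      unfolding cong_iff_dvd_diff t using s(1) by presburger
    have "-2 \<in> class_exps a"
      by (rule principal_units_in_class_exps[where p = 3 and k = k,
            OF a(1) _ _ _ class_exps_mult[OF a(1) j j] h3 h9])
        (simp_all add: ak cong_def)
    then show False using n2 by simp
  qed
qed

text \<open>Iterating the conjugation by an element of order \<open>p ^ k\<close> shows that
  \<open>j ^ (p ^ k)\<close> is 1 modulo \<open>p\<close>, and Fermat's theorem reduces this power
  to \<open>j\<close>.\<close>

lemma class_exps_prime_order:
  assumes p: "prime p" and pG: "p_group p G" and a: "a \<in> carrier G" "ord a = p" and j: "j \<in> class_exps a"
  shows "[j = 1] (mod int p)"
proof -
  obtain x where x: "x \<in> carrier G" "a = inv x \<otimes> a [^] j \<otimes> x"
    using j by (auto simp: class_exps_def conjugate_def)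
  have "\<exists>k. ord x = p ^ k" using pG x(1) by (simp add: p_group_def)
  then obtain k where k: "ord x = p ^ k" by blast
  have iter: "a = inv (x [^] l) \<otimes> a [^] (j ^ l) \<otimes> x [^] l" for l :: nat
  proof (induction l)
    case (Suc l)
    have "a = inv x \<otimes> (inv (x [^] l) \<otimes> a [^] (j ^ l) \<otimes> x [^] l) [^] j \<otimes> x"
      using x(2) unfolding Suc[symmetric] .
    also have "\<dots> = inv x \<otimes> (inv (x [^] l) \<otimes> a [^] (j ^ Suc l) \<otimes> x [^] l) \<otimes> x"
      using x(1) a(1) by (simp add: int_pow_conjugate int_pow_pow mult.commute)
    also have "\<dots> = inv (x [^] Suc l) \<otimes> a [^] (j ^ Suc l) \<otimes> x [^] Suc l"
      using x(1) a(1) by (simp add: inv_mult_group m_assoc)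
    finally show ?case .
  qed (use a(1) in simp)
  have x1: "x [^] (p ^ k) = \<one>" using pow_ord_eq_1[OF x(1)] k by simp
  have "a [^] (j ^ (p ^ k)) = inv (x [^] (p ^ k)) \<otimes> a [^] (j ^ (p ^ k)) \<otimes> x [^] (p ^ k)"
    unfolding x1 using a(1) by simp
  also have "\<dots> = a [^] (1::int)" using iter[of "p ^ k", symmetric] a(1) by simp
  finally have "a [^] (j ^ (p ^ k)) = a [^] (1::int)" .
  then have jp: "[j ^ (p ^ k) = 1] (mod int p)"
    unfolding int_pow_eq[OF a(1)] a(2) cong_iff_dvd_diff by (simp only: dvd_diff_commute)
  define b where "b = nat (j mod int p)"
  have bj: "[int b = j] (mod int p)" using prime_gt_0_nat[OF p] by (simp add: b_def cong_def)
  have fermat: "[b ^ p = b] (mod p)"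
  proof (cases "p dvd b")
    case True
    then have "p dvd b ^ p" using prime_gt_0_nat[OF p] by (simp add: dvd_power_le dvd_trans[OF True])
    then show ?thesis using True by (simp add: cong_def mod_eq_0_iff_dvd)
  next
    case False
    then have "[b * b ^ (p - 1) = b * 1] (mod p)" using fermat_theorem[OF p False] cong_scalar_left by blast
    then show ?thesis using prime_gt_0_nat[OF p] power_Suc[of b "p - 1"] by simp
  qed
  have "[b ^ (p ^ k) = b] (mod p)"
  proof (induction k)
    case (Suc k)
    have "[(b ^ (p ^ k)) ^ p = b ^ p] (mod p)" using cong_pow[OF Suc] .
    then show ?case using fermat cong_trans by (simp add: power_mult[symmetric] mult.commute)
  qed simp
  then have "[int b ^ (p ^ k) = int b] (mod int p)" by (metis cong_int_iff of_nat_power)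
  then have "[j ^ (p ^ k) = j] (mod int p)"
    using cong_pow[OF bj, of "p ^ k"] bj by (meson cong_sym cong_trans)
  then show ?thesis using jp by (meson cong_sym cong_trans)
qed

end

subsection \<open>Subgroups of finite index in p-groups\<close>

text \<open>Another prime divisor \<open>r\<close> of the order would give a subgroup of order
  \<open>r\<close> by Sylow's theorem, hence an element of order \<open>r\<close>, but element
  orders divide powers of \<open>p\<close>.\<close>

lemma order_of_finite_p_group:
  assumes P: "group P" "finite (carrier P)" and p: "prime p"
    and el: "\<And>x. x \<in> carrier P \<Longrightarrow> \<exists>k. x [^]\<^bsub>P\<^esub> (p ^ k :: nat) = \<one>\<^bsub>P\<^esub>"
  shows "\<exists>n. card (carrier P) = p ^ n"
proof -
  interpret group P by fact
  have c0: "card (carrier P) \<noteq> 0" using P(2) one_closed by auto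
  have "r = p" if r: "prime r" "r dvd card (carrier P)" for r
  proof -
    obtain m where m: "Coset.order P = r ^ 1 * m" using r(2) by (auto simp: Coset.order_def)
    obtain H where H: "subgroup H P" "card H = r ^ 1"
      using sylow_thm[OF r(1) P(1) m P(2)] by blast
    have "H \<noteq> {\<one>\<^bsub>P\<^esub>}" using H(2) prime_gt_1_nat[OF r(1)] by auto
    then obtain x where x: "x \<in> H" "x \<noteq> \<one>\<^bsub>P\<^esub>" using subgroup.one_closed[OF H(1)] by blast
    have xc: "x \<in> carrier P" using x H subgroup.subset by blast
    interpret H: group "P\<lparr>carrier := H\<rparr>" using subgroup.subgroup_is_group[OF H(1) P(1)] .
    have "x [^]\<^bsub>P\<lparr>carrier := H\<rparr>\<^esub> Coset.order (P\<lparr>carrier := H\<rparr>) = \<one>\<^bsub>P\<lparr>carrier := H\<rparr>\<^esub>"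
      using x by (intro H.pow_order_eq_1) simp
    then have "x [^]\<^bsub>P\<^esub> r = \<one>\<^bsub>P\<^esub>" using H(2) by (simp add: Coset.order_def nat_pow_consistent[symmetric])
    then have "ord x dvd r" using xc by (simp add: pow_eq_id)
    then have "ord x = r" using r(1) x(2) ord_eq_1[OF xc] by (metis One_nat_def prime_nat_iff)
    moreover obtain k where "x [^]\<^bsub>P\<^esub> (p ^ k) = \<one>\<^bsub>P\<^esub>" using el[OF xc] by blast
    ultimately have "r dvd p ^ k" using xc by (simp add: pow_eq_id)
    then have "r dvd p" using r(1) prime_dvd_power by blast
    then show "r = p" using r(1) p primes_dvd_imp_eq by blast
  qed
  then have "prime_factors (card (carrier P)) \<subseteq> {p}" by (auto simp: prime_factors_dvd)
  then have "card (carrier P) = p ^ multiplicity p (card (carrier P)) \<or> card (carrier P) = p ^ 0"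
    using c0 prime_factorization_nat[of "card (carrier P)"]
    by (cases "prime_factors (card (carrier P)) = {}") (auto dest: subset_singletonD)
  then show ?thesis by blast
qed

context group
begin

text \<open>The inverse converts right multiplication of right cosets into a homomorphism to
  \<open>BijGroup\<close>.\<close>

lemma coset_action: "subgroup D G \<Longrightarrow> group_action G (rcosets D) (\<lambda>g. \<lambda>U\<in>rcosets D. U #> inv g)"
proof -
  assume D: "subgroup D G"
  define E where "E = rcosets D"
  define \<phi> where "\<phi> = (\<lambda>g. \<lambda>U\<in>E. U #> inv g)"
  have Dc: "D \<subseteq> carrier G" using D subgroup.subset by blast
  have closed: "U #> x \<in> E" if "U \<in> E" "x \<in> carrier G" for U x
    using that Dc by (auto simp: E_def RCOSETS_def coset_mult_assoc)
  have sub: "U \<subseteq> carrier G" if "U \<in> E" for U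
    using that Dc r_coset_subset_G by (auto simp: E_def RCOSETS_def)
  have bij: "\<phi> g \<in> Bij E" if g: "g \<in> carrier G" for g
  proof -
    have "bij_betw (\<lambda>U. U #> inv g) E E"
      by (rule bij_betw_byWitness[where f' = "\<lambda>U. U #> g"])
        (use g closed sub in \<open>auto simp: coset_mult_assoc\<close>)
    then have "bij_betw (\<phi> g) E E" by (subst bij_betw_cong[of E _ "\<lambda>U. U #> inv g"]) (auto simp: \<phi>_def)
    then show ?thesis by (simp add: Bij_def \<phi>_def)
  qed
  have "\<phi> \<in> hom G (BijGroup E)"
  proof (rule homI)
    show "\<phi> g \<in> carrier (BijGroup E)" if "g \<in> carrier G" for g using bij[OF that] by (simp add: BijGroup_def)
    show "\<phi> (g \<otimes> h) = \<phi> g \<otimes>\<^bsub>BijGroup E\<^esub> \<phi> h" if gh: "g \<in> carrier G" "h \<in> carrier G" for g h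
      using gh bij closed sub
      by (auto simp: BijGroup_def \<phi>_def compose_def coset_mult_assoc inv_mult_group intro!: restrict_ext)
  qed
  then have "group_hom G (BijGroup E) \<phi>"
    using group_BijGroup is_group by (simp add: group_hom_def group_hom_axioms_def)
  then show ?thesis unfolding group_action_def E_def[symmetric] \<phi>_def[symmetric] .
qed

text \<open>Count the fixed points of \<open>D\<close> on its cosets modulo \<open>p\<close>.\<close>
lemma normalizer_grows:
  assumes p: "prime p" and pG: "p_group p G" and D: "subgroup D G"
    and fin: "finite (rcosets D)" and neq: "D \<noteq> carrier G"
  obtains g where "g \<in> carrier G" "g \<notin> D" "\<And>d. d \<in> D \<Longrightarrow> inv g \<otimes> d \<otimes> g \<in> D"
proof -
  define E where "E = rcosets D"
  define \<phi> where "\<phi> = (\<lambda>g. \<lambda>U\<in>E. U #> inv g)"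
  interpret act: group_action G E \<phi>
    using coset_action[OF D] unfolding E_def \<phi>_def .
  interpret hom: group_hom G "BijGroup E" \<phi> using act.group_hom .
  have Dc: "D \<subseteq> carrier G" using D subgroup.subset by blast
  have finE: "finite E" using fin by (simp add: E_def)
  have DE: "D \<in> E" using subgroup.subgroup_in_rcosets[OF D is_group] by (simp add: E_def)
  have "Bij E \<subseteq> E \<rightarrow>\<^sub>E E" by (auto simp: Bij_def PiE_def bij_betw_def)
  then have finBij: "finite (carrier (BijGroup E))"
    using finE finite_PiE[of E "\<lambda>_. E"] finite_subset by (auto simp: BijGroup_def)
  \<comment> \<open>\<open>G\<close> may be infinite, so subgroups are replaced by their images
    among the permutations of the finitely many cosets; these are finite groups of
    \<open>p\<close>-power order.\<close>
  have ppow: "\<exists>n. card (\<phi> ` H) = p ^ n" and act': "group_action (BijGroup E\<lparr>carrier := \<phi> ` H\<rparr>) E (\<lambda>f. f)"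
    if H: "subgroup H G" for H
  proof -
    have Hc: "H \<subseteq> carrier G" using H subgroup.subset by blast
    have sg: "subgroup (\<phi> ` H) (BijGroup E)" using hom.subgroup_img_is_subgroup[OF H] .
    interpret I: group "BijGroup E\<lparr>carrier := \<phi> ` H\<rparr>"
      using subgroup.subgroup_is_group[OF sg group_BijGroup] .
    have imgc: "\<phi> ` H \<subseteq> carrier (BijGroup E)" using sg subgroup.subset by blast
    have "\<exists>n. card (carrier (BijGroup E\<lparr>carrier := \<phi> ` H\<rparr>)) = p ^ n"
    proof (rule order_of_finite_p_group[OF I.is_group _ p])
      show "finite (carrier (BijGroup E\<lparr>carrier := \<phi> ` H\<rparr>))"
        using finBij imgc finite_subset by auto
      fix x assume "x \<in> carrier (BijGroup E\<lparr>carrier := \<phi> ` H\<rparr>)"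
      then obtain h where h: "h \<in> H" "x = \<phi> h" by auto
      obtain k where "ord h = p ^ k" using pG h Hc by (auto simp: p_group_def)
      then have "h [^] (p ^ k) = \<one>" using pow_ord_eq_1[of h] h Hc by auto
      then have "x [^]\<^bsub>BijGroup E\<^esub> (p ^ k) = \<one>\<^bsub>BijGroup E\<^esub>"
        using h Hc hom.hom_nat_pow[of h "p ^ k"] by auto
      then show "\<exists>k. x [^]\<^bsub>BijGroup E\<lparr>carrier := \<phi> ` H\<rparr>\<^esub> (p ^ k :: nat) = \<one>\<^bsub>BijGroup E\<lparr>carrier := \<phi> ` H\<rparr>\<^esub>"
        using nat_pow_consistent by (intro exI[of _ k]) (simp add: nat_pow_def)
    qed
    then show "\<exists>n. card (\<phi> ` H) = p ^ n" by simp
    show "group_action (BijGroup E\<lparr>carrier := \<phi> ` H\<rparr>) E (\<lambda>f. f)"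
      using imgc I.is_group group_BijGroup
      by (auto simp: group_action_def group_hom_def group_hom_axioms_def hom_def)
  qed
  interpret whole: group_action "BijGroup E\<lparr>carrier := \<phi> ` carrier G\<rparr>" E "\<lambda>f. f"
    using act'[OF subgroup_self] .
  interpret Dact: group_action "BijGroup E\<lparr>carrier := \<phi> ` D\<rparr>" E "\<lambda>f. f"
    using act'[OF D] .
  have orbD: "orbit (BijGroup E\<lparr>carrier := \<phi> ` carrier G\<rparr>) (\<lambda>f. f) D = E"
  proof -
    have "orbit (BijGroup E\<lparr>carrier := \<phi> ` carrier G\<rparr>) (\<lambda>f. f) D = (\<lambda>g. \<phi> g D) ` carrier G"
      by (auto simp: orbit_def)
    also have "\<dots> = {D #> inv g | g. g \<in> carrier G}" using DE by (auto simp: \<phi>_def)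
    also have "\<dots> = E" unfolding E_def RCOSETS_def by (auto; metis inv_closed inv_inv)
    finally show ?thesis .
  qed
  have dvd_pow: "\<exists>e. n = p ^ e" if "n dvd p ^ m" for n m
    using that p divides_primepow_nat by blast
  obtain e where e: "card E = p ^ e"
  proof -
    obtain n where "card (\<phi> ` carrier G) = p ^ n" using ppow[OF subgroup_self] by blast
    then have "card E dvd p ^ n"
      using whole.orbit_stabilizer_theorem[OF DE] by (simp add: orbD Coset.order_def) (metis dvd_triv_left)
    then show ?thesis using dvd_pow that by blast
  qed
  have "card E \<noteq> 1"
  proof
    assume "card E = 1"
    then have "E = {D}" using DE by (auto simp: card_1_singleton_iff)
    then have "D #> x = D" if "x \<in> carrier G" for x
      using that Dc rcosetsI[of D x] by (auto simp: E_def)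
    then have "carrier G \<subseteq> D" using D coset_join1 by blast
    then show False using neq Dc by blast
  qed
  then have pE: "p dvd card E" using e by (cases e) auto
  define orb where "orb = orbit (BijGroup E\<lparr>carrier := \<phi> ` D\<rparr>) (\<lambda>f. f)"
  have orb_mem: "orb U = {U #> inv d | d. d \<in> D}" if "U \<in> E" for U
  proof -
    have "orb U = (\<lambda>d. \<phi> d U) ` D" by (auto simp: orb_def orbit_def)
    then show ?thesis using that by (auto simp: \<phi>_def)
  qed
  \<comment> \<open>Otherwise \<open>D\<close> is the only fixed point, all other orbits have size
    divisible by \<open>p\<close>, and \<open>card E\<close> is 1 modulo \<open>p\<close>.\<close>
  have "\<exists>U\<in>E. U \<noteq> D \<and> orb U = {U}"
  proof (rule ccontr)
    assume no: "\<not> ?thesis"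
    define Orb where "Orb = orbits (BijGroup E\<lparr>carrier := \<phi> ` D\<rparr>) E (\<lambda>f. f)"
    have O: "Orb = orb ` E" by (auto simp: Orb_def orbits_def orb_def)
    have D_orb: "orb D = {D}"
    proof -
      have "D #> inv d = D" if "d \<in> D" for d
        using coset_join2[OF _ D subgroup.m_inv_closed[OF D that]] that Dc by blast
      then show ?thesis using orb_mem[OF DE] subgroup.one_closed[OF D] by auto
    qed
    have finO: "finite Orb" using finE by (simp add: O)
    have "card E = (\<Sum>A\<in>Orb. card A)"
      using Dact.disjoint_sum[OF finE, of "\<lambda>_. 1::nat"] by (simp add: Orb_def)
    also have "\<dots> = card {D} + (\<Sum>A\<in>Orb - {{D}}. card A)"
      using finO DE D_orb O by (subst sum.remove[of Orb "{D}"]) auto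
    finally have cE: "card E = 1 + (\<Sum>A\<in>Orb - {{D}}. card A)" by simp
    have "p dvd (\<Sum>A\<in>Orb - {{D}}. card A)"
    proof (rule dvd_sum)
      fix A assume A: "A \<in> Orb - {{D}}"
      then obtain U where U: "U \<in> E" "A = orb U" by (auto simp: O)
      obtain n where "card (\<phi> ` D) = p ^ n" using ppow[OF D] by blast
      then have "card A dvd p ^ n"
        using Dact.orbit_stabilizer_theorem[OF U(1)] by (simp add: U(2) orb_def Coset.order_def) (metis dvd_triv_left)
      then obtain c where c: "card A = p ^ c" using dvd_pow by blast
      show "p dvd card A"
      proof (cases c)
        case 0
        have "U \<in> A" using U Dact.orbit_refl by (simp add: orb_def)
        then have "A = {U}" using c 0 by (auto simp: card_1_singleton_iff)
        then have False using no U A D_orb by auto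
        then show ?thesis ..
      qed (use c in simp)
    qed
    then have "p dvd 1"
      using pE dvd_add_left_iff[of p "\<Sum>A\<in>Orb - {{D}}. card A" 1] unfolding cE by blast
    then show False using prime_gt_1_nat[OF p] by simp
  qed
  then obtain U where U: "U \<in> E" "U \<noteq> D" "orb U = {U}" by blast
  then obtain x where x: "x \<in> carrier G" "U = D #> x" by (auto simp: E_def RCOSETS_def)
  show ?thesis
  \<comment> \<open>That \<open>D\<close> fixes the coset of \<open>x\<close> means that
    \<open>x \<otimes> d \<otimes> inv x\<close> stays in \<open>D\<close>, so the normalizing
    element is the inverse.\<close>
  proof (rule that[of "inv x"])
    show "inv x \<in> carrier G" using x by simp
    show "inv x \<notin> D"
    proof
      assume "inv x \<in> D"
      then have "x \<in> D" using x(1) subgroup.m_inv_closed[OF D, of "inv x"] by simp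
      then show False using U(2) x(2) coset_join2[OF x(1) D] by simp
    qed
    fix d assume d: "d \<in> D"
    have "inv d \<in> D" using subgroup.m_inv_closed[OF D d] .
    then have "U #> inv (inv d) \<in> orb U" unfolding orb_mem[OF U(1)] by (intro CollectI exI[of _ "inv d"] conjI refl)
    then have "D #> x #> d = D #> x" 
    proof -
      have "inv (inv d) = d" using d Dc by (simp add: subset_iff)
      moreover have "U #> inv (inv d) = U" using \<open>U #> inv (inv d) \<in> orb U\<close> unfolding U(3) by blast
      ultimately show ?thesis unfolding x(2) by simp
    qed
    then have "D #> (x \<otimes> d) = D #> x" using coset_mult_assoc[OF Dc x(1), of d] d Dc by (simp add: subset_iff)
    moreover have dc: "d \<in> carrier G" using d Dc by blast
    ultimately have "D #> (x \<otimes> d \<otimes> inv x) = D"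
      using coset_mult_inv2[of D "x \<otimes> d" x] x(1) Dc by simp
    then have "x \<otimes> d \<otimes> inv x \<in> D" using coset_join1[OF _ _ D] x(1) dc by simp
    then show "inv (inv x) \<otimes> d \<otimes> inv x \<in> D" using x by simp
  qed
qed

text \<open>Take iterated \<open>p\<close>-th powers of a normalizing element up to the last one
  outside \<open>D\<close>. As the element has finite order, inverses of its powers are powers as
  well, which turns the one-sided inclusion into both.\<close>

lemma normalizing_element_order_p:
  assumes p: "prime p" and pG: "p_group p G" and D: "subgroup D G"
    and fin: "finite (rcosets D)" and neq: "D \<noteq> carrier G"
  obtains g where "g \<in> carrier G" "g \<notin> D" "g [^] p \<in> D"
    "\<And>d. d \<in> D \<Longrightarrow> inv g \<otimes> d \<otimes> g \<in> D" "\<And>d. d \<in> D \<Longrightarrow> g \<otimes> d \<otimes> inv g \<in> D"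
proof -
  obtain g where g: "g \<in> carrier G" "g \<notin> D" and norm: "\<And>d. d \<in> D \<Longrightarrow> inv g \<otimes> d \<otimes> g \<in> D"
    using normalizer_grows[OF assms] by blast
  have Dc: "D \<subseteq> carrier G" using D subgroup.subset by blast
  have normk: "inv (g [^] k) \<otimes> d \<otimes> g [^] k \<in> D" if "d \<in> D" for d and k :: nat
  proof (induction k)
    case 0
    then show ?case using that Dc by auto
  next
    case (Suc k)
    have "inv (g [^] Suc k) \<otimes> d \<otimes> g [^] Suc k = inv g \<otimes> (inv (g [^] k) \<otimes> d \<otimes> g [^] k) \<otimes> g"
      using g that Dc by (auto simp: inv_mult_group m_assoc)
    then show ?case using norm[OF Suc] by simp
  qed
  obtain k where k: "ord g = p ^ k" using pG g by (auto simp: p_group_def)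
  have inv_pow: "inv (g [^] l) = g [^] (l * (p ^ k - 1))" for l :: nat
  proof -
    have "l * (p ^ k - 1) + l = p ^ k * l"
      using prime_gt_0_nat[OF p] by (cases "p ^ k") auto
    then have "g [^] (l * (p ^ k - 1)) \<otimes> g [^] l = g [^] (p ^ k * l)"
      using nat_pow_mult[OF g(1), of "l * (p ^ k - 1)" l] by simp
    also have "\<dots> = \<one>"
      using g pow_ord_eq_1[OF g(1)] k by (simp add: nat_pow_pow[symmetric])
    finally have "g [^] (l * (p ^ k - 1)) \<otimes> g [^] l = \<one>" .
    then show ?thesis using g by (simp add: inv_equality)
  qed
  have "g [^] (p ^ k) \<in> D" using k pow_ord_eq_1[OF g(1)] subgroup.one_closed[OF D] by simp
  moreover have "g [^] (p ^ 0) \<notin> D" using g by simp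
  ultimately obtain i where i: "g [^] (p ^ i) \<notin> D" "g [^] (p ^ Suc i) \<in> D"
    using dec_induct[of 0 k "\<lambda>i. g [^] (p ^ i) \<notin> D"] by blast
  show ?thesis
  proof (rule that[of "g [^] (p ^ i)"])
    show "(g [^] (p ^ i)) [^] p \<in> D" using i(2) g by (simp add: nat_pow_pow mult.commute)
    show "g [^] (p ^ i) \<otimes> d \<otimes> inv (g [^] (p ^ i)) \<in> D" if d: "d \<in> D" for d
      using normk[OF d, of "p ^ i * (p ^ k - 1)"] g unfolding inv_pow[symmetric] by simp
  qed (use g i normk in auto)
qed

end

subsection \<open>Central units from units of cyclic subgroups\<close>

context group
begin

text \<open>The coefficients on \<open>S\<close> are added by pushing forward to a one-point set,
  which is additive for every \<open>S\<close>, finite or not.\<close>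

definition class_sum :: "'a set \<Rightarrow> ('a \<Rightarrow>\<^sub>0 int) \<Rightarrow> int" where
  "class_sum S x = coeff_at (frag_extend (\<lambda>g. if g \<in> S then frag_of () else 0) x) ()"

lemma class_sum_add: "class_sum S (x + y) = class_sum S x + class_sum S y"
  by (simp add: class_sum_def frag_extend_add lookup_add)

lemma class_sum_diff: "class_sum S (x - y) = class_sum S x - class_sum S y"
  by (simp add: class_sum_def frag_extend_diff lookup_minus)

lemma class_sum_cmul: "class_sum S (frag_cmul c x) = c * class_sum S x"
  by (simp add: class_sum_def frag_extend_cmul)

lemma class_sum_zero [simp]: "class_sum S 0 = 0"
  by (simp add: class_sum_def)

lemma class_sum_frag_of: "class_sum S (frag_of g) = (if g \<in> S then 1 else 0)"
  by (simp add: class_sum_def)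

lemma class_sum_cj:
  assumes S: "S \<subseteq> carrier G" "\<And>x g. x \<in> carrier G \<Longrightarrow> g \<in> S \<Longrightarrow> inv x \<otimes> g \<otimes> x \<in> S"
    and x: "x \<in> carrier G" and f: "supp f \<subseteq> carrier G"
  shows "class_sum S (cj x f) = class_sum S f"
  using f
proof (induction f rule: frag_induction)
  case (one g)
  have "x \<otimes> (inv x \<otimes> g \<otimes> x) \<otimes> inv x = g"
    using x one by (simp add: m_assoc) (simp add: m_assoc[symmetric])
  then have "inv x \<otimes> g \<otimes> x \<in> S \<longleftrightarrow> g \<in> S"
    using S(2)[of "inv x" "inv x \<otimes> g \<otimes> x"] S(2)[of x g] x by auto
  then show ?case unfolding cj_frag_of class_sum_frag_of by simp
qed (simp_all add: cj_diff class_sum_diff)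

lemma supp_cj:
  assumes x: "x \<in> carrier G" and f: "supp f \<subseteq> D" "D \<subseteq> carrier G" and n: "\<And>d. d \<in> D \<Longrightarrow> inv x \<otimes> d \<otimes> x \<in> D"
  shows "supp (cj x f) \<subseteq> D"
proof
  fix h assume h: "h \<in> supp (cj x f)"
  have fc: "supp f \<subseteq> carrier G" using f by blast
  have hc: "h \<in> carrier G" using h supp_cj_carrier[OF x fc] by blast
  have "x \<otimes> h \<otimes> inv x \<in> supp f" using h coeff_at_cj[OF x fc hc] by (simp add: in_keys_iff)
  then have "inv x \<otimes> (x \<otimes> h \<otimes> inv x) \<otimes> x \<in> D" using f(1) n by blast
  moreover have "inv x \<otimes> (x \<otimes> h \<otimes> inv x) \<otimes> x = h"
    using x hc by (simp add: m_assoc) (simp add: m_assoc[symmetric])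
  ultimately show "h \<in> D" by simp
qed

lemma Units_gmult: "u \<in> Units ZG \<Longrightarrow> v \<in> Units ZG \<Longrightarrow> u \<star> v \<in> Units ZG"
  using monoid.Units_m_closed[OF ring.is_monoid[OF ring_ZG], of u v] by (simp add: ZG_simps)

lemma Units_supp: "u \<in> Units ZG \<Longrightarrow> supp u \<subseteq> carrier G"
  unfolding Units_ZG by blast

lemma Units_cj: "x \<in> carrier G \<Longrightarrow> u \<in> Units ZG \<Longrightarrow> cj x u \<in> Units ZG"
  unfolding cj_def by (intro Units_gmult frag_of_Units inv_closed)

lemma Units_cancel:
  assumes u: "u \<in> Units ZG" and x: "supp x \<subseteq> carrier G" and y: "supp y \<subseteq> carrier G" and eq: "u \<star> x = u \<star> y"
  shows "x = y"
proof -
  obtain v where v: "supp v \<subseteq> carrier G" "v \<star> u = frag_of \<one>" using u unfolding Units_ZG by blast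
  have "v \<star> (u \<star> x) = v \<star> (u \<star> y)" using eq by simp
  then show ?thesis using v x y Units_supp[OF u] by (simp add: gmult_assoc[symmetric] gmult_one)
qed

lemma fixer_subgroup:
  assumes v: "supp v \<subseteq> carrier G"
  shows "subgroup {x \<in> carrier G. cj x v = v} G"
proof (rule subgroupI)
  show "{x \<in> carrier G. cj x v = v} \<noteq> {}" using cj_by_one[OF v] one_closed by blast
  fix a assume "a \<in> {x \<in> carrier G. cj x v = v}"
  then have a: "a \<in> carrier G" "cj a v = v" by blast+
  show "inv a \<in> {x \<in> carrier G. cj x v = v}"
    using cj_cj[OF a(1) inv_closed[OF a(1)] v] a cj_by_one[OF v] by simp
  fix b assume "b \<in> {x \<in> carrier G. cj x v = v}"
  then have b: "b \<in> carrier G" "cj b v = v" by blast+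
  show "a \<otimes> b \<in> {x \<in> carrier G. cj x v = v}"
    using cj_cj[OF a(1) b(1) v] a b by simp
qed blast

lemma one_plus_cmul_gmult:
  assumes "supp a \<subseteq> carrier G" "supp b \<subseteq> carrier G"
  shows "(frag_of \<one> + frag_cmul Q a) \<star> (frag_of \<one> + frag_cmul Q b) =
    frag_of \<one> + frag_cmul Q (a + b + frag_cmul Q (a \<star> b))"
  using assms
  by (simp add: gmult_add_left gmult_add_right gmult_cmul_left gmult_cmul_right gmult_one
      frag_cmul_distrib2 gmult_frag_of add_ac)

lemma supp_add_cmul:
  assumes "supp a \<subseteq> D" "supp b \<subseteq> D"
  shows "supp (a + b) \<subseteq> D" "supp (frag_cmul c a) \<subseteq> D"
  using assms keys_add[of a b] keys_cmul[of c a] by blast+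

primrec cj_prod :: "'a \<Rightarrow> ('a \<Rightarrow>\<^sub>0 int) \<Rightarrow> nat \<Rightarrow> ('a \<Rightarrow>\<^sub>0 int)" where
  "cj_prod g v 0 = frag_of \<one>"
| "cj_prod g v (Suc k) = cj_prod g v k \<star> cj (g [^] k) v"

text \<open>The factors are invariant under \<open>D\<close> and supported in \<open>D\<close>, so they commute; conjugation by \<open>g\<close>
  permutes them cyclically.\<close>
lemma extend_invariant_unit:
  assumes D: "subgroup D G" and g: "g \<in> carrier G" "g [^] p \<in> D"
    and n: "\<And>d. d \<in> D \<Longrightarrow> inv g \<otimes> d \<otimes> g \<in> D" "\<And>d. d \<in> D \<Longrightarrow> g \<otimes> d \<otimes> inv g \<in> D"
    and v: "v \<in> Units ZG" "supp v \<subseteq> D" "\<And>d. d \<in> D \<Longrightarrow> cj d v = v"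
  shows "cj_prod g v p \<in> Units ZG" "supp (cj_prod g v p) \<subseteq> D"
    "\<And>d. d \<in> D \<Longrightarrow> cj d (cj_prod g v p) = cj_prod g v p" "cj g (cj_prod g v p) = cj_prod g v p"
proof -
  have Dc: "D \<subseteq> carrier G" using D subgroup.subset by blast
  have vc: "supp v \<subseteq> carrier G" using v Dc by blast
  define w where "w k = cj (g [^] k) v" for k :: nat
  have wS: "w (Suc k) = cj g (w k)" for k
    using cj_cj[of "g [^] k" g v] g vc by (simp add: w_def)
  have w0: "w 0 = v" using cj_by_one[OF vc] by (simp add: w_def)
  have wU: "w k \<in> Units ZG" for k using Units_cj v(1) g by (simp add: w_def)
  have wD: "supp (w k) \<subseteq> D" for k
  proof (induction k)
    case (Suc k)
    then show ?case unfolding wS by (intro supp_cj[OF g(1) _ Dc n(1)])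
  qed (use w0 v in simp)
  have wc: "supp (w k) \<subseteq> carrier G" for k using wD Dc by blast
  have winv: "cj d (w k) = w k" if "d \<in> D" for d k
    using that
  proof (induction k arbitrary: d)
    case 0
    then show ?case using w0 v by simp
  next
    case (Suc k)
    have dc: "d \<in> carrier G" using Suc Dc by blast
    \<comment> \<open>Invariance of the conjugate by \<open>g\<close> under \<open>d\<close> is
      invariance of the original under \<open>d'\<close>, which is in \<open>D\<close> by the second
      normalizing hypothesis.\<close>
    define d' where "d' = g \<otimes> d \<otimes> inv g"
    have d': "d' \<in> D" "d' \<in> carrier G" using n(2)[OF Suc.prems] Dc by (auto simp: d'_def)
    have "d' \<otimes> g = g \<otimes> d" using g dc by (simp add: d'_def m_assoc)
    then have "cj d (cj g (w k)) = cj g (cj d' (w k))"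
      using g dc d' wc by (simp add: cj_cj)
    then show ?case using Suc.IH[OF d'(1)] by (simp add: wS)
  qed
  define P where "P = cj_prod g v"
  have P0: "P 0 = frag_of \<one>" and PS: "P (Suc k) = P k \<star> w k" for k by (simp_all add: P_def w_def)
  have PU: "P k \<in> Units ZG" for k
    by (induction k) (simp_all add: P0 PS frag_of_Units Units_gmult wU)
  have Pc: "supp (P k) \<subseteq> carrier G" for k using Units_supp[OF PU] .
  have PD: "supp (P k) \<subseteq> D" for k
    by (induction k) (simp_all add: P0 PS subgroup.one_closed[OF D] supp_gmult[OF D] wD)
  have Pinv: "cj d (P k) = P k" if d: "d \<in> D" for d k
  proof -
    have dc: "d \<in> carrier G" using d Dc by blast
    show ?thesis by (induction k) (simp_all add: P0 PS dc cj_gmult Pc wc winv[OF d])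
  qed
  \<comment> \<open>Conjugation by \<open>g\<close> moves every factor one place on, and
    \<open>v\<close> in front restores the initial one. For \<open>k = p\<close> the new last factor
    is \<open>v\<close> again, since \<open>g [^] p\<close> fixes \<open>v\<close>.\<close>
  have shift: "v \<star> cj g (P k) = P (Suc k)" for k
  proof (induction k)
    case 0
    then show ?case using g vc by (simp add: P0 PS w0 gmult_one)
  next
    case (Suc k)
    have "v \<star> cj g (P (Suc k)) = v \<star> cj g (P k) \<star> cj g (w k)"
      using g Pc wc vc supp_cj_carrier[OF g(1)] by (simp add: PS cj_gmult gmult_assoc)
    then show ?case using Suc by (simp add: PS wS)
  qed
  have "w p = v" using v(3)[OF g(2)] by (simp add: w_def)
  then have "v \<star> cj g (P p) = P p \<star> v" using shift[of p] by (simp add: PS)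
  also have "\<dots> = v \<star> P p"
  proof (rule gmult_commute_span[OF PD, symmetric])
    fix d assume d: "d \<in> D"
    then have dc: "d \<in> carrier G" using Dc by blast
    show "v \<star> frag_of d = frag_of d \<star> v" using v(3)[OF d] unfolding cj_eq_iff_commute[OF dc vc] .
  qed
  finally have "cj g (P p) = P p" using Units_cancel[OF v(1) supp_cj_carrier[OF g(1) Pc] Pc] by blast
  then show "cj g (cj_prod g v p) = cj_prod g v p" by (simp add: P_def)
  show "cj_prod g v p \<in> Units ZG" "supp (cj_prod g v p) \<subseteq> D" using PU PD by (simp_all add: P_def)
  show "cj d (cj_prod g v p) = cj_prod g v p" if "d \<in> D" for d using Pinv[OF that] by (simp add: P_def)
qed

text \<open>Conjugates of \<open>z\<close> have equal class sums, and modulo \<open>Q\<close> class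
  sums add under products of elements 1 + Q z.\<close>

lemma cj_prod_one_plus:
  assumes S: "S \<subseteq> carrier G" "\<And>x g. x \<in> carrier G \<Longrightarrow> g \<in> S \<Longrightarrow> inv x \<otimes> g \<otimes> x \<in> S"
    and g: "g \<in> carrier G" and z: "supp z \<subseteq> carrier G" and v: "v = frag_of \<one> + frag_cmul Q z"
  shows "\<exists>z'. supp z' \<subseteq> carrier G \<and> cj_prod g v k = frag_of \<one> + frag_cmul Q z' \<and>
    [class_sum S z' = int k * class_sum S z] (mod Q)"
proof (induction k)
  case 0
  then show ?case by (intro exI[of _ 0]) simp
next
  case (Suc k)
  then obtain y where y: "supp y \<subseteq> carrier G" "cj_prod g v k = frag_of \<one> + frag_cmul Q y"
      "[class_sum S y = int k * class_sum S z] (mod Q)" by blast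
  define w where "w = cj (g [^] k) z"
  have gk: "g [^] k \<in> carrier G" using g by simp
  have w: "supp w \<subseteq> carrier G" "class_sum S w = class_sum S z"
    unfolding w_def using supp_cj_carrier[OF gk z] class_sum_cj[OF S gk z] by simp_all
  have "cj (g [^] k) v = frag_of \<one> + frag_cmul Q w"
    unfolding v w_def using gk by (simp add: cj_add cj_cmul)
  then have "cj_prod g v (Suc k) = frag_of \<one> + frag_cmul Q (y + w + frag_cmul Q (y \<star> w))"
    using y(2) one_plus_cmul_gmult[OF y(1) w(1)] by simp
  moreover have "supp (y + w + frag_cmul Q (y \<star> w)) \<subseteq> carrier G"
    using y w by (intro supp_add_cmul supp_gmult_carrier)
  moreover have "[class_sum S (y + w + frag_cmul Q (y \<star> w)) = int (Suc k) * class_sum S z] (mod Q)"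
  proof -
    have "[class_sum S y + class_sum S z + Q * class_sum S (y \<star> w) = int k * class_sum S z + class_sum S z + 0] (mod Q)"
      by (intro cong_add y(3) cong_refl) (simp add: cong_iff_dvd_diff)
    then show ?thesis by (simp add: class_sum_add class_sum_cmul w(2) algebra_simps)
  qed
  ultimately show ?case by blast
qed

text \<open>Sending the \<open>D\<close>-coset of \<open>x\<close> to its \<open>D'\<close>-coset is
  onto and identifies the distinct cosets of \<open>g\<close> and of the identity.\<close>

lemma card_rcosets_less:
  assumes D: "subgroup D G" and D': "subgroup D' G" and sub: "D \<subseteq> D'" and g: "g \<in> D'" "g \<notin> D"
    and fin: "finite (rcosets D)"
  shows "finite (rcosets D')" "card (rcosets D') < card (rcosets D)"
proof -
  define F where "F U = (\<Union>u\<in>U. D' #> u)" for U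
  have Dc: "D \<subseteq> carrier G" "D' \<subseteq> carrier G" using D D' subgroup.subset by blast+
  have F: "F (D #> x) = D' #> x" if x: "x \<in> carrier G" for x
  proof -
    have "D' #> u = D' #> x" if "u \<in> D #> x" for u
    proof -
      have "u \<in> D' #> x" using that sub by (auto simp: r_coset_def)
      then show ?thesis using repr_independence[OF _ x D'] by blast
    qed
    moreover have "x \<in> D #> x" using rcos_self[OF x D] .
    ultimately show ?thesis unfolding F_def by blast
  qed
  have im: "rcosets D' = F ` (rcosets D)"
  proof
    show "rcosets D' \<subseteq> F ` (rcosets D)"
    proof
      fix V assume "V \<in> rcosets D'"
      then obtain x where x: "x \<in> carrier G" "V = D' #> x" by (auto simp: RCOSETS_def)
      then show "V \<in> F ` (rcosets D)" using F[OF x(1)] rcosetsI[OF Dc(1) x(1)] by blast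
    qed
    show "F ` (rcosets D) \<subseteq> rcosets D'" using F rcosetsI[OF Dc(2)] by (auto simp: RCOSETS_def)
  qed
  then show "finite (rcosets D')" using fin by simp
  have gc: "g \<in> carrier G" using g Dc by blast
  have "\<not> inj_on F (rcosets D)"
  proof
    assume inj: "inj_on F (rcosets D)"
    have "F (D #> g) = F (D #> \<one>)"
      using F[OF gc] F[OF one_closed] coset_join2[OF gc D' g(1)] coset_mult_one[OF Dc(2)] by simp
    then have "D #> g = D #> \<one>"
      using inj rcosetsI[OF Dc(1) gc] rcosetsI[OF Dc(1) one_closed] by (auto dest: inj_onD)
    then have "D #> g = D" using coset_mult_one[OF Dc(1)] by simp
    then show False using coset_join1[OF _ gc D] g(2) by blast
  qed
  then have "card (F ` (rcosets D)) \<noteq> card (rcosets D)" using fin eq_card_imp_inj_on by blast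
  then show "card (rcosets D') < card (rcosets D)"
    using card_image_le[OF fin, of F] im by simp
qed

text \<open>Each step enlarges the group fixing the unit from \<open>D\<close> to the subgroup
  generated by \<open>D\<close> and \<open>g\<close>, at the price of a factor \<open>p\<close> on
  the class sum; the number of cosets drops until \<open>D\<close> is all of
  \<open>G\<close>.\<close>

lemma central_unit_over_finite_index:
  assumes p: "prime p" and pG: "p_group p G"
    and S: "S \<subseteq> carrier G" "\<And>x g. x \<in> carrier G \<Longrightarrow> g \<in> S \<Longrightarrow> inv x \<otimes> g \<otimes> x \<in> S"
  shows "subgroup D G \<Longrightarrow> finite (rcosets D) \<Longrightarrow> v \<in> Units ZG \<Longrightarrow> supp v \<subseteq> D \<Longrightarrow>
    (\<And>d. d \<in> D \<Longrightarrow> cj d v = v) \<Longrightarrow> supp z \<subseteq> carrier G \<Longrightarrow> v = frag_of \<one> + frag_cmul Q z \<Longrightarrow>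
    \<exists>u y m. u \<in> Units ZG \<and> (\<forall>x\<in>carrier G. cj x u = u) \<and> supp y \<subseteq> carrier G \<and>
      u = frag_of \<one> + frag_cmul Q y \<and> [class_sum S y = int p ^ m * class_sum S z] (mod Q)"
proof (induction "card (rcosets D)" arbitrary: D v z rule: less_induct)
  case less
  note D = less.prems(1)
  show ?case
  proof (cases "D = carrier G")
    case True
    then show ?thesis using less.prems
      by (intro exI[of _ v] exI[of _ z] exI[of _ 0]) simp
  next
    case False
    obtain g where g: "g \<in> carrier G" "g \<notin> D" "g [^] p \<in> D"
      and n: "\<And>d. d \<in> D \<Longrightarrow> inv g \<otimes> d \<otimes> g \<in> D" "\<And>d. d \<in> D \<Longrightarrow> g \<otimes> d \<otimes> inv g \<in> D"
      using normalizing_element_order_p[OF p pG D less.prems(2) False] by blast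
    have Dc: "D \<subseteq> carrier G" using D subgroup.subset by blast
    define D' where "D' = generate G (insert g D)"
    have inc: "insert g D \<subseteq> carrier G" using g Dc by blast
    have D': "subgroup D' G" unfolding D'_def using generate_is_subgroup[OF inc] .
    have sub: "insert g D \<subseteq> D'" unfolding D'_def by (auto intro: generate.incl)
    define u where "u = cj_prod g v p"
    note ext = extend_invariant_unit[OF D g(1,3) n less.prems(3,4,5)]
    have u: "u \<in> Units ZG" "supp u \<subseteq> D" "\<And>d. d \<in> D \<Longrightarrow> cj d u = u" "cj g u = u"
      unfolding u_def using ext by blast+
    have "D' \<subseteq> {x \<in> carrier G. cj x u = u}"
      unfolding D'_def
    proof (rule generate_subgroup_incl[OF _ fixer_subgroup[OF Units_supp[OF u(1)]]])
      show "insert g D \<subseteq> {x \<in> carrier G. cj x u = u}" using u(3,4) inc by blast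
    qed
    then have uD': "\<And>d. d \<in> D' \<Longrightarrow> cj d u = u" by blast
    obtain y where y: "supp y \<subseteq> carrier G" "u = frag_of \<one> + frag_cmul Q y"
      "[class_sum S y = int p * class_sum S z] (mod Q)"
      unfolding u_def using cj_prod_one_plus[OF S g(1) less.prems(6,7), of p] by blast
    have sD: "D \<subseteq> D'" "g \<in> D'" "supp u \<subseteq> D'" using sub u(2) by blast+
    note lt = card_rcosets_less[OF D D' sD(1,2) g(2) less.prems(2)]
    obtain u' y' m where "u' \<in> Units ZG" "\<forall>x\<in>carrier G. cj x u' = u'" "supp y' \<subseteq> carrier G"
      "u' = frag_of \<one> + frag_cmul Q y'" and m: "[class_sum S y' = int p ^ m * class_sum S y] (mod Q)"
      using less.hyps[OF lt(2) D' lt(1) u(1) sD(3) uD' y(1,2)] by blast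
    moreover have "[class_sum S y' = int p ^ Suc m * class_sum S z] (mod Q)"
      using cong_trans[OF m cong_scalar_left[OF y(3), of "int p ^ m"]] by (simp add: mult_ac)
    ultimately show ?thesis by blast
  qed
qed

text \<open>Cosets of the centralizer are the fibres of the map from group elements to conjugates of
  \<open>a\<close>.\<close>

lemma centralizer_finite_index:
  assumes a: "a \<in> FC_subgroup G"
  defines "D \<equiv> {x \<in> carrier G. a \<otimes> x = x \<otimes> a}"
  shows "subgroup D G" "finite (rcosets D)"
proof -
  have ac: "a \<in> carrier G" using a by (simp add: FC_subgroup_def)
  show D: "subgroup D G"
  proof (rule subgroupI)
    show "D \<noteq> {}" unfolding D_def using ac by auto
    fix x assume "x \<in> D"
    then have x: "x \<in> carrier G" "a \<otimes> x = x \<otimes> a" by (auto simp: D_def)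
    have "inv x \<otimes> (a \<otimes> x) \<otimes> inv x = inv x \<otimes> (x \<otimes> a) \<otimes> inv x" unfolding x(2) ..
    moreover have "inv x \<otimes> (a \<otimes> x) \<otimes> inv x = inv x \<otimes> a" using x(1) ac by (simp add: m_assoc)
    moreover have "inv x \<otimes> (x \<otimes> a) \<otimes> inv x = a \<otimes> inv x" using x(1) ac by (simp add: m_assoc[symmetric])
    ultimately have "inv x \<otimes> a = a \<otimes> inv x" by simp
    then show "inv x \<in> D" using x by (simp add: D_def)
    fix y assume "y \<in> D"
    then have y: "y \<in> carrier G" "a \<otimes> y = y \<otimes> a" by (auto simp: D_def)
    have "a \<otimes> (x \<otimes> y) = (x \<otimes> a) \<otimes> y" using x y ac by (simp add: m_assoc[symmetric])
    also have "\<dots> = x \<otimes> y \<otimes> a" using x(1) y ac by (simp add: m_assoc)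
    finally show "x \<otimes> y \<in> D" using x y by (simp add: D_def)
  qed (auto simp: D_def)
  have coset: "D #> x = {y \<in> carrier G. inv y \<otimes> a \<otimes> y = inv x \<otimes> a \<otimes> x}" if x: "x \<in> carrier G" for x
  proof (intro equalityI subsetI)
    fix y assume "y \<in> D #> x"
    then obtain d where d: "d \<in> D" "y = d \<otimes> x" by (auto simp: r_coset_def)
    have dc: "d \<in> carrier G" "a \<otimes> d = d \<otimes> a" using d by (auto simp: D_def)
    have "inv y \<otimes> a \<otimes> y = inv x \<otimes> (inv d \<otimes> (a \<otimes> d)) \<otimes> x"
      unfolding d(2) using dc(1) x ac by (simp add: inv_mult_group m_assoc)
    also have "inv d \<otimes> (a \<otimes> d) = a" unfolding dc(2) using dc(1) ac by (simp add: m_assoc[symmetric])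
    finally show "y \<in> {y \<in> carrier G. inv y \<otimes> a \<otimes> y = inv x \<otimes> a \<otimes> x}" using d dc x by simp
  next
    fix y assume "y \<in> {y \<in> carrier G. inv y \<otimes> a \<otimes> y = inv x \<otimes> a \<otimes> x}"
    then have y: "y \<in> carrier G" "inv y \<otimes> a \<otimes> y = inv x \<otimes> a \<otimes> x" by auto
    have "a \<otimes> y = y \<otimes> (inv y \<otimes> a \<otimes> y)" using y(1) ac by (simp add: m_assoc[symmetric])
    then have "a \<otimes> (y \<otimes> inv x) = y \<otimes> (inv x \<otimes> a \<otimes> x) \<otimes> inv x"
      unfolding y(2) using x y(1) ac by (simp add: m_assoc[symmetric])
    also have "\<dots> = (y \<otimes> inv x) \<otimes> a" using x y(1) ac by (simp add: m_assoc)
    finally have "a \<otimes> (y \<otimes> inv x) = (y \<otimes> inv x) \<otimes> a" .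
    then have "y \<otimes> inv x \<in> D" using x y by (simp add: D_def)
    moreover have "y = (y \<otimes> inv x) \<otimes> x" using x y(1) by (simp add: m_assoc)
    ultimately show "y \<in> D #> x" by (auto simp: r_coset_def)
  qed
  have im: "rcosets D \<subseteq> (\<lambda>b. {y \<in> carrier G. inv y \<otimes> a \<otimes> y = b}) ` {b. conjugate G a b}"
    using coset by (auto simp: RCOSETS_def conjugate_def)
  have "finite {b. conjugate G a b}" using a by (simp add: FC_subgroup_def)
  then show "finite (rcosets D)" by (intro finite_subset[OF im] finite_imageI)
qed

text \<open>The unit is multiplied up to a central \<open>u\<close> that is 1 modulo
  \<open>Q\<close>. Being trivial, \<open>u\<close> equals 1 because \<open>Q \<ge> 3\<close>, so a
  power of \<open>p\<close> times the class sum of \<open>z\<close> vanishes modulo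
  \<open>Q\<close>, and that power cancels.\<close>

theorem class_sum_unit_of_cut_group:
  assumes p: "prime p" and pG: "p_group p G" and cut: "cut_group G"
    and S: "S \<subseteq> carrier G" "\<And>x g. x \<in> carrier G \<Longrightarrow> g \<in> S \<Longrightarrow> inv x \<otimes> g \<otimes> x \<in> S"
    and a: "a \<in> FC_subgroup G" and Q: "Q \<ge> 3" "coprime Q (int p)"
    and v: "v \<in> Units ZG" "supp v \<subseteq> range (\<lambda>i. a [^] (i::nat))"
    and z: "supp z \<subseteq> carrier G" "v = frag_of \<one> + frag_cmul Q z"
  shows "Q dvd class_sum S z"
proof -
  define D where "D = {x \<in> carrier G. a \<otimes> x = x \<otimes> a}"
  have ac: "a \<in> carrier G" using a by (simp add: FC_subgroup_def)
  have D: "subgroup D G" "finite (rcosets D)"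
    unfolding D_def by (rule centralizer_finite_index[OF a])+
  have comm: "a [^] (i::nat) \<otimes> d = d \<otimes> a [^] i" if "d \<in> carrier G" "a \<otimes> d = d \<otimes> a" for d i
  proof (induction i)
    case (Suc i)
    have "a [^] Suc i \<otimes> d = a [^] i \<otimes> (a \<otimes> d)" using ac that(1) by (simp add: m_assoc)
    also have "\<dots> = (a [^] i \<otimes> d) \<otimes> a" unfolding that(2) using ac that(1) by (simp add: m_assoc)
    finally show ?case unfolding Suc using ac that(1) by (simp add: m_assoc)
  qed (use that in simp)
  have vD: "supp v \<subseteq> D"
  proof
    fix x assume "x \<in> supp v"
    then obtain i where "x = a [^] (i::nat)" using v(2) by blast
    then show "x \<in> D" using comm[OF ac refl, of i] ac by (simp add: D_def)
  qed
  have vc: "supp v \<subseteq> carrier G" using Units_supp[OF v(1)] .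
  have vinv: "cj d v = v" if d: "d \<in> D" for d
  proof -
    have dc: "d \<in> carrier G" "a \<otimes> d = d \<otimes> a" using d by (auto simp: D_def)
    have "frag_of d \<star> v = v \<star> frag_of d"
    proof (rule gmult_commute_span[OF v(2)])
      fix x assume "x \<in> range (\<lambda>i. a [^] (i::nat))"
      then show "frag_of d \<star> frag_of x = frag_of x \<star> frag_of d"
        using comm[OF dc] by (auto simp: gmult_frag_of)
    qed
    then show ?thesis unfolding cj_eq_iff_commute[OF dc(1) vc] by simp
  qed
  obtain u y m where u: "u \<in> Units ZG" "\<forall>x\<in>carrier G. cj x u = u" and y: "supp y \<subseteq> carrier G"
      "u = frag_of \<one> + frag_cmul Q y" and m: "[class_sum S y = int p ^ m * class_sum S z] (mod Q)"
    using central_unit_over_finite_index[OF p pG S D v(1) vD vinv z] by blast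
  have "u \<in> group_center (units_of ZG)" unfolding center_units_iff using u by blast
  then have "u \<in> frag_of ` group_center G \<union> (\<lambda>z. - frag_of z) ` group_center G"
    using cut unfolding cut_group_def by blast
  then obtain c where c: "u = frag_of c \<or> u = - frag_of c" by blast
  have u1: "coeff_at u \<one> = 1 + Q * coeff_at y \<one>"
    unfolding y(2) lookup_add lookup_frag_cmul by simp
  have "u = frag_of \<one>"
    using c
  proof
    assume u: "u = frag_of c"
    have "c = \<one>"
    proof (rule ccontr)
      assume "c \<noteq> \<one>"
      then have "Q * coeff_at y \<one> = -1" using u1 unfolding u coeff_at_frag_of by simp
      then have "Q dvd 1" by (metis dvd_minus_iff dvd_triv_left)
      then show False using Q(1) by (simp add: zdvd_not_zless)
    qed
    then show ?thesis using u by simp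
  next
    assume u: "u = - frag_of c"
    have "coeff_at u \<one> = 0 \<or> coeff_at u \<one> = -1"
      unfolding u lookup_uminus coeff_at_frag_of by simp
    then have "Q * (- coeff_at y \<one>) = 1 \<or> Q * (- coeff_at y \<one>) = 2" using u1 by auto
    then have "Q dvd 1 \<or> Q dvd 2" by (metis dvd_triv_left)
    then show ?thesis using Q(1) by (auto dest: zdvd_imp_le)
  qed
  then have "frag_cmul Q y = 0" using y(2) by simp
  then have "y = 0" using Q(1) by simp
  then have "Q dvd int p ^ m * class_sum S z"
    using m by (simp add: cong_iff_dvd_diff)
  moreover have "coprime Q (int p ^ m)" using Q(2) by simp
  ultimately show ?thesis using coprime_dvd_mult_right_iff by blast
qed


section \<open>Polynomials in a group element\<close>

definition poly_elem :: "'a \<Rightarrow> int poly \<Rightarrow> ('a \<Rightarrow>\<^sub>0 int)" where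
  "poly_elem a f = (\<Sum>i\<le>degree f. frag_cmul (coeff f i) (frag_of (a [^] i)))"

lemma poly_elem_bound:
  assumes "degree f \<le> d"
  shows "poly_elem a f = (\<Sum>i\<le>d. frag_cmul (coeff f i) (frag_of (a [^] i)))"
  unfolding poly_elem_def using assms
  by (intro sum.mono_neutral_left) (auto simp: coeff_eq_0)

lemma poly_elem_add: "poly_elem a (f + g) = poly_elem a f + poly_elem a g"
proof -
  define d where "d = max (degree f) (degree g)"
  have d: "degree f \<le> d" "degree g \<le> d" "degree (f + g) \<le> d"
    unfolding d_def by (auto simp: degree_add_le_max)
  show ?thesis unfolding d[THEN poly_elem_bound] sum.distrib[symmetric]
    by (intro sum.cong) (auto simp: frag_cmul_distrib)
qed

lemma poly_elem_smult: "poly_elem a (smult c f) = frag_cmul c (poly_elem a f)"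
proof -
  have "poly_elem a (smult c f) = (\<Sum>i\<le>degree f. frag_cmul (coeff (smult c f) i) (frag_of (a [^] i)))"
    by (rule poly_elem_bound[OF degree_smult_le])
  then show ?thesis by (simp add: poly_elem_def frag_cmul_sum)
qed

lemma poly_elem_zero [simp]: "poly_elem a 0 = 0"
  using poly_elem_smult[of a 0 0] by simp

lemma poly_elem_diff: "poly_elem a (f - g) = poly_elem a f - poly_elem a g"
  using poly_elem_add[of a f "smult (-1) g"] poly_elem_smult[of a "-1" g] by simp

lemma poly_elem_monom: "poly_elem a (monom c i) = frag_cmul c (frag_of (a [^] i))"
proof -
  have "poly_elem a (monom c i) = (\<Sum>j\<le>i. frag_cmul (coeff (monom c i) j) (frag_of (a [^] j)))"
    by (rule poly_elem_bound[OF degree_monom_le])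
  also have "\<dots> = (\<Sum>j\<in>{i}. frag_cmul (coeff (monom c i) j) (frag_of (a [^] j)))"
    by (intro sum.mono_neutral_right) auto
  finally show ?thesis by simp
qed

lemma poly_elem_one: "poly_elem a 1 = frag_of \<one>"
  using poly_elem_monom[of a 1 0] by (simp add: monom_0 one_pCons)

lemma poly_elem_mult:
  assumes a: "a \<in> carrier G"
  shows "poly_elem a (f * g) = poly_elem a f \<star> poly_elem a g"
proof (induction f rule: int_poly_induct)
  case (monom c i)
  show ?case
  proof (induction g rule: int_poly_induct)
    case (monom d j)
    show ?case using a
      by (simp add: mult_monom poly_elem_monom gmult_cmul_left gmult_cmul_right gmult_frag_of nat_pow_mult mult.commute)
  qed (simp_all add: distrib_left poly_elem_add gmult_add_right)
qed (simp_all add: distrib_right poly_elem_add gmult_add_left)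

lemma supp_poly_elem: "supp (poly_elem a f) \<subseteq> range (\<lambda>i. a [^] (i::nat))"
proof (induction f rule: int_poly_induct)
  case (monom c i)
  have "supp (frag_cmul c (frag_of (a [^] i))) \<subseteq> {a [^] i}" using keys_cmul[of c "frag_of (a [^] i)"] by simp
  then show ?case unfolding poly_elem_monom by blast
next
  case (add f g)
  then show ?case unfolding poly_elem_add by (intro supp_add_cmul(1))
qed simp

lemma supp_poly_elem_carrier: "a \<in> carrier G \<Longrightarrow> supp (poly_elem a f) \<subseteq> carrier G"
  using supp_poly_elem[of a f] by auto

lemma poly_elem_pcong:
  assumes a: "a \<in> carrier G" "a [^] n = \<one>" and fg: "pcong n 0 f g"
  shows "poly_elem a f = poly_elem a g"
proof -
  obtain h where h: "f - g = (monom 1 n - 1) * h" using fg unfolding pcong_def by auto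
  have "poly_elem a (monom 1 n - 1) = 0"
    unfolding poly_elem_diff poly_elem_monom poly_elem_one using a by simp
  then have "poly_elem a (f - g) = 0" unfolding h using poly_elem_mult[OF a(1)] by simp
  then show ?thesis by (simp add: poly_elem_diff)
qed

lemma class_sum_poly_elem:
  assumes S: "\<And>i. a [^] (i::nat) \<in> S \<longleftrightarrow> [i = c] (mod m) \<or> [i = d] (mod m)" and cd: "\<not> [c = d] (mod m)"
  shows "class_sum S (poly_elem a f) = res_coeff m c f + res_coeff m d f"
proof (induction f rule: int_poly_induct)
  case (monom b i)
  have "\<not> ([i = c] (mod m) \<and> [i = d] (mod m))" using cd cong_sym cong_trans by blast
  then show ?case unfolding poly_elem_monom class_sum_cmul class_sum_frag_of S res_coeff_monom by auto
qed (simp_all add: poly_elem_add class_sum_add res_coeff_add)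

text \<open>If \<open>a [^] i\<close> is conjugate to \<open>a [^] j\<close>, then \<open>i\<close>
  times an inverse of \<open>j\<close> fixes the class of \<open>a\<close>, hence is 1 or -1 modulo
  \<open>m\<close>; so \<open>i\<close> is \<open>j\<close> up to sign. The inverse exists because
  \<open>c\<close> is prime to \<open>m\<close>.\<close>

lemma power_in_class_iff:
  assumes p: "prime (p::nat)" and a: "a \<in> carrier G" "ord a = p ^ s" and pm: "p dvd m" and mo: "m dvd ord a"
    and ex: "\<And>j. j \<in> class_exps a \<Longrightarrow> [j = 1] (mod int m) \<or> [j = -1] (mod int m)"
    and c: "coprime c m" "c < m"
  defines "S \<equiv> {g \<in> carrier G. \<exists>j. ([j = int c] (mod int m) \<or> [j = - int c] (mod int m)) \<and> conjugate G (a [^] j) g}"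
  shows "a [^] (i::nat) \<in> S \<longleftrightarrow> [i = c] (mod m) \<or> [i = m - c] (mod m)"
proof -
  have mc: "int (m - c) = int m - int c" using c by simp
  have iff: "[int i = int c] (mod int m) \<longleftrightarrow> [i = c] (mod m)"
    "[int i = - int c] (mod int m) \<longleftrightarrow> [i = m - c] (mod m)"
  proof -
    show "[int i = int c] (mod int m) \<longleftrightarrow> [i = c] (mod m)" by (rule cong_int_iff)
    have "[int i = - int c] (mod int m) \<longleftrightarrow> [int i = int (m - c)] (mod int m)"
      unfolding mc by (simp add: cong_def)
    then show "[int i = - int c] (mod int m) \<longleftrightarrow> [i = m - c] (mod m)" unfolding cong_int_iff .
  qed
  show ?thesis
  proof
    assume "a [^] i \<in> S"
    then obtain j where j: "[j = int c] (mod int m) \<or> [j = - int c] (mod int m)" "conjugate G (a [^] j) (a [^] i)"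
      unfolding S_def by blast
    have "\<not> int p dvd j"
    proof
      assume "int p dvd j"
      moreover have "int p dvd int m" using pm by simp
      ultimately have "int p dvd int c"
        using j(1) cong_dvd_iff[OF cong_dvd_modulus[of j "int c" "int m" "int p"]]
          cong_dvd_iff[OF cong_dvd_modulus[of j "- int c" "int m" "int p"]] by auto
      then have "p dvd c" by simp
      then have "is_unit p" by (rule coprime_common_divisor[OF c(1) _ pm])
      then show False using p by simp
    qed
    then have "coprime (int p) j" using p by (intro prime_imp_coprime) auto
    then have "coprime j (int (ord a))" by (simp add: a(2) coprime_commute)
    then obtain j' where j': "[j * j' = 1] (mod int (ord a))" using cong_solve_coprime_int by blast
    have "conjugate G ((a [^] j) [^] j') ((a [^] int i) [^] j')"
      using j(2) a(1) by (intro conjugate_int_pow) (auto simp: int_pow_int)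
    moreover have "(a [^] j) [^] j' = a [^] (1::int)"
      unfolding int_pow_pow[OF a(1)] int_pow_eq[OF a(1)] using j' by (simp only: cong_iff_dvd_diff dvd_diff_commute)
    ultimately have "conjugate G a (a [^] (int i * j'))" using a(1) by (simp add: int_pow_pow)
    then have "int i * j' \<in> class_exps a" unfolding class_exps_def using conjugate_sym[OF a(1)] by blast
    then have e: "[int i * j' = 1] (mod int m) \<or> [int i * j' = -1] (mod int m)" by (rule ex)
    have j'm: "[j * j' = 1] (mod int m)" using mo by (intro cong_dvd_modulus[OF j']) simp
    have ij: "[int i = int i * j' * j] (mod int m)"
      using cong_sym[OF cong_scalar_left[OF j'm, of "int i"]] by (simp add: mult_ac)
    have "[int i = j] (mod int m) \<or> [int i = - j] (mod int m)"
      using e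
    proof
      assume "[int i * j' = 1] (mod int m)"
      then show ?thesis using cong_trans[OF ij cong_scalar_right[of "int i * j'" 1 "int m" j]] by simp
    next
      assume "[int i * j' = -1] (mod int m)"
      then show ?thesis using cong_trans[OF ij cong_scalar_right[of "int i * j'" "-1" "int m" j]] by simp
    qed
    then have "[int i = int c] (mod int m) \<or> [int i = - int c] (mod int m)"
      using j(1) cong_minus_minus_iff[of j "int c" "int m"] cong_minus_minus_iff[of j "- int c" "int m"]
      by (metis add.inverse_inverse cong_trans)
    then show "[i = c] (mod m) \<or> [i = m - c] (mod m)" unfolding iff .
  next
    assume "[i = c] (mod m) \<or> [i = m - c] (mod m)"
    then have "[int i = int c] (mod int m) \<or> [int i = - int c] (mod int m)" unfolding iff .
    moreover have "conjugate G (a [^] int i) (a [^] i)"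
      using conjugate_refl[of "a [^] i"] a(1) by (simp add: int_pow_int)
    ultimately show "a [^] i \<in> S" unfolding S_def using a(1) by blast
  qed
qed

text \<open>Carries the contradiction for cyclic group rings over to \<open>G\<close>: on
  polynomials in \<open>a\<close>, the class sum over \<open>S\<close> is the sum of the
  coefficients at \<open>c\<close> and \<open>m - c\<close>.\<close>

lemma cut_group_no_bad_element:
  assumes p: "prime p" and pG: "p_group p G" and cut: "cut_group G"
    and a: "a \<in> FC_subgroup G" and mo: "m dvd ord a" and pm: "p dvd m" and m3: "m \<ge> 3"
    and ex: "\<And>j. j \<in> class_exps a \<Longrightarrow> [j = 1] (mod int m) \<or> [j = -1] (mod int m)"
    and \<kappa>: "coprime \<kappa> p" and kk: "[k * k' = 1] (mod m)"
    and nonunit: "\<And>c. c < m \<Longrightarrow> \<not> coprime c m \<Longrightarrow> [k' * c = c] (mod m) \<or> [k' * c + c = 0] (mod m)"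
    and neq: "cmod (\<Sum>i<\<kappa>. (cis (2 * pi / real m) ^ k) ^ i) \<noteq> cmod (\<Sum>i<\<kappa>. cis (2 * pi / real m) ^ i)"
  shows False
proof -
  have ac: "a \<in> carrier G" using a by (simp add: FC_subgroup_def)
  obtain s where s: "ord a = p ^ s" using pG ac by (auto simp: p_group_def)
  \<comment> \<open>An odd prime different from \<open>p\<close>, so that powers of \<open>p\<close>
    cancel modulo powers of \<open>q\<close>.\<close>
  define q :: int where "q = (if p = 3 then 5 else 3)"
  have q: "odd q" "q \<ge> 3" by (auto simp: q_def)
  have cop: "coprime (q ^ e) (int p)" for e
  proof -
    have "q \<noteq> int p" "prime q" by (auto simp: q_def)
    then have "coprime q (int p)" using p by (intro primes_coprime) auto
    then show ?thesis by simp
  qed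
  have n0: "ord a > 0" using s prime_gt_0_nat[OF p] by simp
  have \<kappa>n: "coprime \<kappa> (ord a)" using \<kappa> by (simp add: s)
  have m2: "m \<ge> 2" using m3 by simp
  show False
  proof (rule generator_coefficients_contradiction[OF n0 mo m2 \<kappa>n kk nonunit q refl neq])
    fix V V' y :: "int poly" and e c :: nat
    assume VV: "pcong (ord a) 0 (V * V') 1" and y: "pcong (ord a) 0 V (1 + smult (q ^ Suc e) y)"
      and c: "coprime c m" "c < m"
    define Q where "Q = q ^ Suc e"
    have a1: "a [^] ord a = \<one>" by (rule pow_ord_eq_1[OF ac])
    define S where "S = {g \<in> carrier G. \<exists>j. ([j = int c] (mod int m) \<or> [j = - int c] (mod int m)) \<and> conjugate G (a [^] j) g}"
    have S: "S \<subseteq> carrier G" by (auto simp: S_def)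
    have Scl: "inv x \<otimes> g \<otimes> x \<in> S" if x: "x \<in> carrier G" and g: "g \<in> S" for x g
    proof -
      obtain j where j: "[j = int c] (mod int m) \<or> [j = - int c] (mod int m)" "conjugate G (a [^] j) g" "g \<in> carrier G"
        using g unfolding S_def by blast
      have "conjugate G g (inv x \<otimes> g \<otimes> x)" using x by (auto simp: conjugate_def)
      then have "conjugate G (a [^] j) (inv x \<otimes> g \<otimes> x)"
        using conjugate_trans[OF _ j(2)] ac by simp
      then show ?thesis unfolding S_def using j x by blast
    qed
    define v where "v = poly_elem a V"
    have inv: "v \<star> poly_elem a V' = frag_of \<one>" "poly_elem a V' \<star> v = frag_of \<one>"
      using poly_elem_pcong[OF ac a1 VV] poly_elem_mult[OF ac, of V V'] poly_elem_mult[OF ac, of V' V]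
      by (simp_all add: v_def poly_elem_one mult.commute)
    then have vU: "v \<in> Units ZG"
      unfolding Units_ZG v_def using supp_poly_elem_carrier[OF ac] by blast
    have vz: "v = frag_of \<one> + frag_cmul Q (poly_elem a y)"
      using poly_elem_pcong[OF ac a1 y] by (simp add: v_def Q_def poly_elem_add poly_elem_one poly_elem_smult)
    have Q3: "Q \<ge> 3"
    proof -
      have "q * 1 \<le> q * q ^ e" using q by (intro mult_left_mono) auto
      then show ?thesis unfolding Q_def power_Suc using q(2) by linarith
    qed
    have "Q dvd class_sum S (poly_elem a y)"
      using class_sum_unit_of_cut_group[OF p pG cut S Scl a Q3 _ vU _ supp_poly_elem_carrier[OF ac] vz]
        cop[of "Suc e"] supp_poly_elem[of a V] by (simp add: Q_def v_def)
    moreover have "class_sum S (poly_elem a y) = res_coeff m c y + res_coeff m (m - c) y"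
    proof (rule class_sum_poly_elem)
      show "a [^] i \<in> S \<longleftrightarrow> [i = c] (mod m) \<or> [i = m - c] (mod m)" for i :: nat
        unfolding S_def by (rule power_in_class_iff[OF p ac s pm mo ex c])
      \<comment> \<open>Equality would give \<open>m = 2 * c\<close> with \<open>c\<close> prime to
        \<open>m\<close>, that is \<open>m = 2\<close>.\<close>
      show "\<not> [c = m - c] (mod m)"
      proof
        assume "[c = m - c] (mod m)"
        moreover have c0: "c \<noteq> 0"
        proof
          assume "c = 0"
          then show False using c(1) m3 by simp
        qed
        ultimately have "c = m - c" using c(2) by (simp add: cong_def)
        then have m2c: "m = c * 2" using c(2) by simp
        then have "c dvd m" by simp
        then have "c = 1" using coprime_common_divisor[OF c(1) dvd_refl] by simp
        then show False using m2c m3 by simp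
      qed
    qed
    ultimately show "q ^ Suc e dvd res_coeff m c y + res_coeff m (m - c) y" by (simp add: Q_def)
  qed
qed

end

text \<open>The squared modulus of 1 + cis x is 2 + 2 cos x, and the cosine decreases strictly on
  the interval from 0 to pi, which contains both angles.\<close>

lemma cmod_geometric_2:
  assumes "m \<ge> 5"
  shows "cmod (\<Sum>i<2. (cis (2 * pi / real m) ^ 2) ^ i) \<noteq> cmod (\<Sum>i<2. cis (2 * pi / real m) ^ i)"
proof
  define t where "t = 2 * pi / real m"
  have n: "(cmod (\<Sum>i<2. cis x ^ i))\<^sup>2 = 2 + 2 * cos x" for x
  proof -
    have "(\<Sum>i<2. cis x ^ i) = 1 + cis x" by (simp add: numeral_2_eq_2)
    then have "(cmod (\<Sum>i<2. cis x ^ i))\<^sup>2 = (1 + cos x)\<^sup>2 + (sin x)\<^sup>2" by (simp add: cmod_power2)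
    also have "\<dots> = 1 + 2 * cos x + ((sin x)\<^sup>2 + (cos x)\<^sup>2)" by (simp add: power2_eq_square algebra_simps)
    finally show ?thesis by simp
  qed
  assume "cmod (\<Sum>i<2. (cis (2 * pi / real m) ^ 2) ^ i) = cmod (\<Sum>i<2. cis (2 * pi / real m) ^ i)"
  moreover have "cis (2 * pi / real m) ^ 2 = cis (2 * t)" by (simp add: t_def DeMoivre)
  ultimately have "cos (2 * t) = cos t" using n[of t] n[of "2 * t"] by (simp add: t_def)
  moreover have "0 < t" "2 * t \<le> pi" using assms by (auto simp: t_def field_simps)
  ultimately show False using cos_monotone_0_pi[of t "2 * t"] by simp
qed

text \<open>For \<open>p = 2\<close> the length must be odd, hence three terms. With
  \<open>r = sqrt 2 / 2\<close> the squared moduli are 2 (1 - r)^2 at the cube and 2 (1 + r)^2 at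
  the root itself.\<close>

lemma cmod_geometric_3:
  "cmod (\<Sum>i<3. (cis (2 * pi / real 8) ^ 3) ^ i) \<noteq> cmod (\<Sum>i<3. cis (2 * pi / real 8) ^ i)"
proof
  define r where "r = sqrt 2 / 2"
  have r: "r > 0" "r * r = 1 / 2" by (simp_all add: r_def)
  define z where "z = cis (2 * pi / real 8)"
  have z: "z = Complex r r"
    unfolding z_def cis_conv_exp[symmetric] by (simp add: complex_eq_iff r_def cos_45 sin_45)
  have n: "(\<Sum>i<3. w ^ i) = 1 + w + w * w" for w :: complex
    by (simp add: numeral_3_eq_3)
  have z3: "z ^ 3 = Complex (- r) r"
    unfolding z power3_eq_cube using r(2) by (simp add: complex_eq_iff algebra_simps)
  have 1: "(cmod (\<Sum>i<3. z ^ i))\<^sup>2 = 2 * (1 + r)\<^sup>2"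
    unfolding n unfolding z cmod_power2 using r(2) by (simp add: power2_eq_square algebra_simps)
  have 2: "(cmod (\<Sum>i<3. (z ^ 3) ^ i))\<^sup>2 = 2 * (1 - r)\<^sup>2"
    unfolding n unfolding z3 cmod_power2 using r(2) by (simp add: power2_eq_square algebra_simps)
  assume "cmod (\<Sum>i<3. (cis (2 * pi / real 8) ^ 3) ^ i) = cmod (\<Sum>i<3. cis (2 * pi / real 8) ^ i)"
  then have "2 * (1 - r)\<^sup>2 = 2 * (1 + r)\<^sup>2" unfolding z_def[symmetric] using 1 2 by simp
  then show False using r(1) by (simp add: power2_eq_square algebra_simps)
qed

context group
begin

section \<open>The two directions of the equivalence\<close>

lemma torsion_FC_eq_FC:
  assumes "prime p" "p_group p G"
  shows "torsion_FC_subgroup G = FC_subgroup G"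
proof -
  have "\<exists>n>0. a [^] (n::nat) = \<one>" if "a \<in> FC_subgroup G" for a
  proof -
    have ac: "a \<in> carrier G" using that by (simp add: FC_subgroup_def)
    obtain k where "ord a = p ^ k" using assms ac by (auto simp: p_group_def)
    then show ?thesis using pow_ord_eq_1[OF ac] prime_gt_0_nat[OF assms(1)]
      by (intro exI[of _ "ord a"]) simp
  qed
  then show ?thesis by (auto simp: torsion_FC_subgroup_def)
qed

lemma one_in_FC: "\<one> \<in> FC_subgroup G"
proof -
  have "{b. conjugate G \<one> b} \<subseteq> {\<one>}" by (auto simp: conjugate_def)
  then show ?thesis using finite_subset by (auto simp: FC_subgroup_def)
qed

text \<open>Conjugates of a power are powers of conjugates.\<close>

lemma FC_subgroup_pow:
  assumes "a \<in> FC_subgroup G"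
  shows "a [^] (n::nat) \<in> FC_subgroup G"
proof -
  have ac: "a \<in> carrier G" and fin: "finite {b. conjugate G a b}" using assms by (auto simp: FC_subgroup_def)
  have "{b. conjugate G (a [^] n) b} \<subseteq> (\<lambda>b. b [^] n) ` {b. conjugate G a b}"
  proof
    fix b assume "b \<in> {b. conjugate G (a [^] n) b}"
    then obtain x where x: "x \<in> carrier G" "b = inv x \<otimes> a [^] n \<otimes> x" by (auto simp: conjugate_def)
    have "(inv x \<otimes> a \<otimes> x) [^] n = inv x \<otimes> a [^] n \<otimes> x" by (rule nat_pow_conjugate[OF ac x(1)])
    then show "b \<in> (\<lambda>b. b [^] n) ` {b. conjugate G a b}"
      using x by (intro image_eqI[of _ _ "inv x \<otimes> a \<otimes> x"]) (auto simp: conjugate_def)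
  qed
  then have "finite {b. conjugate G (a [^] n) b}" using finite_subset finite_imageI[OF fin] by blast
  then show ?thesis using ac by (simp add: FC_subgroup_def)
qed

lemma cut_group_imp_conditions:
  assumes p: "prime p" and pG: "p_group p G" and cut: "cut_group G"
  shows "(p = 2 \<and> (\<forall>a \<in> FC_subgroup G. conjugate G (a [^] (3::nat)) a \<or> conjugate G (a [^] (3::nat)) (inv a)))
    \<or> (p = 3 \<and> (\<forall>a \<in> FC_subgroup G. conjugate G (a [^] (2::nat)) (inv a)))
    \<or> FC_subgroup G = {\<one>}"
proof -
  have ord: "\<exists>s. ord a = p ^ s" if "a \<in> FC_subgroup G" for a
    using pG that by (auto simp: p_group_def FC_subgroup_def)
  have car: "a \<in> carrier G" if "a \<in> FC_subgroup G" for a using that by (simp add: FC_subgroup_def)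
  consider "p = 2" | "p = 3" | "p \<ge> 5"
  proof -
    have "p \<noteq> 4"
    proof
      assume "p = 4"
      then have "2 dvd p" by simp
      moreover have "\<forall>m. m dvd p \<longrightarrow> m = 1 \<or> m = p" using p by (simp add: prime_nat_iff)
      ultimately have "(2::nat) = 1 \<or> 2 = p" by blast
      then show False using \<open>p = 4\<close> by simp
    qed
    then show ?thesis using that prime_ge_2_nat[OF p] by linarith
  qed
  then show ?thesis
  proof cases
    case 1
    have "conjugate G (a [^] (3::nat)) a \<or> conjugate G (a [^] (3::nat)) (inv a)" if a: "a \<in> FC_subgroup G" for a
    proof (rule ccontr)
      assume bad: "\<not> ?thesis"
      obtain s where s: "ord a = 2 ^ s" using ord[OF a] 1 by blast
      note b = class_exps_bad_2[OF car[OF a] s bad]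
      show False
      \<comment> \<open>Modulo 8, the exponent 3 is its own inverse and acts as -1 on even residues,
        so it moves only the coefficients at units.\<close>
      proof (rule cut_group_no_bad_element[OF p pG cut a b(1), where k = 3 and k' = 3 and \<kappa> = 3])
        show "[3 * c = c] (mod 8) \<or> [3 * c + c = 0] (mod 8)" if "\<not> coprime c 8" for c :: nat
        proof -
          have "even c"
          proof (rule ccontr)
            assume "odd c"
            then have "coprime c 2" by simp
            then have "coprime c (2 ^ 3)" unfolding coprime_power_right_iff by blast
            then show False using that by simp
          qed
          then obtain d where "c = 2 * d" by blast
          then show ?thesis by (simp add: cong_def)
        qed
        show "[j = 1] (mod int 8) \<or> [j = -1] (mod int 8)" if "j \<in> class_exps a" for j
          using b(2)[OF that] by simp
      qed (use 1 cmod_geometric_3 in \<open>simp_all add: cong_def\<close>)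
    qed
    then show ?thesis using 1 by blast
  next
    case 2
    have "conjugate G (a [^] (2::nat)) (inv a)" if a: "a \<in> FC_subgroup G" for a
    proof (rule ccontr)
      assume bad: "\<not> ?thesis"
      obtain s where s: "ord a = 3 ^ s" using ord[OF a] 2 by blast
      note b = class_exps_bad_3[OF car[OF a] s bad]
      show False
      \<comment> \<open>Modulo 9, the inverse of 2 is 5, which acts as -1 on the multiples of
        3.\<close>
      proof (rule cut_group_no_bad_element[OF p pG cut a b(1), where k = 2 and k' = 5 and \<kappa> = 2])
        show "[5 * c = c] (mod 9) \<or> [5 * c + c = 0] (mod 9)" if "\<not> coprime c 9" for c :: nat
        proof -
          have "3 dvd c"
          proof (rule ccontr)
            assume "\<not> 3 dvd c"
            moreover have "prime (3::nat)" by simp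
            ultimately have "coprime 3 c" using prime_imp_coprime by blast
            then have "coprime c 3" by (simp add: coprime_commute)
            then have "coprime c (3 ^ 2)" unfolding coprime_power_right_iff by blast
            then show False using that by simp
          qed
          then obtain d where d: "c = 3 * d" by blast
          have "5 * c + c = 9 * (2 * d)" by (simp add: d)
          then show ?thesis by (metis cong_0_iff dvd_triv_left)
        qed
        show "[j = 1] (mod int 9) \<or> [j = -1] (mod int 9)" if "j \<in> class_exps a" for j
          using b(2)[OF that] by simp
        show "cmod (\<Sum>i<2. (cis (2 * pi / real 9) ^ 2) ^ i) \<noteq> cmod (\<Sum>i<2. cis (2 * pi / real 9) ^ i)"
          by (rule cmod_geometric_2) simp
      qed (use 2 in \<open>simp_all add: cong_def\<close>)
    qed
    then show ?thesis using 2 by blast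
  next
    case 3
    have "b = \<one>" if b: "b \<in> FC_subgroup G" for b
    proof (rule ccontr)
      assume nb: "b \<noteq> \<one>"
      obtain s where s: "ord b = p ^ s" using ord[OF b] by blast
      have "s \<noteq> 0"
      proof
        assume "s = 0"
        then show False using s nb ord_eq_1[OF car[OF b]] by simp
      qed
      then obtain r where r: "s = Suc r" using not0_implies_Suc by blast
      \<comment> \<open>A power of order \<open>p\<close>: there the exponents fixing the class are
        1 modulo \<open>p\<close>, so \<open>m = p\<close> is available.\<close>
      define a where "a = b [^] (p ^ r)"
      have a: "a \<in> FC_subgroup G" unfolding a_def by (rule FC_subgroup_pow[OF b])
      have "a \<noteq> \<one>"
      proof
        assume "a = \<one>"
        then have "p ^ Suc r dvd p ^ r" using s r car[OF b] by (simp add: a_def pow_eq_id)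
        then show False using prime_gt_1_nat[OF p] prime_gt_0_nat[OF p] by (simp add: dvd_imp_le)
      qed
      moreover have "a [^] p = \<one>"
        using pow_ord_eq_1[OF car[OF b]] s r car[OF b] by (simp add: a_def nat_pow_pow mult.commute)
      ultimately have oa: "ord a = p"
        using car[OF a] p ord_eq_1[OF car[OF a]] pow_eq_id[OF car[OF a]] by (metis One_nat_def prime_nat_iff)
      have odd: "odd p" using 3 p prime_odd_nat by auto
      show False
      \<comment> \<open>\<open>(p + 1) div 2\<close> is the inverse of 2 modulo \<open>p\<close>,
        and 0 is the only residue not prime to \<open>p\<close>.\<close>
      proof (rule cut_group_no_bad_element[OF p pG cut a, where m = p and k = 2 and k' = "(p + 1) div 2" and \<kappa> = 2])
        show "[j = 1] (mod int p) \<or> [j = -1] (mod int p)" if "j \<in> class_exps a" for j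
          using class_exps_prime_order[OF p pG car[OF a] oa that] by blast
        have eq: "2 * ((p + 1) div 2) = p + 1" using odd by simp
        show "[2 * ((p + 1) div 2) = 1] (mod p)" unfolding eq cong_def by (rule mod_add_self1)
        show "[(p + 1) div 2 * c = c] (mod p) \<or> [(p + 1) div 2 * c + c = 0] (mod p)"
          if "c < p" "\<not> coprime c p" for c
        proof -
          have "p dvd c" using that(2) prime_imp_coprime[OF p, of c] by (auto simp: coprime_commute)
          then have "c = 0" using that(1) by (meson nat_dvd_not_less neq0_conv)
          then show ?thesis by simp
        qed
        show "cmod (\<Sum>i<2. (cis (2 * pi / real p) ^ 2) ^ i) \<noteq> cmod (\<Sum>i<2. cis (2 * pi / real p) ^ i)"
          using cmod_geometric_2 3 by blast
      qed (use 3 oa odd in simp_all)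
    qed
    then show ?thesis using one_in_FC by blast
  qed
qed

lemma conditions_imp_cut_group:
  assumes p: "prime p" and pG: "p_group p G"
    and cond: "(p = 2 \<and> (\<forall>a \<in> FC_subgroup G. conjugate G (a [^] (3::nat)) a \<or> conjugate G (a [^] (3::nat)) (inv a)))
      \<or> (p = 3 \<and> (\<forall>a \<in> FC_subgroup G. conjugate G (a [^] (2::nat)) (inv a)))
      \<or> FC_subgroup G = {\<one>}"
  shows "cut_group G"
proof (rule cut_group_if_power_conjugate[OF p pG])
  fix a and j :: nat
  assume a: "a \<in> FC_subgroup G" and j: "coprime j p"
  have ac: "a \<in> carrier G" using a by (simp add: FC_subgroup_def)
  obtain s where "ord a = p ^ s" using pG ac by (auto simp: p_group_def)
  then have as: "a [^] (p ^ s) = \<one>" using pow_ord_eq_1[OF ac] by simp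
  from cond show "conjugate G (a [^] j) a \<or> conjugate G (a [^] j) (inv a)"
  proof (elim disjE)
    assume c: "p = 2 \<and> (\<forall>a \<in> FC_subgroup G. conjugate G (a [^] (3::nat)) a \<or> conjugate G (a [^] (3::nat)) (inv a))"
    have "odd j" using j c by simp
    then show ?thesis using power_conjugate_2[OF ac] as c a by blast
  next
    assume c: "p = 3 \<and> (\<forall>a \<in> FC_subgroup G. conjugate G (a [^] (2::nat)) (inv a))"
    have "\<not> 3 dvd j" using j c by (metis coprime_common_divisor_nat dvd_refl not_prime_unit p)
    then show ?thesis using power_conjugate_3[OF ac] as c a by blast
  next
    assume "FC_subgroup G = {\<one>}"
    then have "a = \<one>" using a by blast
    then show ?thesis using conjugate_refl[OF one_closed] by simp
  qed
qed

end

theorem theorem9: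
  fixes G :: "('a, 'b) monoid_scheme" and p :: nat
  assumes "prime p" and "p_group p G"
  shows "cut_group G \<longleftrightarrow>
      (p = 2 \<and> (\<forall>a \<in> torsion_FC_subgroup G.
          conjugate G (a [^]\<^bsub>G\<^esub> (3::nat)) a \<or> conjugate G (a [^]\<^bsub>G\<^esub> (3::nat)) (inv\<^bsub>G\<^esub> a)))
    \<or> (p = 3 \<and> (\<forall>a \<in> torsion_FC_subgroup G. conjugate G (a [^]\<^bsub>G\<^esub> (2::nat)) (inv\<^bsub>G\<^esub> a)))
    \<or> torsion_FC_subgroup G = {\<one>\<^bsub>G\<^esub>}"
proof -
  interpret group G using assms(2) by (simp add: p_group_def)
  show ?thesis
    unfolding torsion_FC_eq_FC[OF assms]
    using cut_group_imp_conditions[OF assms] conditions_imp_cut_group[OF assms] by (rule iffI)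
qed

end
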